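(* Let $K$ be a field of characteristic not equal to $2$. Let $n_1,\dots,n_r$ be positive integers and $n=\sum_{i=1}^r n_i$. Let $S_n$ act on $\mathbb{A}^n_K$ by permuting the coordinates, and let $\prod_{i=1}^r S_{n_i}\subset S_n$ be the subgroup preserving the consecutive blocks of coordinates of sizes $n_1,\dots,n_r$. The EKL-degree at the origin of the quotient map $\pi\colon \mathbb{A}_K^n\big/\prod_{i=1}^r S_{n_i}\to\mathbb{A}_K^n/S_n$ (where both quotients are identified with $\mathbb{A}^n_K$ by elementary symmetric polynomials) is $$\deg_0^{\mathrm{EKL}}\pi=\frac{\deg_0\pi-a}{2}\cdot\bigl(\langle 1\rangle+\langle -1\rangle\bigr)+a\cdot\langle 1\rangle=\frac12\left(\frac{n!}{\prod_{i=1}^r n_i!}+a\right)\cdot\langle 1\rangle+\frac12\left(\frac{n!}{\prod_{i=1}^r n_i!}-a\right)\cdot\langle -1\rangle$$ in $\mathrm{GW}(K)$, where $a=\lfloor\frac n2\rfloor!\big/\prod_{i=1}^r\lfloor\frac{n_i}{2}\rfloor!$ if at most one $n_i$ is odd, and $a=0$ otherwise.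
   Context: $\mathrm{GW}(K)$ denotes the Grothendieck-Witt ring of $K$: the group completion of the semiring (under direct sum and tensor product) of isomorphism classes of nondegenerate symmetric bilinear forms on finite-dimensional $K$-vector spaces. For $u\in K^\times$, $\langle u\rangle\in\mathrm{GW}(K)$ is the class of the form $K\times K\to K$, $(x,y)\mapsto uxy$. EKL-degree. Let $f=(f_1,\dots,f_n)\colon\mathbb{A}^n\to\mathbb{A}^n$ be a morphism of $K$-varieties with $f(0)=0$ and such that $0$ is isolated in its fiber $f^{-1}(0)$. The local algebra of $f$ at $0$ is $Q(f)=K[x_1,\dots,x_n]_{m_0}/(f_1,\dots,f_n)$, where $m_0=(x_1,\dots,x_n)$; it is a finite-dimensional $K$-algebra. The distinguished socle element is $E(f)=\det(a_{ij})\in Q(f)$, where $a_{ij}\in K[x_1,\dots,x_n]$ are any polynomials with $f_i=\sum_j a_{ij}x_j$ for all $i$. For a $K$-linear functional $\phi\colon Q(f)\to K$ let $\beta_\phi$ be the symmetric bilinear form $\beta_\phi(a,b)=\phi(ab)$ on $Q(f)$. The EKL-degree $\deg_0^{\mathrm{EKL}}f\in\mathrm{GW}(K)$ is the class of $\beta_\phi$ for any $\phi$ with $\phi(E(f))=1$; it is a known fact that $\beta_\phi$ is then nondegenerate and its class is independent of the choices. The usual local degree is $\deg_0 f=\dim_K Q(f)$, the rank of $\deg_0^{\mathrm{EKL}}f$. Coordinates on the quotients. $\mathbb{A}^n_K/H$ means $\operatorname{Spec} K[x_1,\dots,x_n]^H$. The target $\mathbb{A}^n_K/S_n$ is identified with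 $\mathbb{A}^n_K$ via the elementary symmetric polynomials $e_1,\dots,e_n$ in $x_1,\dots,x_n$, in this order. The source is identified with $\mathbb{A}^n_K$ via the elementary symmetric polynomials of each block of variables: with $m_k=n_1+\dots+n_k$ and $m_0=0$ here, the coordinates are, for $k=1,\dots,r$ in order, $e_1,\dots,e_{n_k}$ in the variables $x_{m_{k-1}+1},\dots,x_{m_k}$. The map $\pi$ is induced by the inclusion $K[x_1,\dots,x_n]^{S_n}\subset K[x_1,\dots,x_n]^{\prod_i S_{n_i}}$. *)

theory Defs
  imports
    "Jordan_Normal_Form.VS_Connect"
    "HOL-Library.Poly_Mapping"
    "HOL-Algebra.QuotRing"
    "HOL-Combinatorics.Permutations"
begin

section \<open>The Grothendieck-Witt ring\<close>

definition nondeg_sym_mat :: "'a::field mat \<Rightarrow> bool" where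
  "nondeg_sym_mat A \<longleftrightarrow> square_mat A \<and> transpose_mat A = A \<and> det A \<noteq> 0"

text \<open>
  Every finite-dimensional space is isomorphic to some \<open>K\<^sup>n\<close>, so nondegenerate symmetric bilinear forms
  are represented by their Gram matrices and isometry becomes congruence of matrices.  Orthogonal
  sum and tensor product become block sum and Kronecker product.  The case \<open>n = 0\<close> is included.
\<close>

typedef (overloaded) 'a form = "{A :: 'a::field mat. nondeg_sym_mat A}"
  morphisms gram Form
  by (rule exI[of _ "1\<^sub>m 0"]) (simp add: nondeg_sym_mat_def)

setup_lifting type_definition_form

definition congruent_mat :: "'a::field mat \<Rightarrow> 'a mat \<Rightarrow> bool" where
  "congruent_mat A B \<longleftrightarrow>
     (\<exists>P\<in>carrier_mat (dim_row A) (dim_row A). det P \<noteq> 0 \<and> B = transpose_mat P * A * P)"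

definition dsum_mat :: "'a::field mat \<Rightarrow> 'a mat \<Rightarrow> 'a mat" where
  "dsum_mat A B = four_block_mat A (0\<^sub>m (dim_row A) (dim_col B)) (0\<^sub>m (dim_row B) (dim_col A)) B"

definition kron_mat :: "'a::field mat \<Rightarrow> 'a mat \<Rightarrow> 'a mat" where
  "kron_mat A B = mat (dim_row A * dim_row B) (dim_col A * dim_col B)
     (\<lambda>(i, j). A $$ (i div dim_row B, j div dim_col B) * B $$ (i mod dim_row B, j mod dim_col B))"

lemma nondeg_sym_matD:
  assumes "nondeg_sym_mat A"
  shows "A \<in> carrier_mat (dim_row A) (dim_row A)" "transpose_mat A = A" "det A \<noteq> 0"
    "dim_col A = dim_row A"
  using assms by (auto simp: nondeg_sym_mat_def)

lemma mat_inverse_ex: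
  fixes A :: "'a::field mat"
  assumes "A \<in> carrier_mat n n" "det A \<noteq> 0"
  shows "\<exists>B\<in>carrier_mat n n. A * B = 1\<^sub>m n \<and> B * A = 1\<^sub>m n \<and> det B \<noteq> 0"
proof -
  from det_non_zero_imp_unit[OF assms, of "()"]
  obtain B where B: "B \<in> carrier_mat n n" "A * B = 1\<^sub>m n" "B * A = 1\<^sub>m n"
    unfolding Units_def ring_mat_def by auto
  have "det A * det B = 1" using det_mult[OF assms(1) B(1)] B(2) by simp
  hence "det B \<noteq> 0" by auto
  thus ?thesis using B by blast
qed

lemma det_nonzeroI:
  fixes A :: "'a::field mat"
  assumes "A \<in> carrier_mat n n" "B \<in> carrier_mat n n" "A * B = 1\<^sub>m n"
  shows "det A \<noteq> 0" "det B \<noteq> 0"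
proof -
  have "det A * det B = 1" using det_mult[OF assms(1,2)] assms(3) by simp
  thus "det A \<noteq> 0" "det B \<noteq> 0" by auto
qed

lemma congruent_mat_refl:
  assumes "A \<in> carrier_mat n n" shows "congruent_mat A A"
  unfolding congruent_mat_def
  by (rule bexI[of _ "1\<^sub>m (dim_row A)"]) (use assms in auto)

lemma congruent_mat_dim:
  assumes "congruent_mat A B"
  shows "dim_row B = dim_row A"
  using assms by (auto simp: congruent_mat_def)

lemma congruent_mat_sym:
  assumes "congruent_mat A B" "A \<in> carrier_mat n n"
  shows "congruent_mat B A"
proof -
  from assms obtain P where P: "P \<in> carrier_mat n n" "det P \<noteq> 0" and B: "B = transpose_mat P * A * P"
    by (auto simp: congruent_mat_def)
  from mat_inverse_ex[OF P] obtain Q where Q: "Q \<in> carrier_mat n n" "P * Q = 1\<^sub>m n" "Q * P = 1\<^sub>m n"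
    "det Q \<noteq> 0" by blast
  have PQ: "transpose_mat Q * transpose_mat P = 1\<^sub>m n"
    using transpose_mult[OF P(1) Q(1)] Q(2) by simp
  note c = assms(2) P(1) Q(1)
  have tr: "transpose_mat P \<in> carrier_mat n n" "transpose_mat Q \<in> carrier_mat n n" using c by auto
  have "transpose_mat Q * B * Q = transpose_mat Q * ((transpose_mat P * A) * P) * Q"
    by (simp add: B)
  also have "\<dots> = (transpose_mat Q * transpose_mat P) * A * (P * Q)"
    using c tr
    by (simp add: assoc_mult_mat[of _ n n _ n _ n] mult_carrier_mat[of _ n n _ n])
  also have "\<dots> = A" unfolding PQ Q(2) using c by simp
  finally have "A = transpose_mat Q * B * Q" ..
  moreover have "dim_row B = n" using B P by simp
  ultimately show ?thesis unfolding congruent_mat_def using Q by auto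
qed

lemma congruent_mat_trans:
  assumes "congruent_mat A B" "congruent_mat B C" "A \<in> carrier_mat n n"
  shows "congruent_mat A C"
proof -
  from assms obtain P where P: "P \<in> carrier_mat n n" "det P \<noteq> 0" and B: "B = transpose_mat P * A * P"
    by (auto simp: congruent_mat_def)
  from assms(2) B P obtain Q where Q: "Q \<in> carrier_mat n n" "det Q \<noteq> 0" 
    and C: "C = transpose_mat Q * B * Q"
    by (auto simp: congruent_mat_def)
  note c = assms(3) P(1) Q(1)
  have tr: "transpose_mat P \<in> carrier_mat n n" "transpose_mat Q \<in> carrier_mat n n" using c by auto
  have "C = transpose_mat (P * Q) * A * (P * Q)"
    unfolding C B transpose_mult[OF P(1) Q(1)] using c tr
    by (simp add: assoc_mult_mat[of _ n n _ n _ n] mult_carrier_mat[of _ n n _ n])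
  moreover have "det (P * Q) \<noteq> 0" using det_mult[OF P(1) Q(1)] P Q by simp
  ultimately show ?thesis unfolding congruent_mat_def
    using c by (intro bexI[of _ "P * Q"]) auto
qed

lemma dsum_mat_carrier [simp]:
  "A \<in> carrier_mat n n \<Longrightarrow> B \<in> carrier_mat m m \<Longrightarrow> dsum_mat A B \<in> carrier_mat (n + m) (n + m)"
  by (auto simp: dsum_mat_def)

lemma dsum_mat_index:
  assumes "A \<in> carrier_mat n n" "B \<in> carrier_mat m m" "i < n + m" "j < n + m"
  shows "dsum_mat A B $$ (i, j) =
    (if i < n then if j < n then A $$ (i, j) else 0 else if j < n then 0 else B $$ (i - n, j - n))"
  using assms by (auto simp: dsum_mat_def)

lemma dsum_mat_mult:
  assumes "A \<in> carrier_mat n n" "B \<in> carrier_mat m m" "C \<in> carrier_mat n n" "D \<in> carrier_mat m m"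
  shows "dsum_mat A B * dsum_mat C D = dsum_mat (A * C) (B * D)"
proof -
  have "four_block_mat A (0\<^sub>m n m) (0\<^sub>m m n) B * four_block_mat C (0\<^sub>m n m) (0\<^sub>m m n) D
      = four_block_mat (A * C + 0\<^sub>m n m * 0\<^sub>m m n) (A * 0\<^sub>m n m + 0\<^sub>m n m * D)
          (0\<^sub>m m n * C + B * 0\<^sub>m m n) (0\<^sub>m m n * 0\<^sub>m n m + B * D)"
    by (rule mult_four_block_mat) (use assms in auto)
  thus ?thesis using assms by (simp add: dsum_mat_def)
qed

lemma dsum_mat_transpose:
  assumes "A \<in> carrier_mat n n" "B \<in> carrier_mat m m"
  shows "transpose_mat (dsum_mat A B) = dsum_mat (transpose_mat A) (transpose_mat B)"
  unfolding dsum_mat_def using assms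
  by (subst transpose_four_block_mat[of _ n n _ m _ m]) auto

lemma dsum_mat_det:
  assumes "A \<in> carrier_mat n n" "B \<in> carrier_mat m m"
  shows "det (dsum_mat A B) = det A * det B"
  unfolding dsum_mat_def using assms
  by (subst det_four_block_mat_upper_right_zero[of _ n _ m]) auto

lemma nondeg_sym_dsum:
  assumes "nondeg_sym_mat A" "nondeg_sym_mat B" shows "nondeg_sym_mat (dsum_mat A B)"
  using nondeg_sym_matD[OF assms(1)] nondeg_sym_matD[OF assms(2)]
    dsum_mat_carrier[of A _ B] dsum_mat_transpose[of A _ B] dsum_mat_det[of A _ B]
  unfolding nondeg_sym_mat_def by (metis carrier_matD mult_eq_0_iff square_mat.simps)

lemma congruent_dsum:
  assumes "congruent_mat A A'" "congruent_mat B B'" "A \<in> carrier_mat n n" "B \<in> carrier_mat m m"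
  shows "congruent_mat (dsum_mat A B) (dsum_mat A' B')"
proof -
  from assms obtain P where P: "P \<in> carrier_mat n n" "det P \<noteq> 0" "A' = transpose_mat P * A * P"
    by (auto simp: congruent_mat_def)
  from assms obtain Q where Q: "Q \<in> carrier_mat m m" "det Q \<noteq> 0" "B' = transpose_mat Q * B * Q"
    by (auto simp: congruent_mat_def)
  have tr: "transpose_mat P \<in> carrier_mat n n" "transpose_mat Q \<in> carrier_mat m m" using P Q by auto
  have "dsum_mat A' B' = transpose_mat (dsum_mat P Q) * dsum_mat A B * dsum_mat P Q"
    unfolding P(3) Q(3) dsum_mat_transpose[OF P(1) Q(1)]
    using assms(3,4) P(1) Q(1) tr by (simp add: dsum_mat_mult[of _ n _ m] mult_carrier_mat[of _ n n _ n] mult_carrier_mat[of _ m m _ m])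
  moreover have "det (dsum_mat P Q) \<noteq> 0" using dsum_mat_det[OF P(1) Q(1)] P Q by simp
  moreover have "dim_row (dsum_mat A B) = n + m" using dsum_mat_carrier[OF assms(3,4)] by auto
  ultimately show ?thesis unfolding congruent_mat_def
    using dsum_mat_carrier[OF P(1) Q(1)] by auto
qed

lemma sum_Kronecker_left:
  "a < (n::nat) \<Longrightarrow> (\<Sum>k = 0..<n. (if k = a then 1 else 0) * f k) = (f a :: 'a::field)"
  by (subst sum.cong[OF refl, of _ _ "\<lambda>k. if k = a then f k else 0"]) auto

lemma sum_Kronecker_right:
  "a < (n::nat) \<Longrightarrow> (\<Sum>k = 0..<n. f k * (if k = a then 1 else 0)) = (f a :: 'a::field)"
  by (subst sum.cong[OF refl, of _ _ "\<lambda>k. if k = a then f k else 0"]) auto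

lemma congruent_reindex:
  fixes A :: "'a::field mat"
  assumes A: "A \<in> carrier_mat n n" and \<sigma>: "inj_on \<sigma> {0..<n}" "\<And>i. i < n \<Longrightarrow> \<sigma> i < n"
    and B: "B \<in> carrier_mat n n" "\<And>i j. i < n \<Longrightarrow> j < n \<Longrightarrow> B $$ (i, j) = A $$ (\<sigma> i, \<sigma> j)"
  shows "congruent_mat A B"
proof -
  define P :: "'a mat" where "P = mat n n (\<lambda>(i, j). if i = \<sigma> j then 1 else 0)"
  have P: "P \<in> carrier_mat n n" by (simp add: P_def)
  have AP: "(A * P) $$ (i, j) = A $$ (i, \<sigma> j)" if "i < n" "j < n" for i j
    using that A \<sigma>(2)[of j] by (simp add: P_def scalar_prod_def sum_Kronecker_right)
  have "transpose_mat P * (A * P) = B"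
  proof (rule eq_matI)
    fix i j assume "i < dim_row B" "j < dim_col B"
    hence ij: "i < n" "j < n" using B by auto
    have "(transpose_mat P * (A * P)) $$ (i, j) =
       (\<Sum>k = 0..<n. (if k = \<sigma> i then 1 else 0) * (A * P) $$ (k, j))"
      using ij A P by (auto simp: scalar_prod_def P_def intro!: sum.cong)
    also have "\<dots> = B $$ (i, j)"
      using ij \<sigma>(2)[of i] by (simp add: sum_Kronecker_left AP B)
    finally show "(transpose_mat P * (A * P)) $$ (i, j) = B $$ (i, j)" .
  qed (use A B P in auto)
  hence 1: "B = transpose_mat P * A * P"
    using A P by (simp add: assoc_mult_mat[of _ n n _ n _ n])
  have "transpose_mat P * P = 1\<^sub>m n"
  proof (rule eq_matI)
    fix i j assume "i < dim_row (1\<^sub>m n :: 'a mat)" "j < dim_col (1\<^sub>m n :: 'a mat)"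
    hence ij: "i < n" "j < n" by auto
    have "(transpose_mat P * P) $$ (i, j) =
       (\<Sum>k = 0..<n. (if k = \<sigma> i then 1 else 0) * (if k = \<sigma> j then 1 else 0 :: 'a))"
      using ij by (auto simp: scalar_prod_def P_def intro!: sum.cong)
    also have "\<dots> = (if \<sigma> i = \<sigma> j then 1 else 0)"
      using ij \<sigma>(2)[of i] by (simp add: sum_Kronecker_left)
    also have "\<dots> = (1\<^sub>m n :: 'a mat) $$ (i, j)"
      using ij \<sigma>(1) by (auto simp: inj_on_def)
    finally show "(transpose_mat P * P) $$ (i, j) = (1\<^sub>m n :: 'a mat) $$ (i, j)" .
  qed (use P in auto)
  hence "det P \<noteq> 0" by (intro det_nonzeroI(2)[of "transpose_mat P" n P]) (use P in auto)
  with 1 P A show ?thesis unfolding congruent_mat_def by auto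
qed

lemma congruent_dsum_commute:
  assumes "A \<in> carrier_mat n n" "B \<in> carrier_mat m m"
  shows "congruent_mat (dsum_mat A B) (dsum_mat B A)"
proof (rule congruent_reindex[of _ "n + m" "\<lambda>i. if i < m then n + i else i - m"])
  show "dsum_mat B A \<in> carrier_mat (n + m) (n + m)"
    using dsum_mat_carrier[OF assms(2,1)] by (simp add: add.commute)
  show "dsum_mat B A $$ (i, j) =
      dsum_mat A B $$ (if i < m then n + i else i - m, if j < m then n + j else j - m)"
    if "i < n + m" "j < n + m" for i j
    using that assms
    by (cases "i < m"; cases "j < m")
      (auto simp: dsum_mat_index[OF assms] dsum_mat_index[OF assms(2,1)])
qed (use assms in \<open>auto simp: inj_on_def split: if_splits\<close>)

lemma dsum_mat_assoc: "dsum_mat (dsum_mat A B) C = dsum_mat A (dsum_mat B C)"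
  unfolding dsum_mat_def by (rule assoc_four_block_mat[symmetric])

lemma dsum_mat_zero: "A \<in> carrier_mat n n \<Longrightarrow> dsum_mat (1\<^sub>m 0) A = A"
  by (rule eq_matI) (auto simp: dsum_mat_def)

lemma kron_mat_carrier [simp]:
  "A \<in> carrier_mat n n \<Longrightarrow> B \<in> carrier_mat m m \<Longrightarrow> kron_mat A B \<in> carrier_mat (n * m) (n * m)"
  by (auto simp: kron_mat_def)

lemma kron_mat_index:
  assumes "A \<in> carrier_mat n n" "B \<in> carrier_mat m m" "i < n * m" "j < n * m"
  shows "kron_mat A B $$ (i, j) = A $$ (i div m, j div m) * B $$ (i mod m, j mod m)"
  using assms by (auto simp: kron_mat_def)

lemma div_mod_less:
  assumes "(i::nat) < n * m" shows "i div m < n" "i mod m < m"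
  using assms by (auto simp: less_mult_imp_div_less mult.commute intro!: mod_less_divisor gr0I)

lemma div_mod_inj: "(i::nat) div m = j div m \<Longrightarrow> i mod m = j mod m \<Longrightarrow> i = j"
  by (metis div_mult_mod_eq)

lemma sum_div_mod:
  "(\<Sum>k = 0..<n * m. f (k div m) (k mod m)) = (\<Sum>a = 0..<n. \<Sum>b = 0..<(m::nat). f a b)"
proof -
  have "bij_betw (\<lambda>k. (k div m, k mod m)) {0..<n * m} ({0..<n} \<times> {0..<m})"
  proof (rule bij_betw_byWitness[of _ "\<lambda>(a, b). a * m + b"])
    show "(\<lambda>(a, b). a * m + b) ` ({0..<n} \<times> {0..<m}) \<subseteq> {0..<n * m}"
    proof clarsimp
      fix a b assume "a < n" "b < m"
      hence "a * m + b < Suc a * m" by simp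
      also have "\<dots> \<le> n * m" using \<open>a < n\<close> by (intro mult_right_mono) auto
      finally show "a * m + b < n * m" .
    qed
  qed (auto simp: div_mod_less)
  from sum.reindex_bij_betw[OF this, of "\<lambda>(a, b). f a b"] show ?thesis
    by (simp add: sum.cartesian_product)
qed

lemma kron_mat_mult:
  assumes "A \<in> carrier_mat n n" "B \<in> carrier_mat m m" "C \<in> carrier_mat n n" "D \<in> carrier_mat m m"
  shows "kron_mat A B * kron_mat C D = kron_mat (A * C) (B * D)"
proof (rule eq_matI)
  have c: "kron_mat A B \<in> carrier_mat (n * m) (n * m)" "kron_mat C D \<in> carrier_mat (n * m) (n * m)"
    "kron_mat (A * C) (B * D) \<in> carrier_mat (n * m) (n * m)" using assms by auto
  show "dim_row (kron_mat A B * kron_mat C D) = dim_row (kron_mat (A * C) (B * D))"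
    "dim_col (kron_mat A B * kron_mat C D) = dim_col (kron_mat (A * C) (B * D))"
    using c by auto
  fix i j assume "i < dim_row (kron_mat (A * C) (B * D))" "j < dim_col (kron_mat (A * C) (B * D))"
  hence ij: "i < n * m" "j < n * m" using c by auto
  note dm = div_mod_less[OF ij(1)] div_mod_less[OF ij(2)]
  have "(kron_mat A B * kron_mat C D) $$ (i, j) =
    (\<Sum>k = 0..<n * m. kron_mat A B $$ (i, k) * kron_mat C D $$ (k, j))"
    using ij c by (auto simp: scalar_prod_def)
  also have "\<dots> = (\<Sum>k = 0..<n * m. (\<lambda>a b. (A $$ (i div m, a) * C $$ (a, j div m)) * 
      (B $$ (i mod m, b) * D $$ (b, j mod m))) (k div m) (k mod m))"
    using ij assms by (intro sum.cong) (auto simp: kron_mat_index[of _ n _ m])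
  also have "\<dots> = (\<Sum>a = 0..<n. \<Sum>b = 0..<m. (A $$ (i div m, a) * C $$ (a, j div m)) * 
      (B $$ (i mod m, b) * D $$ (b, j mod m)))"
    by (rule sum_div_mod)
  also have "\<dots> = (A * C) $$ (i div m, j div m) * (B * D) $$ (i mod m, j mod m)"
    using dm assms by (simp add: scalar_prod_def sum_product)
  also have "\<dots> = kron_mat (A * C) (B * D) $$ (i, j)"
    using ij assms by (simp add: kron_mat_index[of _ n _ m])
  finally show "(kron_mat A B * kron_mat C D) $$ (i, j) = kron_mat (A * C) (B * D) $$ (i, j)" .
qed

lemma kron_mat_transpose:
  "transpose_mat (kron_mat A B) = kron_mat (transpose_mat A) (transpose_mat B)"
  by (rule eq_matI) (auto simp: kron_mat_def div_mod_less)

lemma kron_mat_one: "kron_mat (1\<^sub>m n) (1\<^sub>m m) = (1\<^sub>m (n * m) :: 'a::field mat)"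
  by (rule eq_matI) (auto simp: kron_mat_def div_mod_less dest: div_mod_inj)

lemma kron_mat_det:
  assumes "A \<in> carrier_mat n n" "B \<in> carrier_mat m m" "det A \<noteq> 0" "det B \<noteq> 0"
  shows "det (kron_mat A B) \<noteq> 0"
proof -
  obtain A' B' where "A' \<in> carrier_mat n n" "A * A' = 1\<^sub>m n" "B' \<in> carrier_mat m m" "B * B' = 1\<^sub>m m"
    using mat_inverse_ex[OF assms(1,3)] mat_inverse_ex[OF assms(2,4)] by blast
  thus ?thesis
    using assms by (intro det_nonzeroI(1)[of _ "n * m" "kron_mat A' B'"])
      (auto simp: kron_mat_mult[of _ n _ m] kron_mat_one)
qed

lemma nondeg_sym_kron:
  assumes "nondeg_sym_mat A" "nondeg_sym_mat B" shows "nondeg_sym_mat (kron_mat A B)"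
  using nondeg_sym_matD[OF assms(1)] nondeg_sym_matD[OF assms(2)]
    kron_mat_carrier[of A _ B] kron_mat_transpose[of A B] kron_mat_det[of A _ B]
  unfolding nondeg_sym_mat_def by (metis carrier_matD square_mat.simps)

lemma congruent_kron:
  assumes "congruent_mat A A'" "congruent_mat B B'" "A \<in> carrier_mat n n" "B \<in> carrier_mat m m"
  shows "congruent_mat (kron_mat A B) (kron_mat A' B')"
proof -
  from assms obtain P where P: "P \<in> carrier_mat n n" "det P \<noteq> 0" "A' = transpose_mat P * A * P"
    by (auto simp: congruent_mat_def)
  from assms obtain Q where Q: "Q \<in> carrier_mat m m" "det Q \<noteq> 0" "B' = transpose_mat Q * B * Q"
    by (auto simp: congruent_mat_def)
  have tr: "transpose_mat P \<in> carrier_mat n n" "transpose_mat Q \<in> carrier_mat m m" using P Q by auto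
  have "kron_mat A' B' = transpose_mat (kron_mat P Q) * kron_mat A B * kron_mat P Q"
    unfolding P(3) Q(3) kron_mat_transpose
    using assms(3,4) P(1) Q(1) tr
    by (simp add: kron_mat_mult[of _ n _ m] mult_carrier_mat[of _ n n _ n] mult_carrier_mat[of _ m m _ m])
  moreover have "det (kron_mat P Q) \<noteq> 0" by (rule kron_mat_det[OF P(1) Q(1) P(2) Q(2)])
  moreover have "dim_row (kron_mat A B) = n * m" using kron_mat_carrier[OF assms(3,4)] by auto
  ultimately show ?thesis unfolding congruent_mat_def
    using kron_mat_carrier[OF P(1) Q(1)] by auto
qed

lemma congruent_kron_commute:
  assumes "A \<in> carrier_mat n n" "B \<in> carrier_mat m m"
  shows "congruent_mat (kron_mat A B) (kron_mat B A)"
proof (rule congruent_reindex[of _ "n * m" "\<lambda>i. (i mod n) * m + i div n"])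
  have *: "(i mod n) * m + i div n < n * m" "((i mod n) * m + i div n) div m = i mod n"
    "((i mod n) * m + i div n) mod m = i div n" if "i < n * m" for i
  proof -
    have i: "i div n < m" "i mod n < n" using div_mod_less[of i m n] that by (auto simp: mult.commute)
    have "(i mod n) * m + i div n < Suc (i mod n) * m" using i by simp
    also have "\<dots> \<le> n * m" using i by (intro mult_right_mono) auto
    finally show "(i mod n) * m + i div n < n * m" .
    show "((i mod n) * m + i div n) div m = i mod n" "((i mod n) * m + i div n) mod m = i div n"
      using i by auto
  qed
  show "inj_on (\<lambda>i. i mod n * m + i div n) {0..<n * m}"
    by (rule inj_onI) (metis * atLeastLessThan_iff div_mod_inj)
  show "i mod n * m + i div n < n * m" if "i < n * m" for i using * that by blast
  show "kron_mat B A \<in> carrier_mat (n * m) (n * m)"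
    using kron_mat_carrier[OF assms(2,1)] by (simp add: mult.commute)
  show "kron_mat B A $$ (i, j) = kron_mat A B $$ (i mod n * m + i div n, j mod n * m + j div n)"
    if "i < n * m" "j < n * m" for i j
    using that assms *[of i] *[of j]
    by (simp add: kron_mat_index[of _ n _ m] kron_mat_index[of B m A n] mult.commute)
qed (use assms in auto)

lemma mod_div_mult:
  fixes i b c :: nat
  shows "i mod (b * c) div c = i div c mod b"
proof (cases "c = 0")
  case False
  thus ?thesis using mod_mult2_eq[of i c b] by (simp add: mult.commute[of b c])
qed simp

lemma kron_mat_assoc:
  "kron_mat (kron_mat A B) C = kron_mat A (kron_mat B C)"
proof (rule eq_matI)
  fix i j
  assume "i < dim_row (kron_mat A (kron_mat B C))" "j < dim_col (kron_mat A (kron_mat B C))"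
  hence i: "i < dim_row A * (dim_row B * dim_row C)" and j: "j < dim_col A * (dim_col B * dim_col C)"
    by (simp_all add: kron_mat_def)
  hence i': "i < dim_row A * dim_row B * dim_row C" and j': "j < dim_col A * dim_col B * dim_col C"
    by (simp_all add: mult.assoc)
  note lt = div_mod_less[OF i] div_mod_less[OF j] div_mod_less(1)[OF i'] div_mod_less(1)[OF j']
  have e: "k div (b * c) = k div c div b" for k b c :: nat
    by (simp add: div_mult2_eq mult.commute[of b c])
  show "kron_mat (kron_mat A B) C $$ (i, j) = kron_mat A (kron_mat B C) $$ (i, j)"
    using i j i' j' lt
    by (simp add: kron_mat_def mod_div_mult e mod_mod_cancel mult.assoc)
qed (simp_all add: kron_mat_def mult.assoc)

lemma kron_mat_one_left: "kron_mat (1\<^sub>m 1) A = A"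
  by (rule eq_matI) (auto simp: kron_mat_def)

lemma kron_dsum_distrib:
  assumes "A \<in> carrier_mat n n" "B \<in> carrier_mat m m" "C \<in> carrier_mat l l"
  shows "kron_mat (dsum_mat A B) C = dsum_mat (kron_mat A C) (kron_mat B C)"
proof (rule eq_matI)
  have c: "kron_mat (dsum_mat A B) C \<in> carrier_mat ((n + m) * l) ((n + m) * l)"
    "dsum_mat (kron_mat A C) (kron_mat B C) \<in> carrier_mat (n * l + m * l) (n * l + m * l)"
    using assms by auto
  thus "dim_row (kron_mat (dsum_mat A B) C) = dim_row (dsum_mat (kron_mat A C) (kron_mat B C))"
    "dim_col (kron_mat (dsum_mat A B) C) = dim_col (dsum_mat (kron_mat A C) (kron_mat B C))"
    by (auto simp: distrib_right)
  fix i j assume "i < dim_row (dsum_mat (kron_mat A C) (kron_mat B C))"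
    "j < dim_col (dsum_mat (kron_mat A C) (kron_mat B C))"
  hence ij: "i < n * l + m * l" "j < n * l + m * l" using c by auto
  hence l: "l > 0" by (auto intro: gr0I)
  have shift: "(k - n * l) div l = k div l - n" "(k - n * l) mod l = k mod l" "k - n * l < m * l"
    if "\<not> k < n * l" "k < n * l + m * l" for k
  proof -
    define e where "e = k - n * l"
    hence d: "k = n * l + e" using that(1) by simp
    show "(k - n * l) div l = k div l - n" "(k - n * l) mod l = k mod l" "k - n * l < m * l"
      using l that by (auto simp: d)
  qed
  have lt: "k div l < n \<longleftrightarrow> k < n * l" for k using l by (simp add: div_less_iff_less_mult)
  have nm: "k div l < n + m" if "k < n * l + m * l" for k
    using that l by (simp add: div_less_iff_less_mult distrib_right)
  have ij': "i < (n + m) * l" "j < (n + m) * l" using ij by (simp_all add: distrib_right)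
  have D: "kron_mat (dsum_mat A B) C $$ (i, j) =
      dsum_mat A B $$ (i div l, j div l) * C $$ (i mod l, j mod l)"
    using assms ij' by (intro kron_mat_index[of _ "n + m"]) auto
  have E: "dsum_mat A B $$ (i div l, j div l) =
     (if i < n * l then if j < n * l then A $$ (i div l, j div l) else 0
      else if j < n * l then 0 else B $$ (i div l - n, j div l - n))"
    using dsum_mat_index[OF assms(1,2) nm[OF ij(1)] nm[OF ij(2)]] unfolding lt .
  have F: "dsum_mat (kron_mat A C) (kron_mat B C) $$ (i, j) =
     (if i < n * l then if j < n * l then kron_mat A C $$ (i, j) else 0
      else if j < n * l then 0 else kron_mat B C $$ (i - n * l, j - n * l))"
    by (rule dsum_mat_index) (use assms ij in auto)
  show "kron_mat (dsum_mat A B) C $$ (i, j) = dsum_mat (kron_mat A C) (kron_mat B C) $$ (i, j)"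
  proof (cases "i < n * l"; cases "j < n * l")
    assume "i < n * l" "j < n * l"
    thus ?thesis unfolding D E F using kron_mat_index[OF assms(1,3)] by simp
  next
    assume "\<not> i < n * l" "\<not> j < n * l"
    thus ?thesis unfolding D E F
      using kron_mat_index[OF assms(2,3) shift(3)[of i] shift(3)[of j]] ij
      by (simp add: shift(1,2))
  qed (simp_all add: D E F)
qed

lemma form_gram: "nondeg_sym_mat (gram F)" using gram by blast

lemma form_gram_carrier: "gram F \<in> carrier_mat (dim_row (gram F)) (dim_row (gram F))"
  using nondeg_sym_matD(1)[OF form_gram] .

lift_definition form_isometric :: "'a::field form \<Rightarrow> 'a form \<Rightarrow> bool" is congruent_mat .

lift_definition zero_form :: "'a::field form" is "1\<^sub>m 0" by (simp add: nondeg_sym_mat_def)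

lift_definition one_form :: "'a::field form" is "1\<^sub>m 1" by (simp add: nondeg_sym_mat_def)

lift_definition dsum_form :: "'a::field form \<Rightarrow> 'a form \<Rightarrow> 'a form" is dsum_mat
  by (rule nondeg_sym_dsum)

lift_definition tensor_form :: "'a::field form \<Rightarrow> 'a form \<Rightarrow> 'a form" is kron_mat
  by (rule nondeg_sym_kron)

quotient_type (overloaded) 'a form_class = "'a::field form" / form_isometric
proof (rule equivpI)
  show "reflp form_isometric"
    unfolding reflp_def form_isometric.rep_eq by (blast intro: congruent_mat_refl form_gram_carrier)
  show "symp form_isometric"
    unfolding symp_def form_isometric.rep_eq by (blast intro: congruent_mat_sym form_gram_carrier)
  show "transp form_isometric"
    unfolding transp_def form_isometric.rep_eq by (blast intro: congruent_mat_trans form_gram_carrier)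
qed

instantiation form_class :: (field) comm_semiring_1
begin

lift_definition zero_form_class :: "'a form_class" is zero_form .
lift_definition one_form_class :: "'a form_class" is one_form .
lift_definition plus_form_class :: "'a form_class \<Rightarrow> 'a form_class \<Rightarrow> 'a form_class" is dsum_form
  unfolding form_isometric.rep_eq dsum_form.rep_eq by (blast intro: congruent_dsum form_gram_carrier)
lift_definition times_form_class :: "'a form_class \<Rightarrow> 'a form_class \<Rightarrow> 'a form_class" is tensor_form
  unfolding form_isometric.rep_eq tensor_form.rep_eq by (blast intro: congruent_kron form_gram_carrier)

instance
proof
  fix a b c :: "'a form_class"
  show "a + b + c = a + (b + c)"
    by transfer (simp add: form_isometric.rep_eq dsum_form.rep_eq dsum_mat_assoc,
      metis congruent_mat_refl dsum_form.rep_eq form_gram_carrier)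
  show "a + b = b + a"
    by transfer (simp add: form_isometric.rep_eq dsum_form.rep_eq,
      blast intro: congruent_dsum_commute form_gram_carrier)
  show "0 + a = a"
    by transfer (simp add: form_isometric.rep_eq dsum_form.rep_eq zero_form.rep_eq
      dsum_mat_zero[OF form_gram_carrier] congruent_mat_refl[OF form_gram_carrier])
  show "a * b * c = a * (b * c)"
    by transfer (simp add: form_isometric.rep_eq tensor_form.rep_eq kron_mat_assoc,
      metis congruent_mat_refl tensor_form.rep_eq form_gram_carrier)
  show "a * b = b * a"
    by transfer (simp add: form_isometric.rep_eq tensor_form.rep_eq,
      blast intro: congruent_kron_commute form_gram_carrier)
  show "1 * a = a"
    by transfer (simp only: form_isometric.rep_eq tensor_form.rep_eq one_form.rep_eq
      kron_mat_one_left congruent_mat_refl[OF form_gram_carrier])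
  show "(a + b) * c = a * c + b * c"
    by transfer (simp add: form_isometric.rep_eq tensor_form.rep_eq dsum_form.rep_eq
      kron_dsum_distrib[OF form_gram_carrier form_gram_carrier form_gram_carrier],
      metis congruent_mat_refl tensor_form.rep_eq dsum_form.rep_eq form_gram_carrier)
  have k0: "kron_mat (1\<^sub>m 0) A = 1\<^sub>m 0" "kron_mat A (1\<^sub>m 0) = 1\<^sub>m 0" for A :: "'a mat"
    by (rule eq_matI; simp add: kron_mat_def)+
  show "0 * a = 0"
    by transfer (simp add: form_isometric.rep_eq tensor_form.rep_eq zero_form.rep_eq k0
        congruent_mat_refl[of _ 0])
  show "a * 0 = 0"
    by transfer (simp add: form_isometric.rep_eq tensor_form.rep_eq zero_form.rep_eq k0
        congruent_mat_refl[of _ 0])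
  show "(0::'a form_class) \<noteq> 1"
    by transfer (auto simp: form_isometric.rep_eq zero_form.rep_eq one_form.rep_eq
        dest: congruent_mat_dim)
qed

end

lift_definition form_rank :: "'a::field form_class \<Rightarrow> nat" is "\<lambda>F. dim_row (gram F)"
  by (simp add: form_isometric.rep_eq congruent_mat_dim)

lemma form_rank_simps [simp]:
  "form_rank 0 = 0" "form_rank 1 = 1" "form_rank (x + y) = form_rank x + form_rank y"
  by (transfer; simp add: zero_form.rep_eq one_form.rep_eq dsum_form.rep_eq dsum_mat_def)+

text \<open>
  Group completion of the semiring of isometry classes; the extra summand \<open>e\<close> makes the relation
  transitive without appealing to Witt cancellation.
\<close>

definition gw_eq :: "'a::field form_class \<times> 'a form_class \<Rightarrow> 'a form_class \<times> 'a form_class \<Rightarrow> bool" where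
  "gw_eq = (\<lambda>(a, b) (c, d). \<exists>e. a + d + e = c + b + e)"

quotient_type (overloaded) 'a gw = "'a::field form_class \<times> 'a form_class" / gw_eq
proof (rule equivpI)
  show "reflp gw_eq" by (auto simp: reflp_def gw_eq_def)
  show "symp gw_eq" by (auto simp: symp_def gw_eq_def) metis
  show "transp gw_eq"
  proof (rule transpI)
    fix p q r
    assume "gw_eq p q" "gw_eq q r"
    moreover obtain a b c d e f where pqr: "p = (a, b)" "q = (c, d)" "r = (e, f)"
      by (cases p, cases q, cases r)
    ultimately obtain x y where 1: "a + d + x = c + b + x" and 2: "c + f + y = e + d + y"
      by (auto simp: gw_eq_def)
    have "a + f + (x + y + d) = (a + d + x) + f + y" by (simp add: ac_simps)
    also have "\<dots> = (c + f + y) + b + x" unfolding 1 by (simp add: ac_simps)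
    also have "\<dots> = e + b + (x + y + d)" unfolding 2 by (simp add: ac_simps)
    finally show "gw_eq p r" by (auto simp: gw_eq_def pqr)
  qed
qed

instantiation gw :: (field) comm_ring_1
begin

lift_definition zero_gw :: "'a gw" is "(0, 0)" .
lift_definition one_gw :: "'a gw" is "(1, 0)" .
lift_definition plus_gw :: "'a gw \<Rightarrow> 'a gw \<Rightarrow> 'a gw" is "\<lambda>(a, b) (c, d). (a + c, b + d)"
proof (clarsimp simp: gw_eq_def)
  fix a b c d a' b' c' d' x y :: "'a form_class"
  assume 1: "a + d + x = c + b + x" and 2: "a' + d' + y = c' + b' + y"
  have "a + a' + (d + d') + (x + y) = (a + d + x) + (a' + d' + y)" by (simp add: ac_simps)
  also have "\<dots> = c + c' + (b + b') + (x + y)" unfolding 1 2 by (simp add: ac_simps)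
  finally show "\<exists>z. a + a' + (d + d') + z = c + c' + (b + b') + z" by blast
qed
lift_definition uminus_gw :: "'a gw \<Rightarrow> 'a gw" is "\<lambda>(a, b). (b, a)"
  by (auto simp: gw_eq_def ac_simps) metis
definition minus_gw :: "'a gw \<Rightarrow> 'a gw \<Rightarrow> 'a gw" where "minus_gw x y = x + - y"
lift_definition times_gw :: "'a gw \<Rightarrow> 'a gw \<Rightarrow> 'a gw" is
  "\<lambda>(a, b) (c, d). (a * c + b * d, a * d + b * c)"
proof (clarsimp simp: gw_eq_def)
  fix a b c d a' b' c' d' x y :: "'a form_class"
  assume 1: "a + d + x = c + b + x" and 2: "a' + d' + y = c' + b' + y"
  let ?u = "(a + d + x) * a' + (c + b + x) * b' + c * (a' + d' + y) + d * (c' + b' + y)"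
  let ?v = "(c + b + x) * a' + (a + d + x) * b' + c * (c' + b' + y) + d * (a' + d' + y)"
  let ?z = "d * a' + x * a' + c * b' + x * b' + c * a' + c * y + d * b' + d * y"
  have "a * a' + b * b' + (c * d' + d * c') + ?z = ?u" by (simp add: algebra_simps)
  also have "\<dots> = ?v" unfolding 1 2 ..
  also have "\<dots> = c * c' + d * d' + (a * b' + b * a') + ?z" by (simp add: algebra_simps)
  finally show "\<exists>z. a * a' + b * b' + (c * d' + d * c') + z = c * c' + d * d' + (a * b' + b * a') + z"
    by blast
qed

instance
proof
  fix a b c :: "'a gw"
  show "a + b + c = a + (b + c)" by transfer (auto simp: gw_eq_def algebra_simps)
  show "a + b = b + a" by transfer (auto simp: gw_eq_def algebra_simps)
  show "0 + a = a" by transfer (auto simp: gw_eq_def)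
  show "- a + a = 0" by transfer (auto simp: gw_eq_def algebra_simps)
  show "a - b = a + - b" by (rule minus_gw_def)
  show "a * b * c = a * (b * c)" by transfer (auto simp: gw_eq_def algebra_simps)
  show "a * b = b * a" by transfer (auto simp: gw_eq_def algebra_simps)
  show "1 * a = a" by transfer (auto simp: gw_eq_def)
  show "(a + b) * c = a * c + b * c" by transfer (auto simp: gw_eq_def algebra_simps)
  have "\<not> (0 + 0 + e = 1 + 0 + e)" for e :: "'a form_class"
    by (auto dest: arg_cong[of _ _ form_rank])
  thus "(0::'a gw) \<noteq> 1" by transfer (auto simp: gw_eq_def)
qed

end

definition gw_of_class :: "'a::field form_class \<Rightarrow> 'a gw" where
  "gw_of_class c = abs_gw (c, 0)"

text \<open>
  Meaningful only for nondegenerate symmetric \<open>A\<close> (respectively \<open>u \<noteq> 0\<close>).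
\<close>

definition gw_of_mat :: "'a::field mat \<Rightarrow> 'a gw" where
  "gw_of_mat A = gw_of_class (abs_form_class (Form A))"

definition gw_unit :: "'a::field \<Rightarrow> 'a gw" where
  "gw_unit u = gw_of_mat (mat 1 1 (\<lambda>_. u))"


section \<open>Polynomials\<close>

text \<open>
  Polynomials in countably many variables \<open>x\<^sub>0, x\<^sub>1, \<dots>\<close>; \<open>mpolys n\<close> is the subring \<open>K[x\<^sub>0, \<dots>, x\<^sub>n\<^sub>-\<^sub>1]\<close>.
  Variables are numbered from 0 throughout, and a morphism from affine \<open>n\<close>-space to itself is a
  family \<open>f\<close> of which only \<open>f 0, \<dots>, f (n - 1)\<close> (elements of \<open>mpolys n\<close>) matter.
\<close>

type_synonym 'a mpoly = "(nat \<Rightarrow>\<^sub>0 nat) \<Rightarrow>\<^sub>0 'a"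

definition mpolys :: "nat \<Rightarrow> 'a::field mpoly set" where
  "mpolys n = {p. \<forall>m\<in>Poly_Mapping.keys p. Poly_Mapping.keys m \<subseteq> {..<n}}"

definition mconst :: "'a::field \<Rightarrow> 'a mpoly" where
  "mconst c = Poly_Mapping.single 0 c"

definition mvar :: "nat \<Rightarrow> 'a::field mpoly" where
  "mvar i = Poly_Mapping.single (Poly_Mapping.single i 1) 1"

definition mpoly_subst :: "(nat \<Rightarrow> 'a mpoly) \<Rightarrow> 'a::field mpoly \<Rightarrow> 'a mpoly" where
  "mpoly_subst g p = (\<Sum>m\<in>Poly_Mapping.keys p. mconst (Poly_Mapping.lookup p m) * (\<Prod>i\<in>Poly_Mapping.keys m. g i ^ Poly_Mapping.lookup m i))"

lemma mconst_simps [simp]: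
  "mconst 0 = 0" "mconst 1 = 1" "mconst (a + b) = mconst a + mconst b"
  "mconst (a * b) = mconst a * mconst b"
  by (simp_all add: mconst_def single_add mult_single)

lemma mpoly_subst_superset:
  assumes "finite S" "Poly_Mapping.keys p \<subseteq> S"
  shows "mpoly_subst g p = (\<Sum>m\<in>S. mconst (Poly_Mapping.lookup p m) * (\<Prod>i\<in>Poly_Mapping.keys m. g i ^ Poly_Mapping.lookup m i))"
  unfolding mpoly_subst_def
  by (rule sum.mono_neutral_left) (use assms in \<open>auto simp: in_keys_iff\<close>)

lemma mpoly_subst_add: "mpoly_subst g (p + q) = mpoly_subst g p + mpoly_subst g q"
proof -
  let ?S = "Poly_Mapping.keys p \<union> Poly_Mapping.keys q"
  have "Poly_Mapping.keys (p + q) \<subseteq> ?S" by (rule Poly_Mapping.keys_add)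
  thus ?thesis
    by (simp add: mpoly_subst_superset[of ?S] lookup_add distrib_right sum.distrib)
qed

lemma mpoly_subst_0 [simp]: "mpoly_subst g 0 = 0"
  by (simp add: mpoly_subst_def)

lemma mpoly_subst_sum: "mpoly_subst g (\<Sum>x\<in>X. f x) = (\<Sum>x\<in>X. mpoly_subst g (f x))"
  by (induction X rule: infinite_finite_induct) (simp_all add: mpoly_subst_add)

lemma mpoly_subst_single:
  "mpoly_subst g (Poly_Mapping.single m c) = mconst c * (\<Prod>i\<in>Poly_Mapping.keys m. g i ^ Poly_Mapping.lookup m i)"
  by (simp add: mpoly_subst_def)

lemma monom_power_add:
  fixes g :: "nat \<Rightarrow> 'b::comm_monoid_mult"
  shows "(\<Prod>i\<in>Poly_Mapping.keys (m + m'). g i ^ Poly_Mapping.lookup (m + m') i) =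
    (\<Prod>i\<in>Poly_Mapping.keys m. g i ^ Poly_Mapping.lookup m i) * (\<Prod>i\<in>Poly_Mapping.keys m'. g i ^ Poly_Mapping.lookup m' i)"
proof -
  let ?S = "Poly_Mapping.keys m \<union> Poly_Mapping.keys m'"
  have e: "(\<Prod>i\<in>Poly_Mapping.keys k. g i ^ Poly_Mapping.lookup k i) = (\<Prod>i\<in>?S. g i ^ Poly_Mapping.lookup k i)" if "Poly_Mapping.keys k \<subseteq> ?S" for k :: "nat \<Rightarrow>\<^sub>0 nat"
    by (rule prod.mono_neutral_left) (use that in \<open>auto simp: in_keys_iff\<close>)
  have "(\<Prod>i\<in>Poly_Mapping.keys (m + m'). g i ^ Poly_Mapping.lookup (m + m') i) = (\<Prod>i\<in>?S. g i ^ Poly_Mapping.lookup (m + m') i)"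
    by (rule e[OF Poly_Mapping.keys_add])
  also have "\<dots> = (\<Prod>i\<in>?S. g i ^ Poly_Mapping.lookup m i) * (\<Prod>i\<in>?S. g i ^ Poly_Mapping.lookup m' i)"
    by (simp add: lookup_add power_add prod.distrib)
  finally show ?thesis by (simp add: e)
qed

lemma mpoly_sum_monomials: "(\<Sum>m\<in>Poly_Mapping.keys p. Poly_Mapping.single m (Poly_Mapping.lookup p m)) = p"
  by (rule poly_mapping_eqI)
     (auto simp: lookup_sum lookup_single when_def in_keys_iff)

lemma mpoly_subst_mult: "mpoly_subst g (p * q) = mpoly_subst g p * mpoly_subst g q"
proof -
  have "p * q = (\<Sum>m\<in>Poly_Mapping.keys p. \<Sum>k\<in>Poly_Mapping.keys q. Poly_Mapping.single (m + k) (Poly_Mapping.lookup p m * Poly_Mapping.lookup q k))"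
    by (subst (1) mpoly_sum_monomials[symmetric, of p], subst (1) mpoly_sum_monomials[symmetric, of q])
      (simp add: sum_product mult_single)
  hence "mpoly_subst g (p * q) = (\<Sum>m\<in>Poly_Mapping.keys p. \<Sum>k\<in>Poly_Mapping.keys q.
      mpoly_subst g (Poly_Mapping.single (m + k) (Poly_Mapping.lookup p m * Poly_Mapping.lookup q k)))"
    by (simp add: mpoly_subst_sum)
  also have "\<dots> = mpoly_subst g p * mpoly_subst g q"
    unfolding mpoly_subst_single monom_power_add mpoly_subst_def[of g p] mpoly_subst_def[of g q]
    by (simp add: sum_product mult_ac)
  finally show ?thesis .
qed

lemma mpoly_subst_1 [simp]: "mpoly_subst g 1 = 1"
  using mpoly_subst_single[of g 0 1] by simp

lemma mpoly_subst_prod: "mpoly_subst g (\<Prod>x\<in>X. f x) = (\<Prod>x\<in>X. mpoly_subst g (f x))"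
  by (induction X rule: infinite_finite_induct) (simp_all add: mpoly_subst_mult)

lemma mpoly_subst_power: "mpoly_subst g (p ^ k) = mpoly_subst g p ^ k"
  by (induction k) (simp_all add: mpoly_subst_mult)

lemma mpoly_subst_mconst [simp]: "mpoly_subst g (mconst c) = mconst c"
  unfolding mconst_def by (simp add: mpoly_subst_single mconst_def)

lemma mpoly_subst_mvar [simp]: "mpoly_subst g (mvar i) = g i"
  unfolding mvar_def by (simp add: mpoly_subst_single)

lemma mpoly_subst_subst:
  "mpoly_subst h (mpoly_subst g p) = mpoly_subst (\<lambda>i. mpoly_subst h (g i)) p"
  unfolding mpoly_subst_def[of g p] mpoly_subst_def[of "\<lambda>i. mpoly_subst h (g i)" p]
  by (simp add: mpoly_subst_sum mpoly_subst_mult mpoly_subst_prod mpoly_subst_power)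

lemma mpoly_subst_cong:
  assumes "p \<in> mpolys n" "\<And>i. i < n \<Longrightarrow> g i = h i"
  shows "mpoly_subst g p = mpoly_subst h p"
  unfolding mpoly_subst_def
  by (intro sum.cong prod.cong arg_cong2[of _ _ _ _ "(*)"] arg_cong2[of _ _ _ _ "(^)"] refl)
    (use assms in \<open>auto simp: mpolys_def\<close>)

lemma mpolys_add: "p \<in> mpolys n \<Longrightarrow> q \<in> mpolys n \<Longrightarrow> p + q \<in> mpolys n"
  using Poly_Mapping.keys_add[of p q] by (auto simp: mpolys_def)

lemma mpolys_uminus: "p \<in> mpolys n \<Longrightarrow> - p \<in> mpolys n"
  by (auto simp: mpolys_def)

lemma mpolys_mult: "p \<in> mpolys n \<Longrightarrow> q \<in> mpolys n \<Longrightarrow> p * q \<in> mpolys n"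
proof (unfold mpolys_def, clarify)
  fix m i
  assume *: "\<forall>m\<in>Poly_Mapping.keys p. Poly_Mapping.keys m \<subseteq> {..<n}" "\<forall>m\<in>Poly_Mapping.keys q. Poly_Mapping.keys m \<subseteq> {..<n}"
    "m \<in> Poly_Mapping.keys (p * q)" "i \<in> Poly_Mapping.keys m"
  then obtain a b where "m = a + b" "a \<in> Poly_Mapping.keys p" "b \<in> Poly_Mapping.keys q"
    using keys_mult[of p q] by auto
  thus "i < n" using * Poly_Mapping.keys_add[of a b] by blast
qed

lemma mpolys_0 [simp]: "0 \<in> mpolys n" and mpolys_1 [simp]: "1 \<in> mpolys n"
  by (auto simp: mpolys_def)

lemma mpolys_mconst [simp]: "mconst c \<in> mpolys n"
  by (auto simp: mpolys_def mconst_def)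

lemma mpolys_mvar: "i < n \<Longrightarrow> mvar i \<in> mpolys n"
  by (auto simp: mpolys_def mvar_def)

lemma mpolys_sum: "(\<And>x. x \<in> X \<Longrightarrow> f x \<in> mpolys n) \<Longrightarrow> (\<Sum>x\<in>X. f x) \<in> mpolys n"
  by (induction X rule: infinite_finite_induct) (simp_all add: mpolys_add)

lemma mpolys_prod: "(\<And>x. x \<in> X \<Longrightarrow> f x \<in> mpolys n) \<Longrightarrow> (\<Prod>x\<in>X. f x) \<in> mpolys n"
  by (induction X rule: infinite_finite_induct) (simp_all add: mpolys_mult)

lemma mpolys_power: "p \<in> mpolys n \<Longrightarrow> p ^ k \<in> mpolys n"
  by (induction k) (simp_all add: mpolys_mult)

lemma mpolys_subst:
  assumes "p \<in> mpolys n" "\<And>i. i < n \<Longrightarrow> g i \<in> mpolys m"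
  shows "mpoly_subst g p \<in> mpolys m"
  unfolding mpoly_subst_def
  by (intro mpolys_sum mpolys_mult mpolys_mconst mpolys_prod mpolys_power assms(2))
    (use assms(1) in \<open>auto simp: mpolys_def\<close>)

lemma lookup_mult_0:
  fixes p q :: "'a::field mpoly"
  shows "Poly_Mapping.lookup (p * q) 0 = Poly_Mapping.lookup p 0 * Poly_Mapping.lookup q 0"
proof -
  have z: "0 = l + k \<longleftrightarrow> l = 0 \<and> k = 0" for l k :: "nat \<Rightarrow>\<^sub>0 nat"
    by (metis add_cancel_right_right add_is_0 lookup_add lookup_zero poly_mapping_eqI)
  have "Sum_any (\<lambda>k. Poly_Mapping.lookup q k when 0 = l + k) = (Poly_Mapping.lookup q 0 when l = 0)" for l
    by (cases "l = 0") (simp_all add: z)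
  thus ?thesis by (simp add: lookup_mult mult_when)
qed

section \<open>Local algebra and EKL-degree\<close>

text \<open>
  The localization of \<open>K[x\<^sub>0, \<dots>, x\<^sub>n\<^sub>-\<^sub>1]\<close> at the origin, inside a field of fractions: a polynomial lies
  outside the maximal ideal \<open>(x\<^sub>0, \<dots>, x\<^sub>n\<^sub>-\<^sub>1)\<close> iff its constant coefficient, the one of the monomial
  \<open>0\<close>, is nonzero.
\<close>

definition local_ring :: "nat \<Rightarrow> 'a::field mpoly fract ring" where
  "local_ring n = \<lparr>carrier = {Fract p s |p s. p \<in> mpolys n \<and> s \<in> mpolys n \<and> Poly_Mapping.lookup s 0 \<noteq> 0},
     mult = (*), one = 1, zero = 0, add = (+)\<rparr>"

definition local_ideal :: "nat \<Rightarrow> (nat \<Rightarrow> 'a mpoly) \<Rightarrow> 'a::field mpoly fract set" where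
  "local_ideal n f = Idl\<^bsub>local_ring n\<^esub> ((\<lambda>i. to_fract (f i)) ` {..<n})"

definition local_algebra :: "nat \<Rightarrow> (nat \<Rightarrow> 'a mpoly) \<Rightarrow> ('a::field, 'a mpoly fract set) module" where
  "local_algebra n f =
    (let R = local_ring n; I = local_ideal n f; Q = R Quot I
     in \<lparr>carrier = carrier Q, mult = mult Q, one = one Q, zero = zero Q, add = add Q,
         smult = (\<lambda>c X. (I +>\<^bsub>R\<^esub> to_fract (mconst c)) \<otimes>\<^bsub>Q\<^esub> X)\<rparr>)"

lemma local_ring_simps [simp]:
  "mult (local_ring n) = (*)" "one (local_ring n) = 1" "zero (local_ring n) = 0"
  "add (local_ring n) = (+)"
  by (simp_all add: local_ring_def)

lemma local_ringI:
  "p \<in> mpolys n \<Longrightarrow> s \<in> mpolys n \<Longrightarrow> Poly_Mapping.lookup s 0 \<noteq> 0 \<Longrightarrow> Fract p s \<in> carrier (local_ring n)"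
  by (auto simp: local_ring_def)

lemma local_ringE:
  assumes "x \<in> carrier (local_ring n)"
  obtains p s where "x = Fract p s" "p \<in> mpolys n" "s \<in> mpolys n" "Poly_Mapping.lookup s 0 \<noteq> 0" "s \<noteq> 0"
proof -
  from assms obtain p s where "x = Fract p s" "p \<in> mpolys n" "s \<in> mpolys n" "Poly_Mapping.lookup s 0 \<noteq> 0"
    by (auto simp: local_ring_def)
  moreover from this(4) have "s \<noteq> 0" by auto
  ultimately show ?thesis by (rule that)
qed

lemma to_fract_local_ring: "p \<in> mpolys n \<Longrightarrow> to_fract p \<in> carrier (local_ring n)"
  unfolding to_fract_def by (rule local_ringI) auto

lemma local_ring_add:
  assumes "x \<in> carrier (local_ring n)" "y \<in> carrier (local_ring n)"
  shows "x + y \<in> carrier (local_ring n)"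
  using assms by (elim local_ringE)
    (auto simp: lookup_mult_0 intro!: local_ringI mpolys_add mpolys_mult)

lemma local_ring_mult:
  assumes "x \<in> carrier (local_ring n)" "y \<in> carrier (local_ring n)"
  shows "x * y \<in> carrier (local_ring n)"
  using assms by (elim local_ringE)
    (auto simp: lookup_mult_0 intro!: local_ringI mpolys_mult)

lemma local_ring_uminus:
  assumes "x \<in> carrier (local_ring n)"
  shows "- x \<in> carrier (local_ring n)"
  using assms by (elim local_ringE) (auto intro!: local_ringI mpolys_uminus)

lemma local_ring_cring: "cring (local_ring n :: 'a::field mpoly fract ring)"
proof (rule cringI)
  have z: "0 \<in> carrier (local_ring n :: 'a mpoly fract ring)"
    using to_fract_local_ring[of 0 n] by simp
  show "abelian_group (local_ring n :: 'a mpoly fract ring)"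
    by (rule abelian_groupI)
      (auto simp: local_ring_add z add_ac intro: bexI[of _ "- x" for x] local_ring_uminus)
  show "comm_monoid (local_ring n :: 'a mpoly fract ring)"
    using to_fract_local_ring[of 1 n]
    by (intro comm_monoidI) (auto simp: local_ring_mult mult_ac)
qed (auto simp: distrib_right)

lemma local_ideal_ideal:
  assumes "\<And>i. i < n \<Longrightarrow> f i \<in> mpolys n"
  shows "ideal (local_ideal n f) (local_ring n)"
  unfolding local_ideal_def
  by (rule ring.genideal_ideal[OF cring.axioms(1)[OF local_ring_cring]])
    (use assms in \<open>auto intro: to_fract_local_ring\<close>)

lemma local_algebra_algebra:
  fixes f :: "nat \<Rightarrow> 'a::field mpoly"
  assumes "\<And>i. i < n \<Longrightarrow> f i \<in> mpolys n"
  shows "algebra class_ring (local_algebra n f)"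
proof -
  let ?R = "local_ring n :: 'a mpoly fract ring" and ?I = "local_ideal n f"
  let ?Q = "?R Quot ?I"
  define h where "h c = ?I +>\<^bsub>?R\<^esub> to_fract (mconst c)" for c
  interpret I: ideal ?I ?R by (rule local_ideal_ideal[OF assms])
  interpret Q: cring ?Q by (rule I.quotient_is_cring[OF local_ring_cring])
  have hom: "(+>\<^bsub>?R\<^esub>) ?I \<in> Ring.ring_hom ?R ?Q" by (rule I.rcos_ring_hom)
  have c: "to_fract (mconst a) \<in> carrier ?R" for a by (rule to_fract_local_ring) simp
  have h_hom: "h a \<in> carrier ?Q" "h (a + b) = h a \<oplus>\<^bsub>?Q\<^esub> h b" "h (a * b) = h a \<otimes>\<^bsub>?Q\<^esub> h b"
    "h 1 = \<one>\<^bsub>?Q\<^esub>" for a b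
    using ring_hom_closed[OF hom c, of a] ring_hom_add[OF hom c c, of a b]
      ring_hom_mult[OF hom c c, of a b] ring_hom_one[OF hom]
    by (simp_all add: h_def)
  have sel: "carrier (local_algebra n f) = carrier ?Q" "mult (local_algebra n f) = mult ?Q"
    "one (local_algebra n f) = one ?Q" "zero (local_algebra n f) = zero ?Q"
    "add (local_algebra n f) = add ?Q" "smult (local_algebra n f) = (\<lambda>c X. h c \<otimes>\<^bsub>?Q\<^esub> X)"
    by (simp_all add: local_algebra_def Let_def h_def)
  have cr: "cring (class_ring :: 'a ring)"
    by (rule field.axioms domain.axioms class_field.field_axioms)+
  have inv: "\<exists>y\<in>carrier ?Q. y \<oplus>\<^bsub>?Q\<^esub> x = \<zero>\<^bsub>?Q\<^esub>" if "x \<in> carrier ?Q" for x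
    using that Q.l_neg Q.a_inv_closed by blast
  have lc: "cring (local_algebra n f)"
  proof (rule cringI)
    show "abelian_group (local_algebra n f)"
      by (rule abelian_groupI) (simp_all add: sel Q.a_ac inv)
    show "comm_monoid (local_algebra n f)"
      by (rule comm_monoidI) (simp_all add: sel Q.m_ac)
  qed (simp add: sel Q.l_distr)
  show ?thesis
    by (rule algebraI[OF cr lc])
      (simp_all add: sel h_hom Q.l_distr Q.r_distr Q.m_assoc)
qed

lemma local_algebra_vectorspace:
  fixes f :: "nat \<Rightarrow> 'a::field mpoly"
  assumes "\<And>i. i < n \<Longrightarrow> f i \<in> mpolys n"
  shows "vectorspace class_ring (local_algebra n f)"
  using algebra.axioms(1)[OF local_algebra_algebra[OF assms]] class_field.field_axioms
  by (simp add: vectorspace_def)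

definition local_degree :: "nat \<Rightarrow> (nat \<Rightarrow> 'a::field mpoly) \<Rightarrow> nat" where
  "local_degree n f = vectorspace.dim class_ring (local_algebra n f)"

definition linear_presentation :: "nat \<Rightarrow> (nat \<Rightarrow> 'a::field mpoly) \<Rightarrow> 'a mpoly mat \<Rightarrow> bool" where
  "linear_presentation n f A \<longleftrightarrow> A \<in> carrier_mat n n \<and>
     (\<forall>i<n. \<forall>j<n. A $$ (i, j) \<in> mpolys n) \<and> (\<forall>i<n. f i = (\<Sum>j<n. A $$ (i, j) * mvar j))"

definition socle_element :: "nat \<Rightarrow> (nat \<Rightarrow> 'a::field mpoly) \<Rightarrow> 'a mpoly mat \<Rightarrow> 'a mpoly fract set" where
  "socle_element n f A = local_ideal n f +>\<^bsub>local_ring n\<^esub> to_fract (det A)"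

definition base_module :: "('a::field, 'a) module" where
  "base_module = \<lparr>carrier = UNIV, mult = (*), one = 1, zero = 0, add = (+), smult = (*)\<rparr>"

definition gram_matrix :: "('v \<Rightarrow> 'v \<Rightarrow> 'a::field) \<Rightarrow> 'v list \<Rightarrow> 'a mat" where
  "gram_matrix \<beta> vs = mat (length vs) (length vs) (\<lambda>(i, j). \<beta> (vs ! i) (vs ! j))"

text \<open>
  \<open>\<gamma>\<close> is the class of the form \<open>\<beta>\<close> on \<open>V\<close>.  This includes that \<open>V\<close> is finite-dimensional and that \<open>\<beta>\<close>
  is symmetric and nondegenerate.
\<close>

definition has_gw_class ::
  "('a::field, 'v) module \<Rightarrow> ('v \<Rightarrow> 'v \<Rightarrow> 'a) \<Rightarrow> 'a gw \<Rightarrow> bool" where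
  "has_gw_class V \<beta> \<gamma> \<longleftrightarrow> (\<exists>vs. distinct vs \<and> vectorspace.basis class_ring V (set vs) \<and>
     nondeg_sym_mat (gram_matrix \<beta> vs) \<and> \<gamma> = gw_of_mat (gram_matrix \<beta> vs))"

text \<open>
  The description has a value only if the class exists and does not depend on the presentation \<open>A\<close>,
  the functional \<open>\<phi>\<close> or the basis.  The existence of \<open>A\<close> forces \<open>f(0) = 0\<close>, and finite-dimensionality
  of the local algebra says that the origin is isolated in its fibre.
\<close>

definition EKL_degree :: "nat \<Rightarrow> (nat \<Rightarrow> 'a::field mpoly) \<Rightarrow> 'a gw" where
  "EKL_degree n f = (THE \<gamma>. \<exists>A \<phi>.
     linear_presentation n f A \<and>
     linear_map class_ring (local_algebra n f) base_module \<phi> \<and>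
     \<phi> (socle_element n f A) = 1 \<and>
     has_gw_class (local_algebra n f) (\<lambda>x y. \<phi> (x \<otimes>\<^bsub>local_algebra n f\<^esub> y)) \<gamma>)"

section \<open>Quotients of affine space by Young subgroups\<close>

definition esym :: "nat set \<Rightarrow> nat \<Rightarrow> 'a::field mpoly" where
  "esym X k = (\<Sum>S | S \<subseteq> X \<and> card S = k. \<Prod>i\<in>S. mvar i)"

definition block :: "nat list \<Rightarrow> nat \<Rightarrow> nat set" where
  "block ns k = {sum_list (take k ns)..<sum_list (take (Suc k) ns)}"

text \<open>
  The coordinates on the quotient by the group permuting each block: for each block in turn, its
  elementary symmetric polynomials in degrees 1 up to the block length.  Position \<open>i\<close> of this list is
  the pullback of the \<open>i\<close>-th coordinate function of affine space.
\<close>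

definition block_coords :: "nat list \<Rightarrow> 'a::field mpoly list" where
  "block_coords ns =
     concat (map (\<lambda>k. map (\<lambda>j. esym (block ns k) (Suc j)) [0..<ns ! k]) [0..<length ns])"

definition young_subgroup :: "nat list \<Rightarrow> (nat \<Rightarrow> nat) set" where
  "young_subgroup ns =
     {\<sigma>. \<sigma> permutes {..<sum_list ns} \<and> (\<forall>k<length ns. \<sigma> ` block ns k = block ns k)}"

definition invariants :: "nat \<Rightarrow> (nat \<Rightarrow> nat) set \<Rightarrow> 'a::field mpoly set" where
  "invariants n H = {p \<in> mpolys n. \<forall>\<sigma>\<in>H. mpoly_subst (\<lambda>i. mvar (\<sigma> i)) p = p}"

text \<open>
  The identification \<open>K[z\<^sub>0, \<dots>, z\<^sub>n\<^sub>-\<^sub>1] \<cong> K[x\<^sub>0, \<dots>, x\<^sub>n\<^sub>-\<^sub>1]\<^sup>H\<close> for \<open>H = young_subgroup ns\<close> that sends each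
  coordinate function to the corresponding elementary symmetric polynomial.
\<close>

definition coord_hom :: "nat list \<Rightarrow> 'a::field mpoly \<Rightarrow> 'a mpoly" where
  "coord_hom ns = mpoly_subst (\<lambda>i. block_coords ns ! i)"

text \<open>
  The components of the quotient map: the \<open>i\<close>-th target coordinate is sent by \<open>coord_hom [n]\<close> to an
  \<open>S\<^sub>n\<close>-invariant, which is viewed as an invariant of the Young subgroup and written in the source
  coordinates.  The lists \<open>[n]\<close> and \<open>ns\<close> stand for \<open>S\<^sub>n\<close> and its Young subgroup.
\<close>

definition sym_quotient_map :: "nat list \<Rightarrow> nat \<Rightarrow> 'a::field mpoly" where
  "sym_quotient_map ns i =
     the_inv_into (mpolys (sum_list ns)) (coord_hom ns) (coord_hom [sum_list ns] (mvar i))"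

lemma length_block_coords: "length (block_coords ns) = sum_list ns"
proof -
  have "sum_list (map (\<lambda>k. ns ! k) [0..<length ns]) = sum_list ns" by (simp add: map_nth)
  thus ?thesis by (simp add: block_coords_def length_concat comp_def)
qed

lemma coord_hom_single: "i < n \<Longrightarrow> coord_hom [n] (mvar i) = esym {..<n} (Suc i)"
  by (simp add: coord_hom_def block_coords_def block_def atLeast0LessThan)

lemma block_subset:
  assumes "k < length ns" shows "block ns k \<subseteq> {..<sum_list ns}"
proof -
  have "sum_list (take (Suc k) ns) \<le> sum_list (take (Suc k) ns @ drop (Suc k) ns)"
    by (simp only: sum_list_append le_add1)
  thus ?thesis by (auto simp: block_def)
qed

lemma esym_mpolys: "X \<subseteq> {..<n} \<Longrightarrow> esym X k \<in> mpolys n"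
  unfolding esym_def by (intro mpolys_sum mpolys_prod mpolys_mvar) auto

lemma block_coords_esym:
  assumes "i < sum_list ns"
  shows "\<exists>k<length ns. \<exists>j. block_coords ns ! i = esym (block ns k) j"
proof -
  have "block_coords ns ! i \<in> set (block_coords ns)"
    using assms by (intro nth_mem) (simp add: length_block_coords)
  thus ?thesis by (auto simp: block_coords_def)
qed

lemma esym_permute:
  assumes "inj \<sigma>"
  shows "mpoly_subst (\<lambda>i. mvar (\<sigma> i)) (esym X k) = esym (\<sigma> ` X) k"
proof -
  have b: "bij_betw ((`) \<sigma>) {S. S \<subseteq> X \<and> card S = k} {S. S \<subseteq> \<sigma> ` X \<and> card S = k}"
  proof (rule bij_betwI')
    fix S T assume "S \<in> {S. S \<subseteq> X \<and> card S = k}" "T \<in> {S. S \<subseteq> X \<and> card S = k}"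
    show "\<sigma> ` S = \<sigma> ` T \<longleftrightarrow> S = T" using assms by (simp add: inj_image_eq_iff)
  next
    fix S assume "S \<in> {S. S \<subseteq> X \<and> card S = k}"
    thus "\<sigma> ` S \<in> {S. S \<subseteq> \<sigma> ` X \<and> card S = k}"
      using assms by (auto simp: card_image inj_on_subset[OF assms])
  next
    fix T assume T: "T \<in> {S. S \<subseteq> \<sigma> ` X \<and> card S = k}"
    then obtain S where "S \<subseteq> X" "T = \<sigma> ` S" by (auto simp: subset_image_iff)
    thus "\<exists>S\<in>{S. S \<subseteq> X \<and> card S = k}. T = \<sigma> ` S"
      using T by (auto simp: card_image inj_on_subset[OF assms])
  qed
  have "mpoly_subst (\<lambda>i. mvar (\<sigma> i)) (esym X k) =
      (\<Sum>S | S \<subseteq> X \<and> card S = k. \<Prod>i\<in>S. mvar (\<sigma> i))"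
    by (simp add: esym_def mpoly_subst_sum mpoly_subst_prod)
  also have "\<dots> = (\<Sum>S | S \<subseteq> X \<and> card S = k. \<Prod>i\<in>\<sigma> ` S. mvar i)"
    by (intro sum.cong refl) (simp add: prod.reindex inj_on_subset[OF assms])
  also have "\<dots> = esym (\<sigma> ` X) k"
    unfolding esym_def using sum.reindex_bij_betw[OF b] by simp
  finally show ?thesis .
qed

lemma coord_hom_invariants:
  "coord_hom ns ` mpolys (sum_list ns) \<subseteq> invariants (sum_list ns) (young_subgroup ns)"
proof
  let ?n = "sum_list ns"
  fix q assume "q \<in> coord_hom ns ` mpolys ?n"
  then obtain p where p: "p \<in> mpolys ?n" and q: "q = mpoly_subst (\<lambda>i. block_coords ns ! i) p"
    by (auto simp: coord_hom_def)
  have "q \<in> mpolys ?n"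
    unfolding q
  proof (rule mpolys_subst[OF p])
    fix i assume "i < ?n"
    from block_coords_esym[OF this] show "block_coords ns ! i \<in> mpolys ?n"
      by (metis esym_mpolys block_subset)
  qed
  moreover have "mpoly_subst (\<lambda>i. mvar (\<sigma> i)) q = q" if \<sigma>: "\<sigma> \<in> young_subgroup ns" for \<sigma>
    unfolding q mpoly_subst_subst
  proof (rule mpoly_subst_cong[OF p])
    fix i assume "i < ?n"
    have "inj \<sigma>" using \<sigma> by (auto simp: young_subgroup_def dest: permutes_inj)
    moreover have "\<sigma> ` block ns k = block ns k" if "k < length ns" for k
      using \<sigma> that by (simp add: young_subgroup_def)
    ultimately show "mpoly_subst (\<lambda>i. mvar (\<sigma> i)) (block_coords ns ! i) = block_coords ns ! i"
      using block_coords_esym[OF \<open>i < ?n\<close>] by (metis esym_permute)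
  qed
  ultimately show "q \<in> invariants ?n (young_subgroup ns)" by (simp add: invariants_def)
qed

lemma young_subgroup_single: "young_subgroup [n] = {\<sigma>. \<sigma> permutes {..<n}}"
  by (auto simp: young_subgroup_def block_def atLeast0LessThan permutes_image)

lemma invariants_symmetric_subset:
  "invariants (sum_list ns) (young_subgroup [sum_list ns]) \<subseteq>
   invariants (sum_list ns) (young_subgroup ns)"
  by (auto simp: invariants_def young_subgroup_single) (auto simp: young_subgroup_def)

text \<open>
  The factorial quotients of the theorem are exact, so natural-number division does not truncate.
\<close>

lemma prod_fact_dvd: "(\<Prod>k\<leftarrow>ns. fact k) dvd (fact (sum_list ns) :: nat)"
proof (induction ns)
  case (Cons k ns)
  have "fact k * (\<Prod>k\<leftarrow>ns. fact k) dvd (fact k * fact (sum_list ns) :: nat)"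
    using Cons by (rule mult_dvd_mono[OF dvd_refl])
  also have "\<dots> dvd fact (k + sum_list ns)" by (rule fact_fact_dvd_fact)
  finally show ?case by simp
qed simp

lemma prod_fact_half_dvd:
  assumes "length (filter odd ns) \<le> 1"
  shows "(\<Prod>k\<leftarrow>ns. fact (k div 2)) dvd (fact (sum_list ns div 2) :: nat)"
proof -
  have "2 * sum_list (map (\<lambda>k. k div 2) ns) + length (filter odd ns) = sum_list ns"
    by (induction ns) (auto elim: oddE)
  hence "sum_list ns div 2 = sum_list (map (\<lambda>k. k div 2) ns)" using assms by linarith
  thus ?thesis using prod_fact_dvd[of "map (\<lambda>k. k div 2) ns"] by (simp add: comp_def)
qed

end

theory Submission
  imports Defs
begin

text \<open>
  Identify the coordinate ring of the source with the ring of polynomials in \<open>x\<^sub>1,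
  \<dots>, x\<^sub>n\<close> that are symmetric in each block, by the map \<open>ev\<close>.  The
  ideal of the fibre is then generated by the elementary symmetric polynomials in all variables.
  The block coordinates are nilpotent modulo this ideal (\<open>coord_nilpotent\<close>), hence
  localizing at the origin is not visible in the quotient (locale \<open>isolated_zero\<close>), and
  the local algebra is that of a partial flag variety.  The theorem computes its intersection form.

  The form comes from the functional that sends \<open>p\<close> to the coefficient of the staircase
  monomial of all \<open>n\<close> variables in the antisymmetrization of \<open>ev p\<close> times
  the staircase monomial of the blocks (\<open>pairing\<close>).  It vanishes on the ideal of the
  fibre by \<open>coeff_functional_esym\<close>.  It is \<open>1\<close> on the socle element:
  multiplying a presentation of the quotient map by one of the block coordinates presents the
  elementary symmetric polynomials, and for these and for the block coordinates there are triangular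
  presentations whose determinants are the staircase monomials (\<open>det_coord_mat\<close>,
  \<open>pairing_socle\<close>).  The comparison rests on the fact that determinants of
  presentations are unique modulo the ideal (\<open>det_presentation_unique\<close>), which follows
  from the exactness of the first step of the Koszul complex.

  The class does not depend on the functional.  Any other functional is this one after
  multiplication by some \<open>u\<close>, and its value on the socle element is the constant term
  of \<open>u\<close>.  If this is \<open>1\<close>, then \<open>u\<close> is a square in the local
  algebra, as the characteristic is not \<open>2\<close>, and rescaling by the root is an isometry
  (\<open>gw_class_unique\<close>).

  The monomials \<open>x\<^sup>w\<close> whose exponents strictly decrease in each block and are
  smaller than \<open>n - s\<close> in a block starting at position \<open>s\<close> give, after
  antisymmetrizing over the blocks and dividing by the Vandermonde determinants, products of Schur
  polynomials that span the local algebra (\<open>shapes\<close>, \<open>schur_span\<close>).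
  Complementing the partitions in their boxes is an involution on the shapes.  Inverting the
  variables shows that a Schur polynomial pairs to \<open>1\<close> with its complement, and
  comparing a weight shows that otherwise it pairs to zero unless the sum of the scores is positive
  (\<open>schur_compl\<close>, \<open>gram_entry_positive\<close>,
  \<open>gram_entry_zero_score\<close>).  So the Gram matrix is triangular around the involution.
  Splitting off hyperbolic planes for the pairs of distinct complementary shapes, starting with the
  least score, leaves an orthonormal basis indexed by the shapes that equal their complement
  (\<open>gram_involution_class\<close>).

  It remains to count shapes.  A block of size \<open>k\<close> followed by \<open>m\<close>
  variables contributes a subset of size \<open>k\<close> of an interval of length \<open>k +
  m\<close>, and complements reverse the interval.  All subsets together are counted by the
  multinomial coefficient of the \<open>n\<^sub>i\<close>.  The symmetric ones are counted by the
  multinomial coefficient of the rounded halves, unless some interval of even length requires a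
  subset of odd size (\<open>card_symmetric_subsets\<close>), which happens precisely if at least
  two blocks are odd.
\<close>

abbreviation lookup :: "('a \<Rightarrow>\<^sub>0 'b::zero) \<Rightarrow> 'a \<Rightarrow> 'b" where "lookup \<equiv> Poly_Mapping.lookup"
abbreviation keys :: "('a \<Rightarrow>\<^sub>0 'b::zero) \<Rightarrow> 'a set" where "keys \<equiv> Poly_Mapping.keys"

section \<open>Ideals of polynomials\<close>

definition poly_ideal :: "nat \<Rightarrow> nat \<Rightarrow> (nat \<Rightarrow> 'a mpoly) \<Rightarrow> 'a::field mpoly set" where
  "poly_ideal n k f = {p. \<exists>c. (\<forall>i<k. c i \<in> mpolys n) \<and> p = (\<Sum>i<k. c i * f i)}"

lemma poly_idealI: "(\<And>i. i < k \<Longrightarrow> c i \<in> mpolys n) \<Longrightarrow> (\<Sum>i<k. c i * f i) \<in> poly_ideal n k f"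
  unfolding poly_ideal_def by blast

lemma poly_ideal_0 [simp]: "0 \<in> poly_ideal n k f"
  using poly_idealI[of k "\<lambda>_. 0" n f] by simp

lemma poly_ideal_add:
  assumes "p \<in> poly_ideal n k f" "q \<in> poly_ideal n k f" shows "p + q \<in> poly_ideal n k f"
proof -
  obtain c d where c: "\<forall>i<k. c i \<in> mpolys n" "p = (\<Sum>i<k. c i * f i)"
    and d: "\<forall>i<k. d i \<in> mpolys n" "q = (\<Sum>i<k. d i * f i)"
    using assms by (auto simp: poly_ideal_def)
  have "p + q = (\<Sum>i<k. (c i + d i) * f i)"
    using c d by (simp add: distrib_right sum.distrib)
  thus ?thesis using c d poly_idealI[of k "\<lambda>i. c i + d i" n f] by (simp add: mpolys_add)
qed

lemma poly_ideal_mult: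
  assumes "r \<in> mpolys n" "p \<in> poly_ideal n k f" shows "r * p \<in> poly_ideal n k f"
proof -
  obtain c where c: "\<forall>i<k. c i \<in> mpolys n" "p = (\<Sum>i<k. c i * f i)"
    using assms by (auto simp: poly_ideal_def)
  have "r * p = (\<Sum>i<k. (r * c i) * f i)"
    using c by (simp add: sum_distrib_left mult.assoc)
  thus ?thesis using c assms poly_idealI[of k "\<lambda>i. r * c i" n f] by (simp add: mpolys_mult)
qed

lemma poly_ideal_uminus: "p \<in> poly_ideal n k f \<Longrightarrow> - p \<in> poly_ideal n k f"
  using poly_ideal_mult[OF mpolys_uminus[OF mpolys_1], of p n k f] by simp

lemma poly_ideal_diff:
  "p \<in> poly_ideal n k f \<Longrightarrow> q \<in> poly_ideal n k f \<Longrightarrow> p - q \<in> poly_ideal n k f"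
  using poly_ideal_add[of p n k f "- q"] poly_ideal_uminus[of q n k f] by simp

lemma poly_ideal_sum:
  "(\<And>x. x \<in> X \<Longrightarrow> g x \<in> poly_ideal n k f) \<Longrightarrow> (\<Sum>x\<in>X. g x) \<in> poly_ideal n k f"
  by (induction X rule: infinite_finite_induct) (simp_all add: poly_ideal_add)

lemma poly_ideal_gen:
  assumes "r \<in> mpolys n" "i < k" shows "r * f i \<in> poly_ideal n k f"
proof -
  have "(\<Sum>j<k. (if j = i then r else 0) * f j) = (\<Sum>j<k. if j = i then r * f i else 0)"
    by (rule sum.cong) auto
  also have "\<dots> = r * f i" using assms by simp
  finally show ?thesis using poly_idealI[of k "\<lambda>j. if j = i then r else 0" n f] assms by simp
qed

lemma poly_ideal_mpolys:
  assumes "\<And>i. i < k \<Longrightarrow> f i \<in> mpolys n" shows "poly_ideal n k f \<subseteq> mpolys n"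
  using assms by (auto simp: poly_ideal_def intro!: mpolys_sum mpolys_mult)

lemma mpolys_diff: "p \<in> mpolys n \<Longrightarrow> q \<in> mpolys n \<Longrightarrow> p - q \<in> mpolys n"
  using mpolys_add[of p n "- q"] mpolys_uminus[of q n] by simp

lemma mpolys_single: "keys m \<subseteq> {..<n} \<Longrightarrow> Poly_Mapping.single m c \<in> mpolys n"
  by (auto simp: mpolys_def)

lemma mpolys_signof: "of_int (sign \<sigma>) \<in> mpolys n"
  by (cases \<sigma> rule: sign_cases) (auto simp: mpolys_uminus)

lemma mpolys_det:
  assumes "A \<in> carrier_mat k k" "\<And>i j. i < k \<Longrightarrow> j < k \<Longrightarrow> A $$ (i, j) \<in> mpolys n"
  shows "det A \<in> mpolys n"
  unfolding det_def'[OF assms(1)]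
  by (intro mpolys_sum mpolys_mult mpolys_signof mpolys_prod)
    (auto intro!: assms(2) simp: permutes_in_image)

lemma single_mult_mvar:
  "Poly_Mapping.single m c * mvar j = Poly_Mapping.single (m + Poly_Mapping.single j 1) (c::'a::field)"
  by (simp add: mvar_def mult_single)

text \<open>
  Splitting one variable off each monomial: the ideal generated by the first \<open>k\<close> variables consists
  of the polynomials each of whose monomials involves one of them.
\<close>

lemma poly_ideal_vars:
  fixes p :: "'a::field mpoly"
  assumes p: "p \<in> mpolys n" and k: "k \<le> n" and *: "\<And>m. m \<in> keys p \<Longrightarrow> \<exists>j<k. lookup m j \<noteq> 0"
  shows "p \<in> poly_ideal n k mvar"
proof -
  have "Poly_Mapping.single m (lookup p m) \<in> poly_ideal n k mvar" if m: "m \<in> keys p" for m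
  proof -
    obtain j where j: "j < k" "lookup m j \<noteq> 0" using *[OF m] by blast
    define m' where "m' = m - Poly_Mapping.single j 1"
    have mm: "m = m' + Poly_Mapping.single j 1"
      by (rule poly_mapping_eqI) (use j in \<open>auto simp: m'_def lookup_add lookup_minus lookup_single when_def\<close>)
    have "keys m' \<subseteq> keys m" by (auto simp: m'_def in_keys_iff lookup_minus)
    moreover have "keys m \<subseteq> {..<n}" using p m by (auto simp: mpolys_def)
    ultimately have "Poly_Mapping.single m' (lookup p m) \<in> mpolys n" by (intro mpolys_single) auto
    from poly_ideal_gen[OF this j(1), of mvar] show ?thesis
      unfolding single_mult_mvar mm[symmetric] .
  qed
  hence "(\<Sum>m\<in>keys p. Poly_Mapping.single m (lookup p m)) \<in> poly_ideal n k mvar"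
    by (rule poly_ideal_sum)
  thus ?thesis by (simp only: mpoly_sum_monomials)
qed

lemma maximal_ideal_vars:
  assumes "p \<in> mpolys n" "lookup p 0 = 0"
  shows "p \<in> poly_ideal n n mvar"
proof (rule poly_ideal_vars[OF assms(1) order_refl])
  fix m assume m: "m \<in> keys p"
  have "m \<noteq> 0" using m assms(2) by (auto simp: in_keys_iff)
  then obtain j where "lookup m j \<noteq> 0" by (metis lookup_zero poly_mapping_eqI)
  moreover have "j < n" using m assms(1) calculation by (fastforce simp: mpolys_def in_keys_iff subset_iff)
  ultimately show "\<exists>j<n. lookup m j \<noteq> 0" by blast
qed

section \<open>Independence of the socle element\<close>

lemma lookup_mult_mvar:
  "lookup (p * mvar j :: 'a::field mpoly) m = (if lookup m j = 0 then 0 else lookup p (m - Poly_Mapping.single j 1))"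
proof -
  have "p * mvar j = (\<Sum>k\<in>keys p. Poly_Mapping.single (k + Poly_Mapping.single j 1) (lookup p k))"
    by (subst mpoly_sum_monomials[of p, symmetric]) (simp only: sum_distrib_right single_mult_mvar)
  hence "lookup (p * mvar j) m = (\<Sum>k\<in>keys p. if k + Poly_Mapping.single j 1 = m then lookup p k else 0)"
    by (simp add: lookup_sum lookup_single when_def)
  also have "\<dots> = (\<Sum>k\<in>keys p. if k = m - Poly_Mapping.single j 1 \<and> lookup m j \<noteq> 0 then lookup p k else 0)"
  proof (intro sum.cong if_cong refl)
    fix k
    show "k + Poly_Mapping.single j 1 = m \<longleftrightarrow> k = m - Poly_Mapping.single j 1 \<and> lookup m j \<noteq> 0"
      by (auto simp: poly_mapping_eq_iff fun_eq_iff lookup_add lookup_minus lookup_single when_def)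
  qed
  also have "\<dots> = (if lookup m j = 0 then 0 else lookup p (m - Poly_Mapping.single j 1))"
    by (auto simp: in_keys_iff)
  finally show ?thesis .
qed

text \<open>
  In a relation, a monomial of the coefficient of the last variable that is free of the other variables
  could not cancel, so this coefficient lies in the ideal of the others.  Moving it over to them
  shortens the relation and contributes the last row and column of the antisymmetric matrix.
\<close>

lemma koszul_relations:
  fixes d :: "nat \<Rightarrow> 'a::field mpoly"
  assumes "k \<le> n" "\<And>j. j < k \<Longrightarrow> d j \<in> mpolys n" "(\<Sum>j<k. d j * mvar j) = 0"
  shows "\<exists>s. (\<forall>i j. s i j \<in> mpolys n) \<and> (\<forall>i j. s j i = - s i j) \<and> (\<forall>i. s i i = 0) \<and>
    (\<forall>j<k. d j = (\<Sum>l<k. s j l * mvar l))"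
  using assms
proof (induction k arbitrary: d)
  case 0
  show ?case by (rule exI[of _ "\<lambda>_ _. 0"]) simp
next
  case (Suc k)
  have kn: "k \<le> n" "k < n" using Suc.prems by auto
  have "\<exists>j<k. lookup m j \<noteq> 0" if m: "m \<in> keys (d k)" for m
  proof (rule ccontr)
    assume "\<not> ?thesis"
    hence z: "lookup m j = 0" if "j < k" for j using that by auto
    let ?m = "m + Poly_Mapping.single k 1"
    have "lookup (d k * mvar k) ?m = lookup (d k) m"
      by (simp add: lookup_mult_mvar lookup_add lookup_single)
    moreover have "lookup (d j * mvar j) ?m = 0" if "j < k" for j
      using that by (simp add: lookup_mult_mvar lookup_add lookup_single z)
    ultimately have "lookup (\<Sum>j<Suc k. d j * mvar j) ?m = lookup (d k) m"
      by (simp add: lookup_add lookup_sum)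
    with m Suc.prems(3) show False by (simp add: in_keys_iff)
  qed
  hence "d k \<in> poly_ideal n k mvar"
    using Suc.prems kn by (intro poly_ideal_vars) auto
  then obtain c where c: "\<forall>j<k. c j \<in> mpolys n" "d k = (\<Sum>j<k. c j * mvar j)"
    by (auto simp: poly_ideal_def)
  define d' where "d' j = d j + c j * mvar k" for j
  have "(\<Sum>j<k. d' j * mvar j) = (\<Sum>j<k. d j * mvar j) + (\<Sum>j<k. c j * mvar j) * mvar k"
    by (simp add: d'_def algebra_simps sum.distrib sum_distrib_left sum_distrib_right)
  also have "\<dots> = 0" using Suc.prems(3) c by simp
  finally have 0: "(\<Sum>j<k. d' j * mvar j) = 0" .
  have "d' j \<in> mpolys n" if "j < k" for j
    using that Suc.prems c kn by (auto simp: d'_def intro!: mpolys_add mpolys_mult mpolys_mvar)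
  from Suc.IH[OF kn(1) this 0] obtain s where s: "\<forall>i j. s i j \<in> mpolys n" "\<forall>i j. s j i = - s i j"
    "\<forall>i. s i i = 0" "\<forall>j<k. d' j = (\<Sum>l<k. s j l * mvar l)" by blast
  \<comment> \<open>The border contributed by the coefficient of the last variable.\<close>
  define t where "t i j = (if i < k \<and> j < k then s i j else if i = k \<and> j < k then c j
     else if j = k \<and> i < k then - c i else 0)" for i j
  have "d j = (\<Sum>l<Suc k. t j l * mvar l)" if "j < Suc k" for j
  proof (cases "j = k")
    case True
    have "(\<Sum>l<Suc k. t j l * mvar l) = (\<Sum>l<k. c l * mvar l)"
      using True by (auto simp: t_def intro!: sum.cong)
    thus ?thesis using c True by simp
  next
    case False
    hence j: "j < k" using that by simp
    have "(\<Sum>l<Suc k. t j l * mvar l) = (\<Sum>l<k. s j l * mvar l) - c j * mvar k"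
      using j by (auto simp: t_def intro!: sum.cong)
    also have "\<dots> = d j" using s(4)[rule_format, OF j] by (simp add: d'_def eq_diff_eq diff_eq_eq)
    finally show ?thesis ..
  qed
  moreover have "t i j \<in> mpolys n" for i j
    using s(1) c(1) by (auto simp: t_def intro: mpolys_uminus)
  moreover have "t j i = - t i j" for i j using s(2)[rule_format, of i j] by (auto simp: t_def)
  moreover have "t i i = 0" for i using s(3) by (auto simp: t_def)
  ultimately show ?case by blast
qed

definition replace_row :: "'a mat \<Rightarrow> nat \<Rightarrow> (nat \<Rightarrow> 'a) \<Rightarrow> 'a mat" where
  "replace_row A i d = mat (dim_row A) (dim_col A) (\<lambda>(k, j). if k = i then d j else A $$ (k, j))"

lemma cofactor_replace_row:
  "A \<in> carrier_mat n n \<Longrightarrow> i < n \<Longrightarrow> j < n \<Longrightarrow> cofactor (replace_row A i d) i j = cofactor A i j"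
  unfolding cofactor_def
  by (rule arg_cong[of _ _ "\<lambda>M. _ * det M"]) (auto simp: mat_delete_def replace_row_def intro!: cong_mat)

lemma cofactor_replace_col:
  "A \<in> carrier_mat n n \<Longrightarrow> i < n \<Longrightarrow> j < n \<Longrightarrow> cofactor (replace_col A v j) i j = cofactor A i j"
  unfolding cofactor_def
  by (rule arg_cong[of _ _ "\<lambda>M. _ * det M"]) (auto simp: mat_delete_def replace_col_def intro!: cong_mat)

lemma replace_row_carrier [simp]: "A \<in> carrier_mat n m \<Longrightarrow> replace_row A i d \<in> carrier_mat n m"
  by (auto simp: replace_row_def)

lemma det_replace_row:
  assumes "A \<in> carrier_mat n n" "i < n"
  shows "det (replace_row A i d) = (\<Sum>j<n. d j * cofactor A i j)"
  using assms
  by (subst laplace_expansion_row[of _ n i])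
    (auto simp: cofactor_replace_row[of A n] intro!: sum.cong, auto simp: replace_row_def)

lemma mpolys_cofactor:
  assumes "A \<in> carrier_mat k k" "\<And>i j. i < k \<Longrightarrow> j < k \<Longrightarrow> A $$ (i, j) \<in> mpolys n" "i < k" "j < k"
  shows "cofactor A i j \<in> mpolys n"
  unfolding cofactor_def
proof (intro mpolys_mult mpolys_power)
  show "- 1 \<in> mpolys n" by (simp add: mpolys_uminus)
  have "mat_delete A i j \<in> carrier_mat (k - 1) (k - 1)" by (rule mat_delete_carrier[OF assms(1)])
  thus "det (mat_delete A i j) \<in> mpolys n"
    by (rule mpolys_det) (use assms in \<open>auto simp: mat_delete_def intro!: assms(2)\<close>)
qed

text \<open>
  Cramer's rule turns multiplication by \<open>x\<^sub>l\<close> into replacing the column \<open>l\<close> by the column of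
  the \<open>f\<^sub>k\<close>, up to the row \<open>i\<close> which no longer enters the cofactors.
\<close>

lemma cofactor_exchange:
  assumes A: "A \<in> carrier_mat n n" and mp: "\<And>i j. i < n \<Longrightarrow> j < n \<Longrightarrow> A $$ (i, j) \<in> mpolys n"
    and f: "\<And>k. k < n \<Longrightarrow> k \<noteq> i \<Longrightarrow> f k = (\<Sum>j<n. A $$ (k, j) * mvar j)"
    and i: "i < n" and j: "j < n" and l: "l < n"
  shows "mvar l * cofactor A i j - mvar j * cofactor A i l \<in> poly_ideal n n f"
proof -
  define B where "B = replace_row A i (\<lambda>k. if k = j then 1 else 0)"
  define x where "x = vec n (mvar :: nat \<Rightarrow> 'a mpoly)"
  define C where "C = replace_col B (B *\<^sub>v x) l"
  have B: "B \<in> carrier_mat n n" using A by (simp add: B_def)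
  have x: "x \<in> carrier_vec n" by (simp add: x_def)
  have C: "C \<in> carrier_mat n n" using B by (auto simp: C_def replace_col_def)
  have Bx: "(B *\<^sub>v x) $ k = (if k = i then mvar j else f k)" if "k < n" for k
  proof -
    have "(B *\<^sub>v x) $ k = (\<Sum>m<n. (if k = i then if m = j then 1 else 0 else A $$ (k, m)) * mvar m)"
      using A B that by (auto simp: scalar_prod_def x_def B_def replace_row_def lessThan_atLeast0 intro!: sum.cong)
    thus ?thesis using j f that
      by (cases "k = i") (auto simp: sum.delta if_distrib[of "\<lambda>a. a * _"] cong: if_cong)
  qed
  have "det B = cofactor A i j"
    unfolding B_def det_replace_row[OF A i]
    using j by (simp add: if_distrib[of "\<lambda>a. a * _"] cong: if_cong)
  hence "mvar l * cofactor A i j = det C"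
    using cramer_lemma_mat[OF B x l] l by (simp add: C_def x_def)
  also have "\<dots> = (\<Sum>k<n. (if k = i then mvar j else f k) * cofactor B k l)"
    unfolding laplace_expansion_column[OF C l]
  proof (intro sum.cong refl)
    fix k assume "k \<in> {..<n}"
    hence k: "k < n" by simp
    have "C $$ (k, l) = (B *\<^sub>v x) $ k" using B k l by (simp add: C_def replace_col_def)
    thus "C $$ (k, l) * cofactor C k l = (if k = i then mvar j else f k) * cofactor B k l"
      using Bx[OF k] cofactor_replace_col[OF B k l] by (simp add: C_def)
  qed
  also have "\<dots> = mvar j * cofactor A i l + (\<Sum>k\<in>{..<n} - {i}. f k * cofactor B k l)"
    using i l by (subst sum.remove[of _ i]) (auto simp: B_def cofactor_replace_row[OF A])
  finally have "mvar l * cofactor A i j - mvar j * cofactor A i l = (\<Sum>k\<in>{..<n} - {i}. f k * cofactor B k l)"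
    by simp
  also have "\<dots> \<in> poly_ideal n n f"
  proof (rule poly_ideal_sum)
    fix k assume "k \<in> {..<n} - {i}"
    moreover have "cofactor B k l \<in> mpolys n" if "k < n"
      using B that l mp A by (intro mpolys_cofactor) (auto simp: B_def replace_row_def)
    ultimately show "f k * cofactor B k l \<in> poly_ideal n n f"
      using poly_ideal_gen[of "cofactor B k l" n k n f] by (simp add: mult.commute)
  qed
  finally show ?thesis .
qed

text \<open>
  By antisymmetry of the Koszul relations, the terms for \<open>(j, l)\<close> and \<open>(l, j)\<close> combine to a multiple
  of a difference that \<open>cofactor_exchange\<close> places in the ideal.
\<close>

lemma det_relation_row:
  assumes A: "A \<in> carrier_mat n n" and mp: "\<And>i j. i < n \<Longrightarrow> j < n \<Longrightarrow> A $$ (i, j) \<in> mpolys n"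
    and f: "\<And>k. k < n \<Longrightarrow> k \<noteq> i \<Longrightarrow> f k = (\<Sum>j<n. A $$ (k, j) * mvar j)" and i: "i < n"
    and d: "\<And>j. j < n \<Longrightarrow> d j \<in> mpolys n" "(\<Sum>j<n. d j * mvar j) = 0"
  shows "(\<Sum>j<n. d j * cofactor A i j) \<in> poly_ideal n n f"
proof -
  obtain s where s: "\<forall>i j. s i j \<in> mpolys n" "\<forall>i j. s j i = - s i j" "\<forall>i. s i i = 0"
    "\<forall>j<n. d j = (\<Sum>l<n. s j l * mvar l)"
    using koszul_relations[OF order_refl d] by blast
  let ?t = "\<lambda>j l. s j l * (mvar l * cofactor A i j)"
  have flip: "(\<Sum>(j, l)\<in>{(j, l). j < n \<and> l < j}. ?t j l) = (\<Sum>(l, j)\<in>{(l, j). j < n \<and> l < j}. ?t j l)"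
    by (rule sum.reindex_bij_witness[of _ "\<lambda>(a, b). (b, a)" "\<lambda>(a, b). (b, a)"]) auto
  have fin: "finite {(j, l). j < n \<and> l < j}" "finite {(l, j). j < n \<and> l < j}"
    by (rule finite_subset[of _ "{..<n} \<times> {..<n}"]; auto)+
  have "(\<Sum>j<n. d j * cofactor A i j) = (\<Sum>j<n. \<Sum>l<n. ?t j l)"
    using s(4) by (auto simp: sum_distrib_right mult.assoc intro!: sum.cong)
  also have "\<dots> = (\<Sum>(j, l)\<in>{..<n} \<times> {..<n}. ?t j l)" by (simp add: sum.cartesian_product)
  also have "\<dots> = (\<Sum>(j, l)\<in>{(j, l). j < n \<and> l < j} \<union> {(l, j). j < n \<and> l < j}. ?t j l)"
    by (rule sum.mono_neutral_right) (use s(3) in \<open>auto simp: not_less intro: le_neq_implies_less\<close>)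
  also have "\<dots> = (\<Sum>(j, l)\<in>{(j, l). j < n \<and> l < j}. ?t j l) + (\<Sum>(l, j)\<in>{(l, j). j < n \<and> l < j}. ?t l j)"
    using fin by (subst sum.union_disjoint) auto
  also have "\<dots> = (\<Sum>(l, j)\<in>{(l, j). j < n \<and> l < j}. ?t j l + ?t l j)"
    unfolding flip by (simp add: sum.distrib case_prod_unfold)
  also have "\<dots> = (\<Sum>(l, j)\<in>{(l, j). j < n \<and> l < j}. s j l * (mvar l * cofactor A i j - mvar j * cofactor A i l))"
  proof (intro sum.cong refl, clarify)
    fix l j
    show "?t j l + ?t l j = s j l * (mvar l * cofactor A i j - mvar j * cofactor A i l)"
      using s(2)[rule_format, of l j] by (simp add: algebra_simps)
  qed
  also have "\<dots> \<in> poly_ideal n n f"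
    using s(1) by (intro poly_ideal_sum)
      (auto intro!: poly_ideal_mult cofactor_exchange[OF A mp f i])
  finally show ?thesis .
qed

text \<open>
  Two presentations are joined by presentations that differ in one row only; the difference of the
  determinants is then a determinant with a row of relations between the variables.
\<close>

theorem det_presentation_unique:
  fixes A :: "'a::field mpoly mat"
  assumes "linear_presentation n f A" "linear_presentation n f A'"
  shows "det A' - det A \<in> poly_ideal n n f"
proof -
  note A = assms[unfolded linear_presentation_def]
  define H where "H t = mat n n (\<lambda>(i, j). if i < t then A' $$ (i, j) else A $$ (i, j))" for t
  have H: "H t \<in> carrier_mat n n" "linear_presentation n f (H t)" for t
  proof -
    show H: "H t \<in> carrier_mat n n" by (simp add: H_def)
    have "f i = (\<Sum>j<n. H t $$ (i, j) * mvar j)" if i: "i < n" for i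
    proof (cases "i < t")
      case True
      have "f i = (\<Sum>j<n. A' $$ (i, j) * mvar j)" using A i by blast
      also have "\<dots> = (\<Sum>j<n. H t $$ (i, j) * mvar j)"
        using True i by (intro sum.cong) (auto simp: H_def)
      finally show ?thesis .
    next
      case False
      have "f i = (\<Sum>j<n. A $$ (i, j) * mvar j)" using A i by blast
      also have "\<dots> = (\<Sum>j<n. H t $$ (i, j) * mvar j)"
        using False i by (intro sum.cong) (auto simp: H_def)
      finally show ?thesis .
    qed
    moreover have "\<forall>i<n. \<forall>j<n. H t $$ (i, j) \<in> mpolys n"
      using A by (simp add: H_def)
    ultimately show "linear_presentation n f (H t)" using H by (simp add: linear_presentation_def)
  qed
  have "det (H t) - det A \<in> poly_ideal n n f" if "t \<le> n" for t
    using that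
  proof (induction t)
    case 0
    have "H 0 = A" using A by (intro eq_matI) (auto simp: H_def)
    thus ?case by simp
  next
    case (Suc t)
    note t = H[of t, unfolded linear_presentation_def]
    have "H t = replace_row (H t) t (\<lambda>j. A $$ (t, j))"
      using Suc.prems by (intro eq_matI) (auto simp: H_def replace_row_def)
    hence 1: "det (H t) = (\<Sum>j<n. A $$ (t, j) * cofactor (H t) t j)"
      using det_replace_row[OF H(1), of t] Suc.prems by (metis Suc_le_lessD)
    have "H (Suc t) = replace_row (H t) t (\<lambda>j. A' $$ (t, j))"
      using Suc.prems by (intro eq_matI) (auto simp: H_def replace_row_def)
    hence 2: "det (H (Suc t)) = (\<Sum>j<n. A' $$ (t, j) * cofactor (H t) t j)"
      using det_replace_row[OF H(1), of t] Suc.prems by (metis Suc_le_lessD)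
    have "(\<Sum>j<n. (A' $$ (t, j) - A $$ (t, j)) * cofactor (H t) t j) \<in> poly_ideal n n f"
    proof (rule det_relation_row[OF H(1)])
      have "t < n" using Suc.prems by simp
      hence "f t = (\<Sum>j<n. A' $$ (t, j) * mvar j)" "f t = (\<Sum>j<n. A $$ (t, j) * mvar j)"
        using A by blast+
      hence "(\<Sum>j<n. A' $$ (t, j) * mvar j) = (\<Sum>j<n. A $$ (t, j) * mvar j)" by simp
      thus "(\<Sum>j<n. (A' $$ (t, j) - A $$ (t, j)) * mvar j) = 0"
        by (simp add: left_diff_distrib sum_subtractf)
      show "f k = (\<Sum>j<n. H t $$ (k, j) * mvar j)" if "k < n" for k
        using t that by blast
      show "A' $$ (t, j) - A $$ (t, j) \<in> mpolys n" if "j < n" for j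
        using A that Suc.prems by (auto intro!: mpolys_diff)
    qed (use t Suc.prems in auto)
    hence "det (H (Suc t)) - det (H t) \<in> poly_ideal n n f"
      unfolding 1 2 by (simp add: left_diff_distrib sum_subtractf)
    from poly_ideal_add[OF this Suc.IH] Suc.prems show ?case by simp
  qed
  from this[OF order_refl] have "det (H n) - det A \<in> poly_ideal n n f" .
  moreover have "H n = A'" using A by (intro eq_matI) (auto simp: H_def)
  ultimately show ?thesis by simp
qed

section \<open>The local algebra as a quotient of the polynomial ring\<close>

lemma two_nonzero: "CHAR('a::field) \<noteq> 2 \<Longrightarrow> (2::'a) \<noteq> 0"
  using of_nat_eq_0_iff_char_dvd[where 'a='a, of 2]
  by (auto dest: dvd_imp_le simp: CHAR_not_1 numeral_2_eq_2 le_Suc_eq)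

lemma mpolys_of_nat [simp]: "of_nat k \<in> mpolys n"
  by (induction k) (auto intro!: mpolys_add)

lemma lookup_mconst_0 [simp]: "lookup (mconst c) 0 = c"
  by (simp add: mconst_def)

text \<open>
  The maximal ideal annihilates the socle element: by Cramer's rule, multiplying by \<open>x\<^sub>l\<close> replaces the
  column \<open>l\<close> by the column of the \<open>f\<^sub>k\<close>.
\<close>

lemma mult_det_presentation:
  fixes f :: "nat \<Rightarrow> 'a::field mpoly"
  assumes "linear_presentation n f A" "l < n"
  shows "mvar l * det A \<in> poly_ideal n n f"
proof -
  note A = assms(1)[unfolded linear_presentation_def]
  define x where "x = vec n (mvar :: nat \<Rightarrow> 'a mpoly)"
  have x: "x \<in> carrier_vec n" by (simp add: x_def)
  have Ac: "A \<in> carrier_mat n n" using A by blast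
  have "(A *\<^sub>v x) $ k = f k" if "k < n" for k
  proof -
    have "(A *\<^sub>v x) $ k = (\<Sum>m<n. A $$ (k, m) * mvar m)"
      using Ac that by (auto simp: scalar_prod_def x_def lessThan_atLeast0 intro!: sum.cong)
    thus ?thesis using A that by simp
  qed
  hence col: "replace_col A (A *\<^sub>v x) l $$ (k, l) = f k" if "k < n" for k
    using that Ac assms(2) by (simp add: replace_col_def)
  have "mvar l * det A = det (replace_col A (A *\<^sub>v x) l)"
    using cramer_lemma_mat[OF Ac x assms(2)] assms(2) by (simp add: x_def)
  also have "\<dots> = (\<Sum>k<n. cofactor A k l * f k)"
  proof (subst laplace_expansion_column[of _ n l], goal_cases)
    case 1
    show ?case using Ac by (auto simp: replace_col_def)
  next
    case 3
    show ?case by (intro sum.cong refl) (use col assms(2) in \<open>auto simp: cofactor_replace_col[OF Ac]\<close>)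
  qed (use assms in auto)
  also have "\<dots> \<in> poly_ideal n n f"
    using A assms(2) by (intro poly_idealI mpolys_cofactor[OF Ac]) auto
  finally show ?thesis .
qed

text \<open>
  Nilpotency of the variables modulo the ideal already in the polynomial ring means that the origin is
  the whole fibre, as for weighted homogeneous maps.
\<close>

locale isolated_zero =
  fixes n :: nat and f :: "nat \<Rightarrow> 'a::field mpoly"
  assumes f_mpolys: "\<And>i. i < n \<Longrightarrow> f i \<in> mpolys n"
    and mvar_nilpotent: "\<And>i. i < n \<Longrightarrow> \<exists>M. mvar i ^ M \<in> poly_ideal n n f"
begin

abbreviation "J \<equiv> poly_ideal n n f"
abbreviation "R \<equiv> local_ring n :: 'a mpoly fract ring"
abbreviation "I \<equiv> local_ideal n f"
abbreviation "V \<equiv> local_algebra n f"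

lemma J_mpolys: "p \<in> J \<Longrightarrow> p \<in> mpolys n"
  using poly_ideal_mpolys f_mpolys by blast

lemma nilpotent_add:
  assumes "p \<in> mpolys n" "q \<in> mpolys n" "p ^ k \<in> J" "q ^ l \<in> J"
  shows "(p + q) ^ (k + l) \<in> J"
proof -
  have "of_nat ((k + l) choose i) * p ^ i * q ^ (k + l - i) \<in> J" if "i \<le> k + l" for i
  proof (cases "k \<le> i")
    case True
    then obtain i' where i: "i = k + i'" using le_Suc_ex by blast
    have "(of_nat ((k + l) choose i) * p ^ i' * q ^ (k + l - i)) * p ^ k \<in> J"
      using assms by (intro poly_ideal_mult mpolys_mult mpolys_power) auto
    thus ?thesis by (simp add: i power_add mult_ac)
  next
    case False
    hence i: "k + l - i = (k - i) + l" by simp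
    have "(of_nat ((k + l) choose i) * p ^ i * q ^ (k - i)) * q ^ l \<in> J"
      using assms by (intro poly_ideal_mult mpolys_mult mpolys_power) auto
    thus ?thesis unfolding i power_add by (simp add: mult_ac)
  qed
  thus ?thesis unfolding binomial_ring by (intro poly_ideal_sum) auto
qed

lemma maximal_ideal_nilpotent:
  assumes "p \<in> mpolys n" "lookup p 0 = 0"
  shows "\<exists>k. p ^ k \<in> J"
proof -
  obtain c where c: "\<forall>i<n. c i \<in> mpolys n" "p = (\<Sum>i<n. c i * mvar i)"
    using maximal_ideal_vars[OF assms] by (auto simp: poly_ideal_def)
  have "\<exists>k. (\<Sum>i<m. c i * mvar i) ^ k \<in> J" if "m \<le> n" for m
    using that
  proof (induction m)
    case 0
    show ?case by (rule exI[of _ 1]) simp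
  next
    case (Suc m)
    then obtain k where k: "(\<Sum>i<m. c i * mvar i) ^ k \<in> J" by auto
    obtain M where "mvar m ^ M \<in> J" using mvar_nilpotent Suc.prems by fastforce
    hence "(c m * mvar m) ^ M \<in> J"
      using c Suc.prems by (auto simp: power_mult_distrib intro!: poly_ideal_mult mpolys_power)
    moreover have "(\<Sum>i<m. c i * mvar i) \<in> mpolys n" "c m * mvar m \<in> mpolys n"
      using c Suc.prems by (auto intro!: mpolys_sum mpolys_mult mpolys_mvar)
    ultimately show ?case using nilpotent_add[OF _ _ k] by (auto simp del: power_Suc)
  qed
  thus ?thesis using c by blast
qed

text \<open>
  Modulo \<open>J\<close>, such an \<open>s\<close> is a nonzero constant minus a nilpotent polynomial, so the geometric series
  inverts it.  This is why localizing at the origin does not change the quotient by \<open>J\<close>.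
\<close>

lemma unit_modulo:
  assumes s: "s \<in> mpolys n" "lookup s 0 \<noteq> 0"
  shows "\<exists>t\<in>mpolys n. s * t - 1 \<in> J"
proof -
  define c where "c = inverse (lookup s 0)"
  define u where "u = 1 - mconst c * s"
  have u: "u \<in> mpolys n" using s by (auto simp: u_def intro!: mpolys_diff mpolys_mult)
  have "lookup u 0 = 0" using s by (simp add: u_def lookup_minus lookup_mult_0 c_def)
  from maximal_ideal_nilpotent[OF u this] obtain k where k: "u ^ k \<in> J" by blast
  have "s * (mconst c * (\<Sum>j<k. u ^ j)) = (1 - u) * (\<Sum>j<k. u ^ j)" by (simp add: u_def mult_ac)
  also have "\<dots> = 1 - u ^ k" by (rule one_diff_power_eq[symmetric])
  finally have "s * (mconst c * (\<Sum>j<k. u ^ j)) - 1 = - (u ^ k)" by simp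
  moreover have "mconst c * (\<Sum>j<k. u ^ j) \<in> mpolys n"
    using u by (intro mpolys_mult mpolys_sum mpolys_power) auto
  ultimately show ?thesis using k by (metis poly_ideal_uminus)
qed

text \<open>Newton's iteration for the square root, with the derivative kept at \<open>2\<close>, started at \<open>1\<close>.\<close>

lemma sqrt_modulo:
  assumes char: "CHAR('a) \<noteq> 2" and u: "u \<in> mpolys n" "lookup u 0 = 1"
  shows "\<exists>v\<in>mpolys n. v * v - u \<in> J"
proof -
  note two = two_nonzero[OF char]
  define t where "t = 1 - u"
  define h where "h = mconst (inverse (2::'a))"
  have hh: "h + h = 1"
  proof -
    have "inverse 2 + inverse 2 = (1::'a)" using two by (simp add: field_simps)
    thus ?thesis by (simp add: h_def flip: mconst_simps(3))
  qed
  have t: "t \<in> mpolys n" using u by (simp add: t_def mpolys_diff)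
  have "lookup t 0 = 0" using u by (simp add: t_def lookup_minus)
  from maximal_ideal_nilpotent[OF t this] obtain k where k: "t ^ k \<in> J" by blast
  have h: "h \<in> mpolys n" by (simp add: h_def)
  \<comment> \<open>Each step gains one power of \<open>t\<close>.\<close>
  have "\<exists>x\<in>mpolys n. \<exists>w\<in>mpolys n. (1 + t * x) * (1 + t * x) - u = t ^ Suc m * w" for m
  proof (induction m)
    case 0
    show ?case by (intro bexI[of _ 0] bexI[of _ 1]) (simp_all add: t_def)
  next
    case (Suc m)
    then obtain x w where x: "x \<in> mpolys n" and w: "w \<in> mpolys n"
      and e: "(1 + t * x) * (1 + t * x) - u = t ^ Suc m * w" by blast
    define y where "y = t ^ m * h * w"
    have yy: "t * y + t * y = t ^ Suc m * w"
    proof -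
      have "t * y + t * y = t ^ Suc m * w * (h + h)" by (simp add: y_def algebra_simps)
      thus ?thesis by (simp only: hh mult_1_right)
    qed
    have "(1 + t * (x - y)) * (1 + t * (x - y)) - u
        = ((1 + t * x) * (1 + t * x) - u) - (t * y + t * y) * (1 + t * x) + t * y * (t * y)"
      by (simp add: algebra_simps)
    also have "\<dots> = t ^ Suc (Suc m) * (t ^ m * h * w * h * w - w * x)"
      unfolding e yy by (simp add: y_def algebra_simps)
    finally have "(1 + t * (x - y)) * (1 + t * (x - y)) - u
        = t ^ Suc (Suc m) * (t ^ m * h * w * h * w - w * x)" .
    moreover have "x - y \<in> mpolys n" "t ^ m * h * w * h * w - w * x \<in> mpolys n"
      using x w h t by (auto simp: y_def intro!: mpolys_diff mpolys_mult mpolys_power)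
    ultimately show ?case by blast
  qed
  then obtain x w where x: "x \<in> mpolys n" and w: "w \<in> mpolys n"
    and e: "(1 + t * x) * (1 + t * x) - u = t ^ Suc k * w" by blast
  have "(t * w) * t ^ k \<in> J" using k t w by (intro poly_ideal_mult mpolys_mult)
  hence "(1 + t * x) * (1 + t * x) - u \<in> J" unfolding e by (simp add: mult_ac)
  moreover have "1 + t * x \<in> mpolys n" using x t by (auto intro!: mpolys_add mpolys_mult)
  ultimately show ?thesis by blast
qed

lemma mult_add_sub:
  assumes "p \<in> mpolys n" "p' \<in> mpolys n" "q \<in> mpolys n" "q' \<in> mpolys n" "p - p' \<in> J" "q - q' \<in> J"
  shows "p * q - p' * q' \<in> J"
proof -
  have "p * q - p' * q' = q * (p - p') + p' * (q - q')" by (simp add: algebra_simps)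
  thus ?thesis using assms by (auto intro!: poly_ideal_add poly_ideal_mult)
qed

interpretation R: cring R by (rule local_ring_cring)
interpretation I: ideal I R by (rule local_ideal_ideal[OF f_mpolys])
interpretation Q: cring "R Quot I" by (rule I.quotient_is_cring[OF local_ring_cring])

lemma a_inv_local_ring: "x \<in> carrier R \<Longrightarrow> \<ominus>\<^bsub>R\<^esub> x = - x"
  by (rule R.minus_equality) (auto simp: local_ring_uminus)

lemma local_ideal_generators: "i < n \<Longrightarrow> to_fract (f i) \<in> I"
  unfolding local_ideal_def
  by (rule subsetD[OF R.genideal_self]) (auto intro: to_fract_local_ring f_mpolys)

lemma to_fract_J: assumes "p \<in> J" shows "to_fract p \<in> I"
proof -
  obtain c where c: "\<forall>i<n. c i \<in> mpolys n" "p = (\<Sum>i<n. c i * f i)"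
    using assms by (auto simp: poly_ideal_def)
  have "to_fract (\<Sum>i<m. c i * f i) \<in> I" if "m \<le> n" for m
    using that
  proof (induction m)
    case 0
    show ?case using I.zero_closed by simp
  next
    case (Suc m)
    hence 1: "to_fract (\<Sum>i<m. c i * f i) \<in> I" by simp
    have 2: "to_fract (c m) * to_fract (f m) \<in> I"
      using I.I_l_closed[OF local_ideal_generators[of m] to_fract_local_ring[of "c m" n]] c Suc.prems
      by simp
    show ?case using I.a_closed[OF 1 2] by simp
  qed
  thus ?thesis using c by blast
qed

text \<open>The extension of \<open>J\<close> to the local ring consists of the fractions with numerator in \<open>J\<close>.\<close>

lemma local_ideal_fractions:
  "I \<subseteq> {Fract p s |p s. p \<in> J \<and> s \<in> mpolys n \<and> lookup s 0 \<noteq> 0}" (is "_ \<subseteq> ?I'")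
  unfolding local_ideal_def
proof (rule R.genideal_minimal)
  have nz: "s \<noteq> 0" if "lookup s 0 \<noteq> 0" for s :: "'a mpoly" using that by auto
  have I'I: "Fract p s \<in> ?I'" if "p \<in> J" "s \<in> mpolys n" "lookup s 0 \<noteq> 0" for p s
    using that by blast
  have sub: "?I' \<subseteq> carrier R" by (auto intro!: local_ringI J_mpolys)
  show "ideal ?I' R"
  proof (rule idealI[OF R.ring_axioms])
    show "subgroup ?I' (add_monoid R)"
    proof (rule subgroup.intro)
      show "x \<otimes>\<^bsub>add_monoid R\<^esub> y \<in> ?I'" if xy: "x \<in> ?I'" "y \<in> ?I'" for x y
      proof -
        obtain p s where x: "x = Fract p s" "p \<in> J" "s \<in> mpolys n" "lookup s 0 \<noteq> 0" using xy by blast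
        obtain q t where y: "y = Fract q t" "q \<in> J" "t \<in> mpolys n" "lookup t 0 \<noteq> 0" using xy by blast
        have "x + y = Fract (t * p + s * q) (s * t)" using x y nz by (simp add: mult.commute)
        moreover have "t * p + s * q \<in> J" using x y by (intro poly_ideal_add poly_ideal_mult)
        ultimately show ?thesis using x y I'I[of "t * p + s * q" "s * t"]
          by (simp add: mpolys_mult lookup_mult_0)
      qed
      show "inv\<^bsub>add_monoid R\<^esub> x \<in> ?I'" if xI: "x \<in> ?I'" for x
      proof -
        obtain p s where x: "x = Fract p s" "p \<in> J" "s \<in> mpolys n" "lookup s 0 \<noteq> 0" using xI by blast
        have "inv\<^bsub>add_monoid R\<^esub> x = - x" using a_inv_local_ring sub xI by (auto simp: a_inv_def)
        also have "\<dots> = Fract (- p) s" using x by simp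
        finally show ?thesis using x poly_ideal_uminus by blast
      qed
      show "\<one>\<^bsub>add_monoid R\<^esub> \<in> ?I'"
        using I'I[of 0 1] by (simp add: Zero_fract_def)
    qed (use sub in auto)
    show *: "y \<otimes>\<^bsub>R\<^esub> x \<in> ?I'" if xy: "x \<in> ?I'" "y \<in> carrier R" for x y
    proof -
      obtain p s where x: "x = Fract p s" "p \<in> J" "s \<in> mpolys n" "lookup s 0 \<noteq> 0" using xy by blast
      obtain q t where y: "y = Fract q t" "q \<in> mpolys n" "t \<in> mpolys n" "lookup t 0 \<noteq> 0"
        using xy(2) by (rule local_ringE)
      have "y * x = Fract (q * p) (t * s)" using x y by simp
      moreover have "q * p \<in> J" using x y by (intro poly_ideal_mult)
      ultimately show ?thesis using x y I'I[of "q * p" "t * s"]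
        by (simp add: mpolys_mult lookup_mult_0)
    qed
    show "x \<otimes>\<^bsub>R\<^esub> y \<in> ?I'" if "x \<in> ?I'" "y \<in> carrier R" for x y
      using *[OF that] by (simp add: mult.commute)
  qed
  show "(\<lambda>i. to_fract (f i)) ` {..<n} \<subseteq> ?I'"
  proof clarify
    fix i assume "i < n"
    hence "f i \<in> J" using poly_ideal_gen[of 1 n i n f] by simp
    thus "\<exists>p s. to_fract (f i) = Fract p s \<and> p \<in> J \<and> s \<in> mpolys n \<and> lookup s 0 \<noteq> 0"
      by (intro exI[of _ "f i"] exI[of _ 1]) (simp add: to_fract_def)
  qed
qed

lemma to_fract_in_local_ideal:
  assumes "q \<in> mpolys n" shows "to_fract q \<in> I \<longleftrightarrow> q \<in> J"
proof
  assume "to_fract q \<in> I"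
  then obtain p s where ps: "to_fract q = Fract p s" "p \<in> J" "s \<in> mpolys n" "lookup s 0 \<noteq> 0"
    using local_ideal_fractions by blast
  have "s \<noteq> 0" using ps by auto
  hence sq: "q * s = p" using ps(1) by (simp add: to_fract_def eq_fract)
  obtain t where t: "t \<in> mpolys n" "s * t - 1 \<in> J" using unit_modulo[OF ps(3,4)] by blast
  have "q = t * p - q * (s * t - 1)" unfolding sq[symmetric] by (simp add: algebra_simps)
  also have "\<dots> \<in> J"
    by (rule poly_ideal_diff; rule poly_ideal_mult) (use ps t assms in auto)
  finally show "q \<in> J" .
qed (rule to_fract_J)

definition coset :: "'a mpoly \<Rightarrow> 'a mpoly fract set" where
  "coset p = I +>\<^bsub>R\<^esub> to_fract p"

lemma local_algebra_simps:
  "carrier V = carrier (R Quot I)" "mult V = mult (R Quot I)" "one V = one (R Quot I)"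
  "zero V = zero (R Quot I)" "add V = add (R Quot I)" "smult V c X = coset (mconst c) \<otimes>\<^bsub>R Quot I\<^esub> X"
  by (simp_all add: local_algebra_def Let_def coset_def)

lemma coset_closed: "p \<in> mpolys n \<Longrightarrow> coset p \<in> carrier V"
  unfolding local_algebra_simps coset_def
  by (rule ring_hom_closed[OF I.rcos_ring_hom]) (rule to_fract_local_ring)

lemma coset_add: "p \<in> mpolys n \<Longrightarrow> q \<in> mpolys n \<Longrightarrow> coset p \<oplus>\<^bsub>V\<^esub> coset q = coset (p + q)"
  unfolding local_algebra_simps coset_def
  by (subst ring_hom_add[OF I.rcos_ring_hom, symmetric]) (auto intro: to_fract_local_ring)

lemma coset_mult: "p \<in> mpolys n \<Longrightarrow> q \<in> mpolys n \<Longrightarrow> coset p \<otimes>\<^bsub>V\<^esub> coset q = coset (p * q)"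
  unfolding local_algebra_simps coset_def
  by (subst ring_hom_mult[OF I.rcos_ring_hom, symmetric]) (auto intro: to_fract_local_ring)

lemma coset_smult: "p \<in> mpolys n \<Longrightarrow> c \<odot>\<^bsub>V\<^esub> coset p = coset (mconst c * p)"
  using coset_mult[of "mconst c" p] by (simp add: local_algebra_simps)

lemma coset_eq:
  assumes "p \<in> mpolys n" "q \<in> mpolys n"
  shows "coset p = coset q \<longleftrightarrow> p - q \<in> J"
proof -
  note c = to_fract_local_ring[OF assms(1)] to_fract_local_ring[OF assms(2)]
  have "coset p = coset q \<longleftrightarrow> to_fract p \<ominus>\<^bsub>R\<^esub> to_fract q \<in> I"
    unfolding coset_def using R.quotient_eq_iff_same_a_r_cos[OF I.ideal_axioms c] by simp
  also have "to_fract p \<ominus>\<^bsub>R\<^esub> to_fract q = to_fract (p - q)"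
    using c by (simp add: a_minus_def a_inv_local_ring)
  finally show ?thesis using to_fract_in_local_ideal[of "p - q"] assms by (simp add: mpolys_diff)
qed

lemma coset_zero: "coset 0 = \<zero>\<^bsub>V\<^esub>"
  unfolding local_algebra_simps coset_def using ring_hom_zero[OF I.rcos_ring_hom R.ring_axioms Q.ring_axioms]
  by simp

lemma coset_surj:
  assumes "X \<in> carrier V" shows "\<exists>p\<in>mpolys n. X = coset p"
proof -
  from assms obtain x where x: "x \<in> carrier R" "X = I +>\<^bsub>R\<^esub> x"
    unfolding local_algebra_simps by (auto simp: FactRing_def A_RCOSETS_def')
  from x(1) obtain p s where ps: "x = Fract p s" "p \<in> mpolys n" "s \<in> mpolys n" "lookup s 0 \<noteq> 0" "s \<noteq> 0"
    by (rule local_ringE)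
  obtain t where t: "t \<in> mpolys n" "s * t - 1 \<in> J" using unit_modulo[OF ps(3,4)] by blast
  have c: "to_fract (p * t) \<in> carrier R" using ps t by (intro to_fract_local_ring mpolys_mult)
  have "x \<ominus>\<^bsub>R\<^esub> to_fract (p * t) = x - to_fract (p * t)"
    using c by (simp add: a_minus_def a_inv_local_ring)
  also have "\<dots> = Fract (- p) s * to_fract (s * t - 1)"
    using ps(5) unfolding ps(1) to_fract_def by (simp add: eq_fract algebra_simps)
  also have "\<dots> \<in> I"
    using I.I_l_closed[OF to_fract_J[OF t(2)], of "Fract (- p) s"] ps
    by (simp add: local_ringI mpolys_uminus)
  finally have "X = coset (p * t)"
    unfolding coset_def x(2) using R.quotient_eq_iff_same_a_r_cos[OF I.ideal_axioms x(1) c] by simp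
  thus ?thesis using ps t by (auto intro!: mpolys_mult)
qed

lemma socle_element_coset: "socle_element n f A = coset (det A)"
  by (simp add: socle_element_def coset_def)

lemma V_vectorspace: "vectorspace class_ring V"
  by (rule local_algebra_vectorspace[OF f_mpolys])

end

section \<open>The EKL-degree from a functional and a basis\<close>

lemma gw_of_mat_congruent:
  assumes "nondeg_sym_mat A" "nondeg_sym_mat B" "congruent_mat A B"
  shows "gw_of_mat A = gw_of_mat B"
proof -
  have "form_isometric (Form A) (Form B)"
    using assms by (simp add: form_isometric.rep_eq Form_inverse)
  hence "abs_form_class (Form A) = abs_form_class (Form B)"
    by (simp add: form_class.abs_eq_iff)
  thus ?thesis by (simp add: gw_of_mat_def)
qed

lemma gram_matrix_carrier [simp]: "gram_matrix \<beta> vs \<in> carrier_mat (length vs) (length vs)"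
  by (simp add: gram_matrix_def)

lemma gram_matrix_index:
  "i < length vs \<Longrightarrow> j < length vs \<Longrightarrow> gram_matrix \<beta> vs $$ (i, j) = \<beta> (vs ! i) (vs ! j)"
  by (simp add: gram_matrix_def)

lemma mult_mat_index:
  assumes "A \<in> carrier_mat n m" "B \<in> carrier_mat m l" "i < n" "j < l"
  shows "(A * B) $$ (i, j) = (\<Sum>k<m. A $$ (i, k) * B $$ (k, j))"
  using assms by (auto simp: scalar_prod_def atLeast0LessThan intro!: sum.cong)

lemma sum_list_nth_lessThan: "(\<Sum>x\<leftarrow>xs. g x) = (\<Sum>i<length xs. g (xs ! i))"
  by (simp add: sum_list_sum_nth atLeast0LessThan)

lemma base_module_vectorspace: "vectorspace class_ring (base_module :: ('a::field, 'a) module)"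
proof -
  have "module class_ring (base_module :: ('a, 'a) module)"
  proof (rule moduleI)
    show "cring (class_ring :: 'a ring)" by (rule field.axioms domain.axioms class_field.field_axioms)+
    show "abelian_group (base_module :: ('a, 'a) module)"
      by (rule abelian_groupI) (auto simp: base_module_def intro: exI[of _ "- x" for x])
  qed (auto simp: base_module_def algebra_simps)
  thus ?thesis using class_field.field_axioms by (simp add: vectorspace_def)
qed

text \<open>
  Elements that span the quotient by the ideal and have a nondegenerate Gram matrix are a basis of it:
  a relation between them would be orthogonal to all of them.
\<close>

locale socle_functional = isolated_zero n f for n and f :: "nat \<Rightarrow> 'a::field mpoly" +
  fixes L :: "'a mpoly \<Rightarrow> 'a" and bs :: "'a mpoly list"
  assumes char_not_2: "CHAR('a) \<noteq> 2"
    and L_add: "\<And>p q. p \<in> mpolys n \<Longrightarrow> q \<in> mpolys n \<Longrightarrow> L (p + q) = L p + L q"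
    and L_smult: "\<And>c p. p \<in> mpolys n \<Longrightarrow> L (mconst c * p) = c * L p"
    and L_ideal: "\<And>p. p \<in> poly_ideal n n f \<Longrightarrow> L p = 0"
    and L_socle: "\<And>A. linear_presentation n f A \<Longrightarrow> L (det A) = 1"
    and presentation_ex: "\<exists>A. linear_presentation n f A"
    and bs_mpolys: "set bs \<subseteq> mpolys n"
    and bs_span: "\<And>p. p \<in> mpolys n \<Longrightarrow> \<exists>c. p - (\<Sum>i<length bs. mconst (c i) * bs ! i) \<in> poly_ideal n n f"
    and gram_nondeg: "nondeg_sym_mat (gram_matrix (\<lambda>p q. L (p * q)) bs)"
begin

abbreviation "N \<equiv> length bs"
abbreviation "G \<equiv> gram_matrix (\<lambda>p q. L (p * q)) bs"

lemma bs_nth [simp]: "i < N \<Longrightarrow> bs ! i \<in> mpolys n"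
  using bs_mpolys nth_mem by blast

lemma L_cong:
  assumes "p \<in> mpolys n" "q \<in> mpolys n" "p - q \<in> J" shows "L p = L q"
  using L_add[OF mpolys_diff[OF assms(1,2)] assms(2)] L_ideal[OF assms(3)] by simp

lemma L_sum:
  assumes "\<And>i. i < m \<Longrightarrow> q i \<in> mpolys n"
  shows "L (\<Sum>i<m. mconst (c i) * q i) = (\<Sum>i<(m::nat). c i * L (q i))"
  using assms
proof (induction m)
  case 0
  show ?case using L_ideal[of 0] by simp
next
  case (Suc m)
  have "L (\<Sum>i<Suc m. mconst (c i) * q i) = L (\<Sum>i<m. mconst (c i) * q i) + L (mconst (c m) * q m)"
    using Suc.prems by (simp, intro L_add mpolys_sum mpolys_mult) auto
  thus ?case using Suc by (simp add: L_smult)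
qed

lemma gram_inverse:
  obtains B where "B \<in> carrier_mat N N" "G * B = 1\<^sub>m N" "B * G = 1\<^sub>m N"
  using mat_inverse_ex[of G N] gram_nondeg by (auto simp: nondeg_sym_mat_def)

lemma bs_independent:
  assumes "(\<Sum>i<N. mconst (c i) * bs ! i) \<in> J" "k < N"
  shows "c k = 0"
proof -
  obtain B where B: "B \<in> carrier_mat N N" "G * B = 1\<^sub>m N" "B * G = 1\<^sub>m N" by (rule gram_inverse)
  have 0: "(\<Sum>i<N. c i * G $$ (i, j)) = 0" if j: "j < N" for j
  proof -
    have "bs ! j * (\<Sum>i<N. mconst (c i) * bs ! i) \<in> J" using assms j by (intro poly_ideal_mult) auto
    also have "bs ! j * (\<Sum>i<N. mconst (c i) * bs ! i) = (\<Sum>i<N. mconst (c i) * (bs ! i * bs ! j))"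
      by (simp add: sum_distrib_left mult_ac)
    finally have "0 = L \<dots>" using L_ideal by simp
    also have "\<dots> = (\<Sum>i<N. c i * G $$ (i, j))"
      using j by (subst L_sum) (auto intro!: mpolys_mult simp: gram_matrix_index)
    finally show ?thesis ..
  qed
  have "c k = (\<Sum>i<N. c i * (G * B) $$ (i, k))"
    using assms(2) by (simp add: B(2) if_distrib[of "\<lambda>a. _ * a"] cong: if_cong)
  also have "\<dots> = (\<Sum>i<N. \<Sum>j<N. c i * G $$ (i, j) * B $$ (j, k))"
    using B(1) assms(2) by (intro sum.cong refl)
      (auto simp: scalar_prod_def atLeast0LessThan sum_distrib_left mult.assoc gram_matrix_def intro!: sum.cong)
  also have "\<dots> = (\<Sum>j<N. (\<Sum>i<N. c i * G $$ (i, j)) * B $$ (j, k))"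
    by (subst sum.swap) (simp add: sum_distrib_right)
  also have "\<dots> = 0" using 0 by simp
  finally show ?thesis .
qed

text \<open>
  Nondegeneracy of the Gram matrix represents every functional on the quotient as \<open>L (u \<cdot>)\<close>.
\<close>

lemma bs_dual_element:
  "\<exists>u\<in>mpolys n. \<forall>j<N. L (u * bs ! j) = g j"
proof -
  obtain B where B: "B \<in> carrier_mat N N" "G * B = 1\<^sub>m N" "B * G = 1\<^sub>m N" by (rule gram_inverse)
  define c where "c i = (\<Sum>k<N. g k * B $$ (k, i))" for i
  have "L ((\<Sum>i<N. mconst (c i) * bs ! i) * bs ! j) = g j" if j: "j < N" for j
  proof -
    have "L ((\<Sum>i<N. mconst (c i) * bs ! i) * bs ! j) = L (\<Sum>i<N. mconst (c i) * (bs ! i * bs ! j))"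
      by (simp add: sum_distrib_right mult.assoc)
    also have "\<dots> = (\<Sum>i<N. c i * G $$ (i, j))"
      using j by (subst L_sum) (auto intro!: mpolys_mult simp: gram_matrix_index)
    also have "\<dots> = (\<Sum>k<N. \<Sum>i<N. g k * (B $$ (k, i) * G $$ (i, j)))"
      by (subst sum.swap) (simp add: c_def sum_distrib_right mult.assoc)
    also have "\<dots> = (\<Sum>k<N. g k * (B * G) $$ (k, j))"
      using B(1) j by (intro sum.cong refl)
        (auto simp: scalar_prod_def atLeast0LessThan sum_distrib_left gram_matrix_def intro!: sum.cong)
    also have "\<dots> = g j" using j by (simp add: B(3) if_distrib[of "\<lambda>a. _ * a"] cong: if_cong)
    finally show ?thesis .
  qed
  moreover have "(\<Sum>i<N. mconst (c i) * bs ! i) \<in> mpolys n" by (intro mpolys_sum mpolys_mult) auto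
  ultimately show ?thesis by blast
qed

interpretation VS: vectorspace class_ring V by (rule V_vectorspace)

lemma lincomb_coset:
  assumes "set qs \<subseteq> mpolys n" "distinct (map coset qs)"
  shows "VS.lincomb a (set (map coset qs)) = coset (\<Sum>q\<leftarrow>qs. mconst (a (coset q)) * q)"
  using assms
proof (induction qs)
  case Nil
  show ?case by (simp add: VS.lincomb_def coset_zero)
next
  case (Cons q qs)
  have s: "(\<Sum>q\<leftarrow>qs. mconst (a (coset q)) * q) \<in> mpolys n"
    unfolding sum_list_nth_lessThan using Cons.prems by (intro mpolys_sum mpolys_mult) auto
  have c: "coset p \<in> carrier V" if "p \<in> set (q # qs)" for p
    using that Cons.prems by (auto intro: coset_closed)
  have "VS.lincomb a (set (map coset (q # qs)))
      = a (coset q) \<odot>\<^bsub>V\<^esub> coset q \<oplus>\<^bsub>V\<^esub> VS.lincomb a (set (map coset qs))"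
    unfolding VS.lincomb_def using Cons.prems c
    by (simp, subst VS.finsum_insert) (auto intro!: VS.smult_closed)
  thus ?case using Cons s
    by (simp add: coset_smult coset_add mpolys_mult)
qed

lemma coset_bs_distinct: "distinct (map coset bs)"
proof (unfold distinct_conv_nth, clarsimp)
  fix i j assume ij: "i < N" "j < N" "i \<noteq> j" and "coset (bs ! i) = coset (bs ! j)"
  hence "bs ! i - bs ! j \<in> J" by (simp add: coset_eq)
  also have "bs ! i - bs ! j = (\<Sum>k<N. mconst (if k = i then 1 else if k = j then - 1 else 0) * bs ! k)"
  proof -
    have "(\<Sum>k<N. mconst (if k = i then 1 else if k = j then - 1 else 0) * bs ! k)
       = (\<Sum>k<N. (if k = i then bs ! k else 0) - (if k = j then bs ! k else 0))"
    proof (intro sum.cong refl)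
      have "mconst (- 1) = (- 1 :: 'a mpoly)" by (simp add: mconst_def single_uminus)
      thus "mconst (if k = i then 1 else if k = j then - 1 else 0) * bs ! k
        = (if k = i then bs ! k else 0) - (if k = j then bs ! k else 0)" for k
        using ij by auto
    qed
    also have "\<dots> = bs ! i - bs ! j" using ij by (simp add: sum_subtractf)
    finally show ?thesis ..
  qed
  finally have "(if i = i then 1 else if i = j then - 1 else 0) = (0::'a)"
    by (rule bs_independent) (rule ij)
  thus False by simp
qed

lemma coset_bs_basis: "VS.basis (set (map coset bs))"
  unfolding VS.basis_def
proof (intro conjI)
  let ?B = "set (map coset bs)"
  show sub: "?B \<subseteq> carrier V" using bs_mpolys by (auto intro: coset_closed)
  have lc: "VS.lincomb a ?B = coset (\<Sum>i<N. mconst (a (coset (bs ! i))) * bs ! i)" for a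
    using lincomb_coset[OF bs_mpolys coset_bs_distinct] by (simp add: sum_list_nth_lessThan)
  have cl: "(\<Sum>i<N. mconst (c i) * bs ! i) \<in> mpolys n" for c
    by (intro mpolys_sum mpolys_mult) auto
  show "VS.lin_indpt ?B"
  proof (rule VS.finite_lin_indpt2)
    fix a assume "VS.lincomb a ?B = \<zero>\<^bsub>V\<^esub>"
    hence "coset (\<Sum>i<N. mconst (a (coset (bs ! i))) * bs ! i) = coset 0"
      by (simp only: lc coset_zero)
    hence "(\<Sum>i<N. mconst (a (coset (bs ! i))) * bs ! i) \<in> J"
      using coset_eq[OF cl mpolys_0] by simp
    from bs_independent[OF this] show "\<forall>v\<in>?B. a v = \<zero>\<^bsub>class_ring\<^esub>"
      by (auto simp: in_set_conv_nth)
  qed (use sub in auto)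
  have "X \<in> VS.span ?B" if X: "X \<in> carrier V" for X
  proof -
    obtain p where p: "p \<in> mpolys n" "X = coset p" using coset_surj[OF X] by blast
    obtain c where c: "p - (\<Sum>i<N. mconst (c i) * bs ! i) \<in> J" using bs_span[OF p(1)] by blast
    define a where "a = c \<circ> the_inv_into {..<N} (\<lambda>i. coset (bs ! i))"
    have "inj_on (\<lambda>i. coset (bs ! i)) {..<N}"
      using coset_bs_distinct by (auto simp: inj_on_def distinct_conv_nth)
    hence "a (coset (bs ! i)) = c i" if "i < N" for i
      using that the_inv_into_f_f[of "\<lambda>i. coset (bs ! i)" "{..<N}" i] by (simp add: a_def)
    hence "VS.lincomb a ?B = coset (\<Sum>i<N. mconst (c i) * bs ! i)" unfolding lc by simp
    also have "\<dots> = X" using coset_eq[OF p(1) cl[of c]] c p by metis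
    finally show ?thesis using VS.finite_span[OF _ sub] by auto
  qed
  thus "VS.span ?B = carrier V" using VS.span_is_subset2[OF sub] by auto
qed

lemma V_dim: "VS.dim = N"
  using VS.dim_basis[OF _ coset_bs_basis] distinct_card[OF coset_bs_distinct] by simp

definition functional :: "'a mpoly fract set \<Rightarrow> 'a" where
  "functional X = L (SOME p. p \<in> mpolys n \<and> X = coset p)"

lemma functional_coset:
  assumes "p \<in> mpolys n" shows "functional (coset p) = L p"
proof -
  let ?q = "SOME q. q \<in> mpolys n \<and> coset p = coset q"
  have "?q \<in> mpolys n \<and> coset p = coset ?q" by (rule someI[of _ p]) (use assms in simp)
  hence q: "?q \<in> mpolys n" "coset ?q = coset p" by simp_all
  from iffD1[OF coset_eq[OF q(1) assms] q(2)] have "?q - p \<in> J" .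
  thus ?thesis unfolding functional_def by (rule L_cong[OF q(1) assms])
qed

lemma functional_linear: "linear_map class_ring V base_module functional"
proof -
  have "functional \<in> LinearCombinations.module_hom class_ring V base_module"
    unfolding LinearCombinations.module_hom_def
  proof (safe)
    fix X Y assume "X \<in> carrier V" "Y \<in> carrier V"
    then obtain p q where pq: "p \<in> mpolys n" "X = coset p" "q \<in> mpolys n" "Y = coset q"
      using coset_surj by metis
    thus "functional (X \<oplus>\<^bsub>V\<^esub> Y) = functional X \<oplus>\<^bsub>base_module\<^esub> functional Y"
      by (simp add: coset_add functional_coset mpolys_add L_add base_module_def)
  next
    fix c X assume "X \<in> carrier V"
    then obtain p where pq: "p \<in> mpolys n" "X = coset p"
      using coset_surj by metis
    thus "functional (c \<odot>\<^bsub>V\<^esub> X) = c \<odot>\<^bsub>base_module\<^esub> functional X"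
      by (simp add: coset_smult functional_coset mpolys_mult L_smult base_module_def)
  qed (simp add: base_module_def)
  thus ?thesis using VS.vectorspace_axioms base_module_vectorspace[where 'a='a]
    by (simp add: linear_map_def mod_hom_def mod_hom_axioms_def vectorspace_def)
qed

lemma presentation_det: "linear_presentation n f A \<Longrightarrow> det A \<in> mpolys n"
  by (rule mpolys_det) (auto simp: linear_presentation_def)

text \<open>
  Any other functional is \<open>L(u \<cdot>)\<close> for some \<open>u\<close>, and its value on the socle element is the constant
  term of \<open>u\<close>.  If that is \<open>1\<close>, then \<open>u\<close> is a square \<open>v\<^sup>2\<close>, and multiplication by \<open>v\<close> is an isometry
  between the two forms.
\<close>

lemma gw_class_unique:
  assumes A: "linear_presentation n f A"
    and phi: "linear_map class_ring V base_module \<phi>" and phi1: "\<phi> (socle_element n f A) = 1"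
    and cl: "has_gw_class V (\<lambda>x y. \<phi> (x \<otimes>\<^bsub>V\<^esub> y)) \<gamma>"
  shows "\<gamma> = gw_of_mat G"
proof -
  interpret lin: linear_map class_ring V base_module \<phi> by (rule phi)
  obtain vs where vs: "distinct vs" "VS.basis (set vs)"
    "nondeg_sym_mat (gram_matrix (\<lambda>x y. \<phi> (x \<otimes>\<^bsub>V\<^esub> y)) vs)"
    "\<gamma> = gw_of_mat (gram_matrix (\<lambda>x y. \<phi> (x \<otimes>\<^bsub>V\<^esub> y)) vs)"
    using cl by (auto simp: has_gw_class_def)
  let ?G' = "gram_matrix (\<lambda>x y. \<phi> (x \<otimes>\<^bsub>V\<^esub> y)) vs"
  have len: "length vs = N"
    using VS.dim_basis[OF _ vs(2)] distinct_card[OF vs(1)] V_dim by simp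
  have "\<forall>i<N. \<exists>q\<in>mpolys n. vs ! i = coset q"
  proof (intro allI impI)
    fix i assume "i < N"
    hence "vs ! i \<in> carrier V" using vs(2) len unfolding VS.basis_def by auto
    thus "\<exists>q\<in>mpolys n. vs ! i = coset q" by (rule coset_surj)
  qed
  then obtain q where q: "\<And>i. i < N \<Longrightarrow> q i \<in> mpolys n" "\<And>i. i < N \<Longrightarrow> vs ! i = coset (q i)"
    by metis
  define \<psi> where "\<psi> p = \<phi> (coset p)" for p
  have psi_add: "\<psi> (p + r) = \<psi> p + \<psi> r" if "p \<in> mpolys n" "r \<in> mpolys n" for p r
    using lin.f_add[of "coset p" "coset r"] that
    by (simp add: \<psi>_def coset_add coset_closed base_module_def)
  have psi_smult: "\<psi> (mconst c * p) = c * \<psi> p" if "p \<in> mpolys n" for p c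
    using lin.f_smult[of c "coset p"] that
    by (simp add: \<psi>_def coset_smult coset_closed base_module_def)
  have psi_0: "\<psi> p = 0" if "p \<in> J" for p
  proof -
    have p: "p \<in> mpolys n" using that J_mpolys by blast
    have "\<psi> p = \<psi> (mconst 0 * 0)" unfolding \<psi>_def using that coset_eq[OF p mpolys_0] by simp
    also have "\<dots> = 0" by (simp only: psi_smult[OF mpolys_0] mult_zero_left)
    finally show ?thesis .
  qed
  have psi_cong: "\<psi> p = \<psi> r" if "p \<in> mpolys n" "r \<in> mpolys n" "p - r \<in> J" for p r
    using psi_add[OF mpolys_diff[OF that(1,2)] that(2)] psi_0[OF that(3)] by simp
  have cl: "(\<Sum>i<N. mconst (c i) * bs ! i) \<in> mpolys n" for c
    by (intro mpolys_sum mpolys_mult) auto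
  have psi_sum: "\<psi> (\<Sum>i<m. mconst (c i) * bs ! i) = (\<Sum>i<m. c i * \<psi> (bs ! i))" if "m \<le> N" for m c
    using that
  proof (induction m)
    case (Suc m)
    have "\<psi> (\<Sum>i<Suc m. mconst (c i) * bs ! i)
        = \<psi> (\<Sum>i<m. mconst (c i) * bs ! i) + \<psi> (mconst (c m) * bs ! m)"
      using Suc.prems by (simp, intro psi_add mpolys_sum mpolys_mult) auto
    thus ?case using Suc by (simp add: psi_smult)
  qed (simp add: psi_0)
  obtain u where u: "u \<in> mpolys n" "\<forall>j<N. L (u * bs ! j) = \<psi> (bs ! j)"
    using bs_dual_element[of "\<lambda>j. \<psi> (bs ! j)"] by blast
  have psi_L: "\<psi> p = L (u * p)" if p: "p \<in> mpolys n" for p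
  proof -
    obtain c where c: "p - (\<Sum>i<N. mconst (c i) * bs ! i) \<in> J" using bs_span[OF p] by blast
    have "\<psi> p = (\<Sum>i<N. c i * L (u * bs ! i))"
      using psi_cong[OF p cl c] psi_sum[OF order_refl] u by simp
    also have "\<dots> = L (\<Sum>i<N. mconst (c i) * (u * bs ! i))"
      using u by (subst L_sum) (auto intro: mpolys_mult)
    also have "(\<Sum>i<N. mconst (c i) * (u * bs ! i)) = u * (\<Sum>i<N. mconst (c i) * bs ! i)"
      by (simp add: sum_distrib_left mult_ac)
    also have "L \<dots> = L (u * p)"
    proof (rule L_cong[symmetric])
      have "u * (p - (\<Sum>i<N. mconst (c i) * bs ! i)) \<in> J" using u c by (intro poly_ideal_mult)
      thus "u * p - u * (\<Sum>i<N. mconst (c i) * bs ! i) \<in> J" by (simp add: right_diff_distrib)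
    qed (use u p cl in \<open>auto intro: mpolys_mult\<close>)
    finally show ?thesis .
  qed
  note detA = presentation_det[OF A]
  have "lookup u 0 = 1"
  proof -
    define m where "m = u - mconst (lookup u 0)"
    have m: "m \<in> mpolys n" using u by (auto simp: m_def intro: mpolys_diff)
    have "m \<in> poly_ideal n n mvar"
      using m by (rule maximal_ideal_vars) (simp add: m_def lookup_minus)
    then obtain c where c: "\<forall>i<n. c i \<in> mpolys n" "m = (\<Sum>i<n. c i * mvar i)"
      by (auto simp: poly_ideal_def)
    have "m * det A = (\<Sum>i<n. c i * (mvar i * det A))"
      using c by (simp add: sum_distrib_right mult.assoc)
    also have "\<dots> \<in> J"
    proof (rule poly_ideal_sum)
      show "c i * (mvar i * det A) \<in> J" if "i \<in> {..<n}" for i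
        by (rule poly_ideal_mult) (use that c mult_det_presentation[OF A] in auto)
    qed
    finally have "L (u * det A) = L (mconst (lookup u 0) * det A)"
      using u detA by (intro L_cong mpolys_mult) (auto simp: m_def algebra_simps)
    also have "\<dots> = lookup u 0" using detA L_socle[OF A] by (simp add: L_smult)
    finally show ?thesis
      using psi_L[OF detA] phi1 by (simp add: \<psi>_def socle_element_coset)
  qed
  then obtain v where v: "v \<in> mpolys n" "v * v - u \<in> J"
    using sqrt_modulo[OF char_not_2 u(1)] by blast
  define c where "c i = (SOME c. v * q i - (\<Sum>k<N. mconst (c k) * bs ! k) \<in> J)" for i
  have c: "v * q i - (\<Sum>k<N. mconst (c i k) * bs ! k) \<in> J" if "i < N" for i
    unfolding c_def using bs_span[OF mpolys_mult[OF v(1) q(1)[OF that]]]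
    by (rule someI_ex[of "\<lambda>c. v * q i - (\<Sum>k<N. mconst (c k) * bs ! k) \<in> J"])
  define C where "C = mat N N (\<lambda>(k, i). c i k)"
  have C: "C \<in> carrier_mat N N" by (simp add: C_def)
  have G: "G \<in> carrier_mat N N" by simp
  have entry: "?G' $$ (i, j) = (\<Sum>k<N. \<Sum>l<N. c i k * (c j l * G $$ (k, l)))" if ij: "i < N" "j < N" for i j
  proof -
    have qq: "q i \<in> mpolys n" "q j \<in> mpolys n" using q ij by auto
    have "?G' $$ (i, j) = \<psi> (q i * q j)"
      using ij qq by (simp add: gram_matrix_index len q(2) coset_mult \<psi>_def)
    also have "\<dots> = L (u * (q i * q j))" using qq by (simp add: psi_L mpolys_mult)
    also have "\<dots> = L ((v * v) * (q i * q j))"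
      using u v qq by (intro L_cong[symmetric] mpolys_mult)
        (auto intro!: mult_add_sub mpolys_mult)
    also have "\<dots> = L ((v * q i) * (v * q j))" by (simp add: mult_ac)
    also have "\<dots> = L ((\<Sum>k<N. mconst (c i k) * bs ! k) * (\<Sum>l<N. mconst (c j l) * bs ! l))"
      using v qq c ij cl by (intro L_cong mult_add_sub mpolys_mult) auto
    also have "(\<Sum>k<N. mconst (c i k) * bs ! k) * (\<Sum>l<N. mconst (c j l) * bs ! l)
        = (\<Sum>k<N. mconst (c i k) * (\<Sum>l<N. mconst (c j l) * (bs ! k * bs ! l)))"
      unfolding sum_product by (rule sum.cong[OF refl]) (simp add: sum_distrib_left mult_ac)
    also have "L \<dots> = (\<Sum>k<N. c i k * (\<Sum>l<N. c j l * L (bs ! k * bs ! l)))"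
    proof (subst L_sum, goal_cases)
      case (1 k)
      thus ?case by (intro mpolys_sum mpolys_mult) auto
    next
      case 2
      have "L (\<Sum>l<N. mconst (c j l) * (bs ! k * bs ! l)) = (\<Sum>l<N. c j l * L (bs ! k * bs ! l))"
        if "k < N" for k using that by (intro L_sum mpolys_mult) auto
      thus ?case by simp
    qed
    also have "\<dots> = (\<Sum>k<N. \<Sum>l<N. c i k * (c j l * G $$ (k, l)))"
      by (simp add: sum_distrib_left gram_matrix_index)
    finally show ?thesis .
  qed
  have "?G' = transpose_mat C * G * C"
  proof (rule eq_matI)
    fix i j assume "i < dim_row (transpose_mat C * G * C)" "j < dim_col (transpose_mat C * G * C)"
    hence ij: "i < N" "j < N" using C by auto
    have GC: "(G * C) $$ (k, j) = (\<Sum>l<N. G $$ (k, l) * c j l)" if "k < N" for k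
      using that ij C by (auto simp: scalar_prod_def C_def atLeast0LessThan gram_matrix_def intro!: sum.cong)
    have Ct: "transpose_mat C \<in> carrier_mat N N" using C by simp
    have "(transpose_mat C * G * C) $$ (i, j) = (transpose_mat C * (G * C)) $$ (i, j)"
      using C G by (subst assoc_mult_mat[of _ N N _ N _ N]) auto
    also have "\<dots> = (\<Sum>k<N. c i k * (G * C) $$ (k, j))"
      unfolding mult_mat_index[OF Ct mult_carrier_mat[OF G C] ij]
      using ij by (intro sum.cong) (auto simp: C_def)
    also have "\<dots> = ?G' $$ (i, j)"
      unfolding entry[OF ij] by (intro sum.cong refl) (simp add: GC sum_distrib_left mult_ac)
    finally show "?G' $$ (i, j) = (transpose_mat C * G * C) $$ (i, j)" ..
  qed (use C in \<open>auto simp: gram_matrix_def len\<close>)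
  moreover from this have "det ?G' = det (transpose_mat C) * det G * det C"
    using det_mult[OF mult_carrier_mat[OF transpose_carrier_mat[THEN iffD2, OF C] G] C]
      det_mult[OF transpose_carrier_mat[THEN iffD2, OF C] G] by simp
  hence "det C \<noteq> 0" using vs(3) by (auto simp: nondeg_sym_mat_def)
  ultimately have "congruent_mat G ?G'"
    unfolding congruent_mat_def using C by (intro bexI[of _ C]) (auto simp: gram_matrix_def)
  thus ?thesis using gw_of_mat_congruent[OF gram_nondeg vs(3)] vs(4) by simp
qed

theorem local_degree_eq: "local_degree n f = N"
  using V_dim by (simp add: local_degree_def)

theorem EKL_degree_eq: "EKL_degree n f = gw_of_mat G"
  unfolding EKL_degree_def
proof (rule the_equality)
  obtain A where A: "linear_presentation n f A" using presentation_ex by blast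
  have "functional (socle_element n f A) = 1"
    using presentation_det[OF A] L_socle[OF A] by (simp add: socle_element_coset functional_coset)
  moreover have "gram_matrix (\<lambda>x y. functional (x \<otimes>\<^bsub>V\<^esub> y)) (map coset bs) = G"
    by (rule eq_matI) (auto simp: gram_matrix_def coset_mult functional_coset mpolys_mult)
  hence "has_gw_class V (\<lambda>x y. functional (x \<otimes>\<^bsub>V\<^esub> y)) (gw_of_mat G)"
    unfolding has_gw_class_def
    using coset_bs_distinct coset_bs_basis gram_nondeg by (intro exI[of _ "map coset bs"]) auto
  ultimately show "\<exists>A \<phi>. linear_presentation n f A \<and> linear_map class_ring V base_module \<phi> \<and>
      \<phi> (socle_element n f A) = 1 \<and> has_gw_class V (\<lambda>x y. \<phi> (x \<otimes>\<^bsub>V\<^esub> y)) (gw_of_mat G)"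
    using A functional_linear by blast
qed (use gw_class_unique in blast)

end

section \<open>Forms with an involution on the basis\<close>

lemma gw_of_mat_dsum:
  assumes "nondeg_sym_mat A" "nondeg_sym_mat B"
  shows "gw_of_mat (dsum_mat A B) = gw_of_mat A + gw_of_mat B"
proof -
  have "dsum_form (Form A) (Form B) = Form (dsum_mat A B)"
    using assms by (simp add: dsum_form.rep_eq Form_inverse nondeg_sym_dsum flip: gram_inject)
  thus ?thesis
    by (simp add: gw_of_mat_def gw_of_class_def plus_gw.abs_eq plus_form_class.abs_eq)
qed

lemma congruent_mat_nondeg:
  assumes "congruent_mat A B" "nondeg_sym_mat B" "A \<in> carrier_mat n n" "transpose_mat A = A"
  shows "nondeg_sym_mat A"
proof -
  obtain P where P: "P \<in> carrier_mat n n" "B = transpose_mat P * A * P"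
    using assms by (auto simp: congruent_mat_def)
  have Pt: "transpose_mat P \<in> carrier_mat n n" using P by simp
  have "det B = det (transpose_mat P) * det A * det P"
    using det_mult[OF mult_carrier_mat[OF Pt assms(3)] P(1)] det_mult[OF Pt assms(3)] P(2) by simp
  thus ?thesis using assms by (auto simp: nondeg_sym_mat_def)
qed

lemma unit_form_nondeg: "u \<noteq> 0 \<Longrightarrow> nondeg_sym_mat (mat 1 1 (\<lambda>_. u))"
  by (auto simp: nondeg_sym_mat_def det_single intro!: eq_matI)

lemma gw_unit_1: "gw_unit 1 = 1"
proof -
  have "mat 1 1 (\<lambda>_. 1) = (1\<^sub>m 1 :: 'a::field mat)" by (rule eq_matI) auto
  moreover have "one_form = Form (1\<^sub>m 1 :: 'a mat)"
    by (simp add: one_form_def)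
  ultimately show ?thesis
    by (simp add: gw_unit_def gw_of_mat_def gw_of_class_def one_gw_def one_form_class_def)
qed

lemma nondeg_sym_one: "nondeg_sym_mat (1\<^sub>m n)"
  by (simp add: nondeg_sym_mat_def)

lemma gw_of_mat_one: "gw_of_mat (1\<^sub>m n :: 'a::field mat) = of_nat n"
proof (induction n)
  case 0
  have "zero_form = Form (1\<^sub>m 0 :: 'a mat)" by (simp add: zero_form_def)
  thus ?case by (simp add: gw_of_mat_def gw_of_class_def zero_gw_def zero_form_class_def)
next
  case (Suc n)
  have "(1\<^sub>m (Suc n) :: 'a mat) = dsum_mat (1\<^sub>m 1) (1\<^sub>m n)"
    by (rule eq_matI) (auto simp: dsum_mat_def)
  hence "gw_of_mat (1\<^sub>m (Suc n) :: 'a mat) = gw_of_mat (1\<^sub>m 1) + of_nat n"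
    using gw_of_mat_dsum[OF nondeg_sym_one nondeg_sym_one] Suc by metis
  moreover have "gw_of_mat (1\<^sub>m 1 :: 'a mat) = 1"
  proof -
    have "mat 1 1 (\<lambda>_. 1) = (1\<^sub>m 1 :: 'a mat)" by (rule eq_matI) auto
    thus ?thesis using gw_unit_1[where 'a='a] by (simp add: gw_unit_def)
  qed
  ultimately show ?case by simp
qed

definition hyperbolic_mat :: "'a::field mat" where
  "hyperbolic_mat = mat 2 2 (\<lambda>(i, j). if i = j then 0 else 1)"

text \<open>
  For the standard basis \<open>e\<^sub>0, e\<^sub>1\<close> of a hyperbolic plane, \<open>e\<^sub>0 + e\<^sub>1/2\<close> and \<open>e\<^sub>0 - e\<^sub>1/2\<close> are orthogonal
  with values \<open>1\<close> and \<open>-1\<close>.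
\<close>

lemma hyperbolic_mat_class:
  assumes "(2::'a::field) \<noteq> 0"
  shows "nondeg_sym_mat (hyperbolic_mat :: 'a mat)"
    and "gw_of_mat (hyperbolic_mat :: 'a mat) = gw_unit 1 + gw_unit (-1)"
proof -
  let ?D = "dsum_mat (mat 1 1 (\<lambda>_. 1)) (mat 1 1 (\<lambda>_. - 1)) :: 'a mat"
  let ?H = "hyperbolic_mat :: 'a mat"
  define P :: "'a mat" where "P = mat 2 2 (\<lambda>(i, j). if i = 0 then 1 else if j = 0 then inverse 2 else - inverse 2)"
  have c: "P \<in> carrier_mat 2 2" "?H \<in> carrier_mat 2 2" "transpose_mat P \<in> carrier_mat 2 2"
    by (simp_all add: P_def hyperbolic_mat_def)
  have D: "nondeg_sym_mat ?D" by (intro nondeg_sym_dsum unit_form_nondeg) auto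
  have half: "inverse 2 + inverse 2 = (1::'a)" using assms by (simp add: field_simps)
  have eq: "?D = transpose_mat P * ?H * P"
  proof (rule eq_matI)
    fix i j assume "i < dim_row (transpose_mat P * ?H * P)" "j < dim_col (transpose_mat P * ?H * P)"
    hence ij: "i < 2" "j < 2" using c by auto
    have "(transpose_mat P * ?H * P) $$ (i, j) = P $$ (1, i) * P $$ (0, j) + P $$ (0, i) * P $$ (1, j)"
      using ij c unfolding mult_mat_index[OF mult_carrier_mat[OF c(3) c(2)] c(1) ij]
      by (simp add: numeral_2_eq_2 hyperbolic_mat_def scalar_prod_def)
    thus "?D $$ (i, j) = (transpose_mat P * ?H * P) $$ (i, j)"
      using ij half by (auto simp: P_def dsum_mat_def less_2_cases_iff)
  qed (use c in \<open>auto simp: dsum_mat_def\<close>)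
  have "det ?D = det (transpose_mat P) * det ?H * det P"
    unfolding eq using det_mult[OF mult_carrier_mat[OF c(3,2)] c(1)] det_mult[OF c(3,2)] by simp
  hence "det P \<noteq> 0" using D by (auto simp: nondeg_sym_mat_def)
  hence cong: "congruent_mat ?H ?D" unfolding congruent_mat_def using eq c
    by (intro bexI[of _ P]) auto
  have "transpose_mat ?H = ?H" by (rule eq_matI) (auto simp: hyperbolic_mat_def)
  thus nd: "nondeg_sym_mat ?H" using congruent_mat_nondeg[OF cong D c(2)] by blast
  have "gw_of_mat ?H = gw_of_mat ?D" by (rule gw_of_mat_congruent[OF nd D cong])
  also have "\<dots> = gw_unit 1 + gw_unit (-1)"
    unfolding gw_unit_def by (intro gw_of_mat_dsum unit_form_nondeg) auto
  finally show "gw_of_mat ?H = gw_unit 1 + gw_unit (-1)" .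
qed

lemma gram_matrix_permute:
  assumes "distinct xs" "distinct ys" "set xs = set ys"
  shows "congruent_mat (gram_matrix g xs) (gram_matrix g ys)"
proof -
  have len: "length xs = length ys" using assms distinct_card by metis
  have "\<forall>i<length xs. \<exists>k<length xs. xs ! k = ys ! i"
    using assms len by (metis in_set_conv_nth)
  then obtain \<sigma> where s: "\<And>i. i < length xs \<Longrightarrow> \<sigma> i < length xs" "\<And>i. i < length xs \<Longrightarrow> xs ! \<sigma> i = ys ! i"
    by metis
  show ?thesis
  proof (rule congruent_reindex[of _ "length xs" \<sigma>])
    show "inj_on \<sigma> {0..<length xs}"
    proof (rule inj_onI)
      fix i j assume ij: "i \<in> {0..<length xs}" "j \<in> {0..<length xs}" "\<sigma> i = \<sigma> j"
      hence "ys ! i = ys ! j" using s(2)[of i] s(2)[of j] by simp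
      thus "i = j" using ij len assms(2) by (simp add: nth_eq_iff_index_eq)
    qed
  qed (use s len in \<open>auto simp: gram_matrix_def\<close>)
qed

text \<open>
  A vector pairing to \<open>1\<close> with \<open>w'\<close> and to \<open>0\<close> with itself and all others splits off a hyperbolic
  plane: subtracting multiples of it makes all other vectors orthogonal to \<open>w'\<close> without changing
  the products among them.
\<close>

lemma gram_split_hyperbolic:
  fixes g :: "'w \<Rightarrow> 'w \<Rightarrow> 'a::field"
  assumes two: "(2::'a) \<noteq> 0"
    and sym: "\<And>x y. x \<in> set (w # w' # vs) \<Longrightarrow> y \<in> set (w # w' # vs) \<Longrightarrow> g x y = g y x"
    and ww': "g w w' = 1" and ww: "g w w = 0" and wv: "\<And>v. v \<in> set vs \<Longrightarrow> g w v = 0"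
  shows "congruent_mat (gram_matrix g (w # w' # vs)) (dsum_mat hyperbolic_mat (gram_matrix g vs))"
proof -
  let ?xs = "w # w' # vs"
  define n where "n = length ?xs"
  define A where "A = gram_matrix g ?xs"
  \<comment> \<open>The multiples of the first vector to be added; minus half the square of the second vector makes it isotropic.\<close>
  define p where "p j = (if j = 0 then 1 else if j = 1 then - g w' w' / 2 else - g w' (?xs ! j))" for j :: nat
  define P where "P = mat n n (\<lambda>(i, j). if i = 0 then p j else if i = j then 1 else 0)"
  have A: "A \<in> carrier_mat n n" by (simp add: A_def n_def gram_matrix_def)
  have P: "P \<in> carrier_mat n n" "transpose_mat P \<in> carrier_mat n n" by (simp_all add: P_def)
  have n: "0 < n" "1 < n" by (simp_all add: n_def)
  have mem: "?xs ! i \<in> set ?xs" if "i < n" for i using that nth_mem unfolding n_def by blast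
  have Aij: "A $$ (i, j) = g (?xs ! i) (?xs ! j)" if "i < n" "j < n" for i j
    using that by (simp add: A_def gram_matrix_def n_def)
  have A_sym: "A $$ (i, j) = A $$ (j, i)" if "i < n" "j < n" for i j
    using that sym[OF mem mem] by (simp add: Aij)
  have A0: "A $$ (0, j) = (if j = 1 then 1 else 0)" if "j < n" for j
  proof (cases j)
    case (Suc k)
    thus ?thesis using that ww' wv by (cases k) (auto simp: Aij n_def)
  qed (use n ww in \<open>simp add: Aij\<close>)
  have AP: "(A * P) $$ (i, j) = (if j = 0 then 0 else A $$ (i, j)) + (if i = 1 then p j else 0)"
    if ij: "i < n" "j < n" for i j
  proof -
    have "(A * P) $$ (i, j) = (\<Sum>k<n. A $$ (i, k) * (if k = 0 then p j else if k = j then 1 else 0))"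
      unfolding mult_mat_index[OF A P(1) ij] using ij by (intro sum.cong) (auto simp: P_def)
    also have "\<dots> = (\<Sum>k<n. (if k = 0 then A $$ (i, 0) * p j else 0)
        + (if k = j then if j = 0 then 0 else A $$ (i, j) else 0))"
      by (intro sum.cong) auto
    also have "\<dots> = A $$ (i, 0) * p j + (if j = 0 then 0 else A $$ (i, j))"
      using ij n by (simp add: sum.distrib)
    finally show ?thesis using ij n A0[of i] A_sym[of i 0] by simp
  qed
  have PAP: "(transpose_mat P * (A * P)) $$ (i, j) =
      p i * (A * P) $$ (0, j) + (if i = 0 then 0 else (A * P) $$ (i, j))" if ij: "i < n" "j < n" for i j
  proof -
    have "(transpose_mat P * (A * P)) $$ (i, j)
        = (\<Sum>k<n. (if k = 0 then p i else if k = i then 1 else 0) * (A * P) $$ (k, j))"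
      unfolding mult_mat_index[OF P(2) mult_carrier_mat[OF A P(1)] ij]
      using ij by (intro sum.cong) (auto simp: P_def)
    also have "\<dots> = (\<Sum>k<n. (if k = 0 then p i * (A * P) $$ (0, j) else 0)
        + (if k = i then if i = 0 then 0 else (A * P) $$ (i, j) else 0))"
      by (intro sum.cong) auto
    finally show ?thesis using ij n by (simp add: sum.distrib)
  qed
  have hg: "(hyperbolic_mat :: 'a mat) \<in> carrier_mat 2 2" by (simp add: hyperbolic_mat_def)
  have n2: "n = 2 + length vs" by (simp add: n_def)
  have "dsum_mat hyperbolic_mat (gram_matrix g vs) = transpose_mat P * (A * P)"
  proof (rule eq_matI)
    fix i j assume "i < dim_row (transpose_mat P * (A * P))" "j < dim_col (transpose_mat P * (A * P))"
    hence ij: "i < n" "j < n" using P by auto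
    have L: "dsum_mat hyperbolic_mat (gram_matrix g vs) $$ (i, j) =
        (if i < 2 then if j < 2 then if i = j then 0 else 1 else 0
         else if j < 2 then 0 else A $$ (i, j))"
    proof -
      have "gram_matrix g vs $$ (i - 2, j - 2) = A $$ (i, j)" if "\<not> i < 2" "\<not> j < 2"
        using that ij by (auto simp: Aij gram_matrix_def n2 numeral_2_eq_2 nth_Cons split: nat.splits)
      thus ?thesis
        using dsum_mat_index[OF hg gram_matrix_carrier[of g vs], of i j] ij n2
        by (auto simp: hyperbolic_mat_def)
    qed
    have p1: "2 * p 1 + g w' w' = 0" using two by (simp add: p_def)
    have pj: "A $$ (1, j) = - p j" if "j < n" "j \<ge> 2" for j using that n by (simp add: Aij p_def)
    have A11: "A $$ (1, 1) = g w' w'" using n by (simp add: Aij)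
    have p0: "p 0 = 1" by (simp add: p_def)
    have R: "(transpose_mat P * (A * P)) $$ (i, j) =
        (if i = 0 then if j = 1 then 1 else 0
         else if j = 0 then if i = 1 then 1 else 0
         else A $$ (i, j) + (if i = 1 then p j else 0) + (if j = 1 then p i else 0))"
      using PAP[OF ij] AP[OF ij] AP[OF n(1) ij(2)] A0[OF ij(2)] p0 by auto
    show "dsum_mat hyperbolic_mat (gram_matrix g vs) $$ (i, j) = (transpose_mat P * (A * P)) $$ (i, j)"
      unfolding L R using A11 p1 pj[of i] pj[of j] ij A_sym[of i 1] n
      by (auto simp: less_2_cases_iff not_less)
  qed (use P hg in \<open>auto simp: dsum_mat_def n2 gram_matrix_def\<close>)
  hence eq: "dsum_mat hyperbolic_mat (gram_matrix g vs) = transpose_mat P * A * P"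
    using assoc_mult_mat[OF P(2) A P(1)] by simp
  have "upper_triangular P" by (auto simp: P_def)
  hence "det P = prod_list (diag_mat P)" using det_upper_triangular P(1) by blast
  also have "diag_mat P = replicate n 1"
    by (rule nth_equalityI) (auto simp: diag_mat_def P_def p_def)
  finally have "det P \<noteq> 0" by simp
  thus ?thesis unfolding congruent_mat_def A_def[symmetric] using eq P A
    by (intro bexI[of _ P]) auto
qed

text \<open>
  If the basis carries an involution \<open>\<iota>\<close> and a score that \<open>\<iota>\<close> negates, such that two vectors pair to zero
  unless \<open>\<iota>\<close> swaps them or their scores have a positive sum, then a non-fixed basis vector of minimal
  score pairs with its partner only and splits off a hyperbolic plane.  At the end only fixed points
  remain, which have score \<open>0\<close> and are orthonormal.
\<close>

theorem gram_involution_class: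
  fixes g :: "'w \<Rightarrow> 'w \<Rightarrow> 'a::field" and score :: "'w \<Rightarrow> int"
  assumes "(2::'a) \<noteq> 0" and "distinct ws"
    and "\<And>x y. x \<in> set ws \<Longrightarrow> y \<in> set ws \<Longrightarrow> g x y = g y x"
    and "\<And>x. x \<in> set ws \<Longrightarrow> \<iota> x \<in> set ws" and "\<And>x. x \<in> set ws \<Longrightarrow> \<iota> (\<iota> x) = x"
    and "\<And>x. x \<in> set ws \<Longrightarrow> score (\<iota> x) = - score x"
    and "\<And>x. x \<in> set ws \<Longrightarrow> g x (\<iota> x) = 1"
    and "\<And>x y. x \<in> set ws \<Longrightarrow> y \<in> set ws \<Longrightarrow> g x y \<noteq> 0 \<Longrightarrow> y = \<iota> x \<or> score x + score y > 0"
  shows "nondeg_sym_mat (gram_matrix g ws) \<and>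
    (\<exists>h. length ws = card {x \<in> set ws. \<iota> x = x} + 2 * h \<and>
      gw_of_mat (gram_matrix g ws) =
        of_nat h * (gw_unit 1 + gw_unit (-1)) + of_nat (card {x \<in> set ws. \<iota> x = x}) * gw_unit 1)"
  using assms(2-)
proof (induction "length ws" arbitrary: ws rule: less_induct)
  case less
  note two = assms(1)
  note dist = less.prems(1) and sym = less.prems(2) and inv = less.prems(3,4) and sc = less.prems(5)
    and unit = less.prems(6) and tri = less.prems(7)
  let ?A = "gram_matrix g ws"
  have tA: "transpose_mat ?A = ?A"
    by (rule eq_matI) (auto simp: gram_matrix_def intro!: sym)
  show ?case
  proof (cases "\<forall>x\<in>set ws. \<iota> x = x")
    case True
    have s0: "score x = 0" if "x \<in> set ws" for x using True sc[OF that] that by auto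
    have "?A = 1\<^sub>m (length ws)"
    proof (rule eq_matI)
      fix i j assume "i < dim_row (1\<^sub>m (length ws) :: 'a mat)" "j < dim_col (1\<^sub>m (length ws) :: 'a mat)"
      hence ij: "i < length ws" "j < length ws" by auto
      hence mem: "ws ! i \<in> set ws" "ws ! j \<in> set ws" by auto
      have "g (ws ! i) (ws ! j) = (if i = j then 1 else 0)"
        using unit[OF mem(1)] tri[OF mem] s0[OF mem(1)] s0[OF mem(2)] True mem ij dist
        by (auto simp: nth_eq_iff_index_eq)
      thus "?A $$ (i, j) = 1\<^sub>m (length ws) $$ (i, j)" using ij by (simp add: gram_matrix_def)
    qed (auto simp: gram_matrix_def)
    moreover have "{x \<in> set ws. \<iota> x = x} = set ws" using True by blast
    ultimately show ?thesis using dist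
      by (auto simp: nondeg_sym_one gw_of_mat_one gw_unit_1 distinct_card intro!: exI[of _ 0])
  next
    case False
    define M where "M = {x \<in> set ws. \<iota> x \<noteq> x}"
    have "finite M" "M \<noteq> {}" using False by (auto simp: M_def)
    then obtain w where w: "w \<in> M" "\<And>x. x \<in> M \<Longrightarrow> score w \<le> score x"
      using arg_min_if_finite[of M score] by (metis arg_min_least)
    have w_ws: "w \<in> set ws" and w_ne: "\<iota> w \<noteq> w" using w(1) by (auto simp: M_def)
    have M_inv: "\<iota> x \<in> M" if "x \<in> M" for x using that inv by (auto simp: M_def)
    have sw: "score w \<le> 0" using w(2)[OF M_inv[OF w(1)]] sc[OF w_ws] by simp
    have ortho: "g w y = 0" if y: "y \<in> set ws" "y \<noteq> \<iota> w" for y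
    proof (rule ccontr)
      assume "g w y \<noteq> 0"
      hence pos: "score w + score y > 0" using tri[OF w_ws y(1)] y(2) by blast
      hence "\<iota> y \<noteq> y" using sc[OF y(1)] sw by auto
      hence "score w \<le> score (\<iota> y)" using y M_inv by (intro w(2)) (auto simp: M_def)
      thus False using pos sc[OF y(1)] by simp
    qed
    define vs where "vs = filter (\<lambda>x. x \<noteq> w \<and> x \<noteq> \<iota> w) ws"
    have set_vs: "set vs = set ws - {w, \<iota> w}" by (auto simp: vs_def)
    have set_ws: "set ws = set (w # \<iota> w # vs)" using w_ws inv(1) by (auto simp: set_vs)
    have dvs: "distinct (w # \<iota> w # vs)" "distinct vs" using dist w_ne by (auto simp: vs_def)
    have len: "length ws = 2 + length vs"
      using distinct_card[OF dist] distinct_card[OF dvs(1)] set_ws by simp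
    have iw: "g w (\<iota> w) = 1" by (rule unit[OF w_ws])
    let ?B = "gram_matrix g vs"
    have fix_eq: "{x \<in> set ws. \<iota> x = x} = {x \<in> set vs. \<iota> x = x}"
      using w_ne inv(2)[OF w_ws] by (auto simp: set_vs)
    have IH: "nondeg_sym_mat ?B \<and> (\<exists>h. length vs = card {x \<in> set vs. \<iota> x = x} + 2 * h \<and>
      gw_of_mat ?B = of_nat h * (gw_unit 1 + gw_unit (-1)) + of_nat (card {x \<in> set vs. \<iota> x = x}) * gw_unit 1)"
    proof (rule less.hyps)
      show "\<iota> x \<in> set vs" if "x \<in> set vs" for x
        using that inv(1)[of x] inv(2)[of x] inv(2)[OF w_ws] by (auto simp: set_vs)
    qed (use len dvs sym inv sc unit tri in \<open>auto simp: set_vs\<close>)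
    have split: "congruent_mat (gram_matrix g (w # \<iota> w # vs)) (dsum_mat hyperbolic_mat ?B)"
    proof (rule gram_split_hyperbolic[OF two])
      show "g w w = 0" using ortho[OF w_ws] w_ne by auto
      show "g w v = 0" if "v \<in> set vs" for v using that ortho by (auto simp: set_vs)
    qed (use sym iw set_ws in auto)
    have cong: "congruent_mat ?A (dsum_mat hyperbolic_mat ?B)"
      by (rule congruent_mat_trans[OF gram_matrix_permute split gram_matrix_carrier])
        (use dist dvs set_ws in auto)
    have ndD: "nondeg_sym_mat (dsum_mat hyperbolic_mat ?B)"
      using IH hyperbolic_mat_class(1)[OF two] by (intro nondeg_sym_dsum) auto
    have ndA: "nondeg_sym_mat ?A" by (rule congruent_mat_nondeg[OF cong ndD gram_matrix_carrier tA])
    have "gw_of_mat ?A = gw_unit 1 + gw_unit (-1) + gw_of_mat ?B"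
      using gw_of_mat_congruent[OF ndA ndD cong] gw_of_mat_dsum[OF hyperbolic_mat_class(1)[OF two]] IH
        hyperbolic_mat_class(2)[OF two] by metis
    moreover obtain h where "length vs = card {x \<in> set vs. \<iota> x = x} + 2 * h"
      "gw_of_mat ?B = of_nat h * (gw_unit 1 + gw_unit (-1)) + of_nat (card {x \<in> set vs. \<iota> x = x}) * gw_unit 1"
      using IH by blast
    ultimately show ?thesis using ndA len unfolding fix_eq
      by (intro conjI exI[of _ "Suc h"]) (simp_all add: algebra_simps)
  qed
qed

section \<open>Monomials and the action of permutations\<close>

definition expo :: "nat \<Rightarrow> (nat \<Rightarrow> nat) \<Rightarrow> nat \<Rightarrow>\<^sub>0 nat" where
  "expo n a = (\<Sum>i<n. Poly_Mapping.single i (a i))"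

lemma lookup_expo [simp]: "lookup (expo n a) i = (if i < n then a i else 0)"
  by (simp add: expo_def lookup_sum lookup_single when_def)

lemma keys_expo: "keys (expo n a) \<subseteq> {..<n}"
  by (auto simp: in_keys_iff split: if_splits)

lemma expo_lookup: "keys m \<subseteq> {..<n} \<Longrightarrow> expo n (lookup m) = m"
  by (rule poly_mapping_eqI) (auto simp: in_keys_iff)

definition xmon :: "(nat \<Rightarrow>\<^sub>0 nat) \<Rightarrow> 'a::field mpoly" where
  "xmon a = Poly_Mapping.single a 1"

lemma xmon_add: "xmon (a + b) = xmon a * xmon b"
  by (simp add: xmon_def mult_single)

lemma xmon_0 [simp]: "xmon 0 = 1"
  by (simp add: xmon_def)

lemma lookup_xmon: "lookup (xmon a) m = (if m = a then 1 else 0)"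
  by (simp add: xmon_def lookup_single when_def)

lemma mconst_xmon: "mconst c * xmon a = Poly_Mapping.single a c"
  by (simp add: xmon_def mconst_def mult_single)

lemma xmon_mpolys: "keys a \<subseteq> {..<n} \<Longrightarrow> xmon a \<in> mpolys n"
  by (simp add: xmon_def mpolys_single)

lemma xmon_sum: "xmon (\<Sum>i\<in>I. a i) = (\<Prod>i\<in>I. xmon (a i))"
  by (induction I rule: infinite_finite_induct) (simp_all add: xmon_add)

lemma mvar_power: "mvar i ^ k = xmon (Poly_Mapping.single i k)"
  by (induction k) (auto simp: mvar_def xmon_def mult_single single_add[symmetric])

lemma xmon_expo: "xmon (expo n a) = (\<Prod>i<n. mvar i ^ a i)"
  by (simp add: expo_def xmon_sum mvar_power)

lemma mpoly_expand: "p = (\<Sum>m\<in>keys p. mconst (lookup p m) * xmon m)"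
  by (simp add: mconst_xmon mpoly_sum_monomials)

lemma lookup_mconst_mult [simp]: "lookup (mconst c * p) m = c * lookup p m"
proof -
  have "mconst c * p = (\<Sum>k\<in>keys p. Poly_Mapping.single k (c * lookup p k))"
    by (subst (1) mpoly_sum_monomials[of p, symmetric])
       (simp add: sum_distrib_left mconst_def mult_single)
  thus ?thesis by (auto simp: lookup_sum lookup_single when_def in_keys_iff)
qed

lemma mconst_of_int: "of_int k = (mconst (of_int k) :: 'a::field mpoly)"
proof -
  have "(\<Sum>i<k. 1) = (of_nat k :: 'a mpoly)" for k :: nat by simp
  have n: "of_nat k = (mconst (of_nat k) :: 'a mpoly)" for k by (induction k) simp_all
  have m: "mconst (- c) = - (mconst c :: 'a mpoly)" for c by (simp add: mconst_def single_uminus)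
  show ?thesis by (cases k rule: int_cases2) (simp_all add: n m)
qed

lemma lookup_xmon_mult:
  fixes p :: "'a::field mpoly"
  shows "lookup (p * xmon a) m = (if \<exists>k. m = k + a then lookup p (m - a) else 0)"
proof -
  have "p * xmon a = (\<Sum>k\<in>keys p. Poly_Mapping.single (k + a) (lookup p k))"
    by (subst (1) mpoly_sum_monomials[of p, symmetric])
       (simp add: sum_distrib_right xmon_def mult_single)
  hence "lookup (p * xmon a) m = (\<Sum>k\<in>keys p. if k + a = m then lookup p k else 0)"
    by (simp add: lookup_sum lookup_single when_def)
  also have "\<dots> = (\<Sum>k\<in>keys p. if k = m - a then if \<exists>k. m = k + a then lookup p k else 0 else 0)"
    by (intro sum.cong refl) auto
  finally show ?thesis by (simp add: in_keys_iff)
qed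

definition act :: "(nat \<Rightarrow> nat) \<Rightarrow> 'a::field mpoly \<Rightarrow> 'a mpoly" where
  "act \<sigma> p = mpoly_subst (\<lambda>i. mvar (\<sigma> i)) p"

lemma act_simps:
  "act \<sigma> (p + q) = act \<sigma> p + act \<sigma> q" "act \<sigma> (p * q) = act \<sigma> p * act \<sigma> q"
  "act \<sigma> (mconst c) = mconst c" "act \<sigma> (sum h X) = (\<Sum>x\<in>X. act \<sigma> (h x))"
  "act \<sigma> (of_int k) = of_int k"
  by (simp_all add: act_def mpoly_subst_add mpoly_subst_mult mpoly_subst_sum mconst_of_int)

lemma act_act: "act \<sigma> (act \<tau> p) = act (\<sigma> \<circ> \<tau>) p"
  by (simp add: act_def mpoly_subst_subst comp_def)

lemma act_xmon:
  assumes "bij \<sigma>" shows "act \<sigma> (xmon (Poly_Mapping.map_key \<sigma> a)) = xmon a"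
proof -
  have inj: "inj \<sigma>" using assms by (rule bij_is_inj)
  let ?k = "Poly_Mapping.map_key \<sigma> a"
  have l: "lookup ?k i = lookup a (\<sigma> i)" for i using inj by (simp add: map_key.rep_eq)
  have "act \<sigma> (xmon ?k) = (\<Prod>i\<in>keys ?k. mvar (\<sigma> i) ^ lookup a (\<sigma> i))"
    by (simp add: act_def xmon_def mpoly_subst_single l)
  also have "\<dots> = xmon (\<Sum>i\<in>keys ?k. Poly_Mapping.single (\<sigma> i) (lookup a (\<sigma> i)))"
    by (simp add: mvar_power xmon_sum)
  also have "(\<Sum>i\<in>keys ?k. Poly_Mapping.single (\<sigma> i) (lookup a (\<sigma> i))) = a"
  proof (rule poly_mapping_eqI)
    fix j
    obtain i where i: "j = \<sigma> i" using assms by (metis bij_pointE)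
    have "lookup (\<Sum>i\<in>keys ?k. Poly_Mapping.single (\<sigma> i) (lookup a (\<sigma> i))) j
       = (\<Sum>i'\<in>keys ?k. if i' = i then lookup a (\<sigma> i) else 0)"
      unfolding lookup_sum lookup_single when_def i
      by (intro sum.cong) (use inj in \<open>auto dest: injD\<close>)
    thus "lookup (\<Sum>i\<in>keys ?k. Poly_Mapping.single (\<sigma> i) (lookup a (\<sigma> i))) j = lookup a j"
      by (auto simp: i in_keys_iff l)
  qed
  finally show ?thesis .
qed

lemma map_key_inv:
  assumes "bij \<sigma>"
  shows "Poly_Mapping.map_key \<sigma> (Poly_Mapping.map_key (Hilbert_Choice.inv \<sigma>) a) = a"
    "Poly_Mapping.map_key (Hilbert_Choice.inv \<sigma>) (Poly_Mapping.map_key \<sigma> a) = a"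
  using assms bij_imp_bij_inv[OF assms]
  by (auto intro!: poly_mapping_eqI simp: map_key.rep_eq bij_is_inj inv_f_f surj_f_inv_f bij_is_surj)

lemma lookup_act:
  fixes p :: "'a::field mpoly"
  assumes "bij \<sigma>" shows "lookup (act \<sigma> p) m = lookup p (Poly_Mapping.map_key \<sigma> m)"
proof -
  have "act \<sigma> p = (\<Sum>k\<in>keys p. mconst (lookup p k) * act \<sigma> (xmon k))"
    by (subst mpoly_expand[of p]) (simp add: act_simps)
  also have "\<dots> = (\<Sum>k\<in>keys p. mconst (lookup p k) * xmon (Poly_Mapping.map_key (Hilbert_Choice.inv \<sigma>) k))"
    using act_xmon[OF assms] map_key_inv[OF assms] by metis
  finally have "lookup (act \<sigma> p) m
      = (\<Sum>k\<in>keys p. if m = Poly_Mapping.map_key (Hilbert_Choice.inv \<sigma>) k then lookup p k else 0)"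
    by (simp add: lookup_sum lookup_xmon if_distrib[of "\<lambda>x. _ * x"] cong: if_cong)
  also have "\<dots> = (\<Sum>k\<in>keys p. if k = Poly_Mapping.map_key \<sigma> m then lookup p k else 0)"
    by (intro sum.cong if_cong refl) (metis map_key_inv[OF assms])
  finally show ?thesis by (simp add: in_keys_iff)
qed

section \<open>Antisymmetrization\<close>

definition Alt :: "(nat \<Rightarrow> nat) set \<Rightarrow> 'a::field mpoly \<Rightarrow> 'a mpoly" where
  "Alt S q = (\<Sum>\<sigma>\<in>S. of_int (sign \<sigma>) * act \<sigma> q)"

lemma Alt_add: "Alt S (p + q) = Alt S p + Alt S q"
  by (simp add: Alt_def act_simps distrib_left sum.distrib)

lemma Alt_sum: "Alt S (sum h X) = (\<Sum>x\<in>X. Alt S (h x))"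
  by (induction X rule: infinite_finite_induct) (simp_all add: Alt_add, simp_all add: Alt_def act_def)

lemma Alt_invariant_mult:
  "(\<And>\<sigma>. \<sigma> \<in> S \<Longrightarrow> act \<sigma> e = e) \<Longrightarrow> Alt S (e * q) = e * Alt S q"
  by (simp add: Alt_def act_simps sum_distrib_left mult_ac)

lemma lookup_Alt:
  assumes "\<And>\<sigma>. \<sigma> \<in> S \<Longrightarrow> bij \<sigma>"
  shows "lookup (Alt S q) m = (\<Sum>\<sigma>\<in>S. of_int (sign \<sigma>) * lookup q (Poly_Mapping.map_key \<sigma> m))"
  unfolding Alt_def lookup_sum mconst_of_int lookup_mconst_mult
  by (intro sum.cong refl) (simp add: lookup_act assms)

lemma Alt_act:
  assumes S: "S \<subseteq> {\<sigma>. \<sigma> permutes {..<n}}" and \<tau>: "\<tau> \<in> S"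
    and mult: "\<And>\<sigma>. \<sigma> \<in> S \<Longrightarrow> \<sigma> \<circ> \<tau> \<in> S" "\<And>\<sigma>. \<sigma> \<in> S \<Longrightarrow> \<sigma> \<circ> Hilbert_Choice.inv \<tau> \<in> S"
  shows "Alt S (act \<tau> q) = of_int (sign \<tau>) * Alt S q"
proof -
  have perm: "permutation \<sigma>" if "\<sigma> \<in> S" for \<sigma>
    using S that by (auto intro: permutes_imp_permutation)
  have "\<tau> permutes {..<n}" using S \<tau> by blast
  note io = permutes_inv_o[OF this]
  have b: "bij_betw (\<lambda>\<sigma>. \<sigma> \<circ> \<tau>) S S"
    by (rule bij_betw_byWitness[where f' = "\<lambda>\<sigma>. \<sigma> \<circ> Hilbert_Choice.inv \<tau>"])
       (use mult io in \<open>auto simp: comp_assoc\<close>)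
  have "of_int (sign \<tau>) * Alt S q = (\<Sum>\<sigma>\<in>S. of_int (sign \<tau>) * (of_int (sign (\<sigma> \<circ> \<tau>)) * act (\<sigma> \<circ> \<tau>) q))"
    unfolding Alt_def sum_distrib_left by (rule sum.reindex_bij_betw[OF b, symmetric])
  also have "\<dots> = (\<Sum>\<sigma>\<in>S. of_int (sign \<sigma>) * act \<sigma> (act \<tau> q))"
  proof (intro sum.cong refl)
    fix \<sigma> assume "\<sigma> \<in> S"
    have "of_int (sign \<tau>) * of_int (sign (\<sigma> \<circ> \<tau>)) = (of_int (sign \<tau> * sign \<tau> * sign \<sigma>) :: 'a mpoly)"
      using sign_compose[OF perm[OF \<open>\<sigma> \<in> S\<close>] perm[OF \<tau>]]
      by (simp only: of_int_mult mult_ac)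
    also have "\<dots> = of_int (sign \<sigma>)" by (simp only: sign_idempotent mult_1_left)
    finally show "of_int (sign \<tau>) * (of_int (sign (\<sigma> \<circ> \<tau>)) * act (\<sigma> \<circ> \<tau>) q) = of_int (sign \<sigma>) * act \<sigma> (act \<tau> q)"
      by (simp add: act_act mult.assoc[symmetric])
  qed
  finally show ?thesis by (simp add: Alt_def)
qed

lemma two_mpoly_cancel:
  assumes "(2::'a::field) \<noteq> 0" "p = - (p :: 'a mpoly)" shows "p = 0"
proof (rule poly_mapping_eqI)
  fix m
  have "lookup p m = - lookup p m" using assms(2) by (metis lookup_uminus)
  hence "2 * lookup p m = 0" by (metis add.right_inverse mult_2)
  thus "lookup p m = lookup 0 m" using assms(1) by simp
qed

section \<open>Elementary symmetric polynomials\<close>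

lemma esym_0: "finite X \<Longrightarrow> esym X 0 = 1"
proof -
  assume "finite X"
  hence "{S. S \<subseteq> X \<and> card S = 0} = {{}}" by (auto dest: finite_subset)
  thus ?thesis by (simp add: esym_def)
qed

lemma esym_gt: "finite X \<Longrightarrow> card X < k \<Longrightarrow> esym X k = 0"
proof -
  assume "finite X" "card X < k"
  hence "{S. S \<subseteq> X \<and> card S = k} = {}" by (auto dest: card_mono)
  thus ?thesis unfolding esym_def by (simp only: sum.empty)
qed

lemma esym_card: "finite X \<Longrightarrow> esym X (card X) = (\<Prod>i\<in>X. mvar i)"
proof -
  assume "finite X"
  hence "{S. S \<subseteq> X \<and> card S = card X} = {X}" by (auto dest: card_subset_eq)
  thus ?thesis by (simp add: esym_def)
qed

lemma esym_insert:
  assumes "finite X" "x \<notin> X"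
  shows "esym (insert x X) (Suc k) = esym X (Suc k) + (mvar x * esym X k :: 'a::field mpoly)"
proof -
  have split: "{S. S \<subseteq> insert x X \<and> card S = Suc k}
      = {S. S \<subseteq> X \<and> card S = Suc k} \<union> insert x ` {S. S \<subseteq> X \<and> card S = k}" (is "?A = ?B \<union> ?C")
  proof (intro equalityI subsetI)
    fix S assume S: "S \<in> ?A"
    hence fS: "finite S" using assms(1) by (auto dest: finite_subset)
    show "S \<in> ?B \<union> ?C"
    proof (cases "x \<in> S")
      case True
      hence "S = insert x (S - {x})" "S - {x} \<subseteq> X" "card (S - {x}) = k" using S fS by auto
      thus ?thesis by blast
    qed (use S in auto)
  next
    fix S assume "S \<in> ?B \<union> ?C"
    thus "S \<in> ?A" using assms finite_subset[OF _ assms(1)] by (auto simp: card_insert_if)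
  qed
  have inj: "inj_on (insert x) {S. S \<subseteq> X \<and> card S = k}"
    using assms(2) by (intro inj_onI) (metis (no_types, lifting) insert_ident mem_Collect_eq subsetD)
  have fin: "finite ?B" "finite ?C" using assms(1) by auto
  have dis: "?B \<inter> ?C = {}" using assms(2) by auto
  have "esym (insert x X) (Suc k) = esym X (Suc k) + (\<Sum>S\<in>?C. \<Prod>i\<in>S. mvar i :: 'a mpoly)"
    unfolding esym_def split by (rule sum.union_disjoint[OF fin dis])
  also have "(\<Sum>S\<in>?C. \<Prod>i\<in>S. mvar i :: 'a mpoly) = (\<Sum>S | S \<subseteq> X \<and> card S = k. \<Prod>i\<in>insert x S. mvar i)"
    by (simp add: sum.reindex[OF inj])
  also have "\<dots> = mvar x * esym X k"
    unfolding esym_def sum_distrib_left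
  proof (intro sum.cong refl)
    fix S assume "S \<in> {S. S \<subseteq> X \<and> card S = k}"
    hence "finite S" "x \<notin> S" using assms by (auto dest: finite_subset)
    thus "(\<Prod>i\<in>insert x S. mvar i) = mvar x * (\<Prod>i\<in>S. mvar i :: 'a mpoly)" by simp
  qed
  finally show ?thesis .
qed

text \<open>The variable \<open>x \<in> X\<close> is a root of \<open>\<Prod>\<^sub>y\<^sub>\<in>\<^sub>X (T - y)\<close>; the sum telescopes.\<close>

lemma esym_root:
  assumes "finite X" "x \<in> X"
  shows "(\<Sum>i\<le>card X. (-1) ^ i * esym X i * mvar x ^ (card X - i)) = (0 :: 'a::field mpoly)"
proof -
  define Y where "Y = X - {x}"
  have Y: "finite Y" "x \<notin> Y" "X = insert x Y" "card X = Suc (card Y)"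
    using assms card_Suc_Diff1[OF assms] by (auto simp: Y_def)
  let ?y = "mvar x :: 'a mpoly"
  define t where "t i = (-1) ^ i * esym Y i * ?y ^ (card X - i)" for i
  have step: "(-1) ^ Suc i * esym X (Suc i) * ?y ^ (card X - Suc i) = t (Suc i) - t i" if "i < card X" for i
  proof -
    have "?y ^ (card X - i) = ?y * ?y ^ (card X - Suc i)"
      using that by (metis Suc_diff_Suc power_Suc)
    thus ?thesis unfolding t_def Y(3) esym_insert[OF Y(1,2)] by (simp add: algebra_simps)
  qed
  have "(\<Sum>i\<le>card X. (-1) ^ i * esym X i * ?y ^ (card X - i))
      = t 0 + (\<Sum>i<card X. t (Suc i) - t i)"
    unfolding sum.atMost_shift using step assms(1) Y(1) by (simp add: t_def esym_0)
  also have "\<dots> = t (card X)" by (simp only: sum_lessThan_telescope) simp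
  also have "\<dots> = 0" using Y by (simp add: t_def esym_gt)
  finally show ?thesis .
qed

lemma esym_act:
  assumes "bij \<sigma>" "\<sigma> ` X = X" shows "act \<sigma> (esym X k) = esym X k"
  using esym_permute[OF bij_is_inj[OF assms(1)], of X k] assms(2) by (simp add: act_def)

section \<open>Adjoining a root of a monic polynomial\<close>

definition subring_set :: "'b::comm_ring_1 set \<Rightarrow> bool" where
  "subring_set A \<longleftrightarrow> 0 \<in> A \<and> 1 \<in> A \<and> (\<forall>x\<in>A. \<forall>y\<in>A. x + y \<in> A \<and> x * y \<in> A) \<and> (\<forall>x\<in>A. - x \<in> A)"

definition power_span :: "'b::comm_ring_1 set \<Rightarrow> 'b \<Rightarrow> nat \<Rightarrow> 'b set" where
  "power_span A y m = {\<Sum>t<m. s t * y ^ t |s. \<forall>t. s t \<in> A}"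

lemma subring_setD:
  assumes "subring_set A"
  shows "0 \<in> A" "1 \<in> A" "x \<in> A \<Longrightarrow> y \<in> A \<Longrightarrow> x + y \<in> A" "x \<in> A \<Longrightarrow> y \<in> A \<Longrightarrow> x * y \<in> A"
    "x \<in> A \<Longrightarrow> - x \<in> A" "x \<in> A \<Longrightarrow> y \<in> A \<Longrightarrow> x - y \<in> A"
  using assms unfolding subring_set_def by (auto simp: diff_conv_add_uminus simp del: add_uminus_conv_diff)

lemma subring_set_sum:
  "subring_set A \<Longrightarrow> (\<And>x. x \<in> X \<Longrightarrow> h x \<in> A) \<Longrightarrow> sum h X \<in> A"
  by (induction X rule: infinite_finite_induct) (auto simp: subring_setD)

text \<open>
  The equation for \<open>y ^ m\<close> rewrites multiplication by \<open>y\<close> on the span of the lower powers, which is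
  therefore closed under products.
\<close>

lemma power_span_subring:
  assumes A: "subring_set A" and m: "0 < m" and y: "y ^ m \<in> power_span A y m"
  shows "subring_set (power_span A y m)" "A \<subseteq> power_span A y m" "y \<in> power_span A y m"
proof -
  let ?B = "power_span A y m"
  note A' = subring_setD[OF A]
  have BI: "(\<Sum>t<m. s t * y ^ t) \<in> ?B" if "\<And>t. s t \<in> A" for s
    using that unfolding power_span_def by blast
  have zero: "0 \<in> ?B" using BI[of "\<lambda>_. 0"] A' by simp
  have add: "p + q \<in> ?B" if pq: "p \<in> ?B" "q \<in> ?B" for p q
  proof -
    obtain s t where s: "p = (\<Sum>i<m. s i * y ^ i)" "\<And>i. s i \<in> A" and t: "q = (\<Sum>i<m. t i * y ^ i)" "\<And>i. t i \<in> A"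
      using pq unfolding power_span_def by blast
    have "p + q = (\<Sum>i<m. (s i + t i) * y ^ i)" by (simp add: s t distrib_right sum.distrib)
    thus ?thesis using BI[of "\<lambda>i. s i + t i"] s t A' by simp
  qed
  have scale: "a * p \<in> ?B" if ap: "a \<in> A" "p \<in> ?B" for a p
  proof -
    obtain s where s: "p = (\<Sum>i<m. s i * y ^ i)" "\<And>i. s i \<in> A"
      using ap unfolding power_span_def by blast
    have "a * p = (\<Sum>i<m. (a * s i) * y ^ i)" by (simp add: s sum_distrib_left mult.assoc)
    thus ?thesis using BI[of "\<lambda>i. a * s i"] s ap A' by simp
  qed
  have sums: "sum h X \<in> ?B" if "\<And>x. x \<in> X \<Longrightarrow> h x \<in> ?B" for h and X :: "nat set"
    using that by (induction X rule: infinite_finite_induct) (auto simp: zero add)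
  have pow: "y ^ t \<in> ?B" if "t \<le> m" for t
  proof (cases "t = m")
    case False
    have "(\<Sum>i<m. (if i = t then 1 else 0) * y ^ i) = (\<Sum>i<m. if i = t then y ^ i else 0)"
      by (intro sum.cong) auto
    also have "\<dots> = y ^ t" using False that by simp
    finally show ?thesis using BI[of "\<lambda>i. if i = t then 1 else 0"] A' by simp
  qed (use y in simp)
  show A_B: "A \<subseteq> ?B"
  proof
    fix a assume "a \<in> A"
    thus "a \<in> ?B" using scale[OF _ pow[of 0]] by simp
  qed
  show "y \<in> ?B" using pow[of 1] m by simp
  have yB: "y * p \<in> ?B" if p: "p \<in> ?B" for p
  proof -
    obtain s where s: "p = (\<Sum>i<m. s i * y ^ i)" "\<And>i. s i \<in> A"
      using p unfolding power_span_def by blast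
    have "y * p = (\<Sum>i<m. s i * y ^ Suc i)" by (simp add: s sum_distrib_left mult_ac)
    also have "\<dots> \<in> ?B" using s by (intro sums scale pow) auto
    finally show ?thesis .
  qed
  have ypB: "y ^ t * p \<in> ?B" if "p \<in> ?B" for t p
  proof (induction t)
    case (Suc t)
    from yB[OF this] show ?case by (simp add: mult.assoc)
  qed (use that in simp)
  have mult: "p * q \<in> ?B" if pq: "p \<in> ?B" "q \<in> ?B" for p q
  proof -
    obtain s where s: "p = (\<Sum>i<m. s i * y ^ i)" "\<And>i. s i \<in> A"
      using pq unfolding power_span_def by blast
    have "p * q = (\<Sum>i<m. s i * (y ^ i * q))" by (simp add: s sum_distrib_right mult.assoc)
    also have "\<dots> \<in> ?B" using s pq by (intro sums scale ypB) auto
    finally show ?thesis .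
  qed
  have "1 \<in> ?B" using A_B A' by blast
  moreover have "- p \<in> ?B" if "p \<in> ?B" for p
    using scale[of "- 1" p] that A' by auto
  ultimately show "subring_set ?B" unfolding subring_set_def using zero add mult by blast
qed

section \<open>Blocks of variables\<close>

text \<open>
  The variable \<open>i\<close> lies in the block \<open>{st i..<en i}\<close>.  One block is the case of the symmetric group.
\<close>

locale blocks =
  fixes n :: nat and st en :: "nat \<Rightarrow> nat"
  assumes st_le: "i < n \<Longrightarrow> st i \<le> i" and en_gt: "i < n \<Longrightarrow> i < en i" and en_le: "i < n \<Longrightarrow> en i \<le> n"
    and same: "i < n \<Longrightarrow> st i \<le> j \<Longrightarrow> j < en i \<Longrightarrow> st j = st i \<and> en j = en i"
begin

lemma st_eq_iff:
  assumes "i < n" "j < n" shows "st j = st i \<longleftrightarrow> st i \<le> j \<and> j < en i"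
proof
  assume eq: "st j = st i"
  have "en (st k) = en k" if "k < n" for k
    using same[of k "st k"] st_le[of k] en_gt[of k] that by auto
  hence "en j = en i" using assms eq by metis
  thus "st i \<le> j \<and> j < en i" using st_le[of j] en_gt[of j] assms eq by auto
qed (use same[OF assms(1), of j] in blast)

lemma st_eq_en_eq: "i < n \<Longrightarrow> j < n \<Longrightarrow> st j = st i \<Longrightarrow> en j = en i"
  using st_eq_iff same by blast

lemma st_mono: "i \<le> j \<Longrightarrow> j < n \<Longrightarrow> st i \<le> st j"
proof (rule ccontr)
  assume ij: "i \<le> j" "j < n" and "\<not> st i \<le> st j"
  hence "st j \<le> i" "i < en j" using st_le[of i] en_gt[of j] by auto
  thus False using same[OF ij(2)] \<open>\<not> st i \<le> st j\<close> by auto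
qed

definition young :: "(nat \<Rightarrow> nat) set" where
  "young = {\<sigma>. \<sigma> permutes {..<n} \<and> (\<forall>i<n. st (\<sigma> i) = st i)}"

lemma young_permutes: "\<sigma> \<in> young \<Longrightarrow> \<sigma> permutes {..<n}"
  by (simp add: young_def)

lemma young_lt: "\<sigma> \<in> young \<Longrightarrow> i < n \<Longrightarrow> \<sigma> i < n"
  using permutes_in_image[OF young_permutes, of \<sigma> i] by simp

lemma finite_young: "finite young"
  by (rule finite_subset[OF _ finite_permutations[of "{..<n}"]]) (auto simp: young_def)

lemma young_bij: "\<sigma> \<in> young \<Longrightarrow> bij \<sigma>"
  using young_permutes permutes_bij by blast

lemma young_comp: "\<sigma> \<in> young \<Longrightarrow> \<tau> \<in> young \<Longrightarrow> \<sigma> \<circ> \<tau> \<in> young"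
  using young_lt[of \<tau>] by (auto simp: young_def intro: permutes_compose)

lemma young_inv:
  assumes "\<sigma> \<in> young" shows "Hilbert_Choice.inv \<sigma> \<in> young"
proof -
  have p: "\<sigma> permutes {..<n}" by (rule young_permutes[OF assms])
  have "st (Hilbert_Choice.inv \<sigma> i) = st i" if "i < n" for i
  proof -
    have "Hilbert_Choice.inv \<sigma> i < n" using permutes_in_image[OF permutes_inv[OF p]] that by simp
    hence "st (\<sigma> (Hilbert_Choice.inv \<sigma> i)) = st (Hilbert_Choice.inv \<sigma> i)"
      using assms by (simp add: young_def)
    thus ?thesis using permutes_inverses(1)[OF p] by simp
  qed
  thus ?thesis using permutes_inv[OF p] by (simp add: young_def)
qed

lemma id_young: "id \<in> young"
  by (simp add: young_def permutes_id)

lemma transpose_young: "i < n \<Longrightarrow> j < n \<Longrightarrow> st i = st j \<Longrightarrow> transpose i j \<in> young"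
  by (auto simp: young_def permutes_swap_id transpose_def)

lemma Alt_young_act: "\<tau> \<in> young \<Longrightarrow> Alt young (act \<tau> q) = of_int (sign \<tau>) * Alt young q"
  by (rule Alt_act[where n = n]) (auto intro: young_permutes young_comp young_inv)

lemma young_block:
  assumes "\<sigma> \<in> young" "i < n" shows "\<sigma> ` {st i..<en i} = {st i..<en i}"
proof -
  have "\<sigma> j \<in> {st i..<en i}" if "j \<in> {st i..<en i}" for j
  proof -
    have "j < n" using that en_le[OF assms(2)] by simp
    hence "\<sigma> j < n" "st (\<sigma> j) = st j" using young_lt[OF assms(1)] assms(1) by (auto simp: young_def)
    thus ?thesis using same[OF assms(2)] that st_eq_iff[OF assms(2) \<open>\<sigma> j < n\<close>] by simp
  qed
  thus ?thesis using young_bij[OF assms(1)]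
    by (intro card_subset_eq) (auto simp: card_image inj_on_subset[OF bij_is_inj])
qed

definition coord :: "nat \<Rightarrow> 'a::field mpoly" where
  "coord i = esym {st i..<en i} (Suc (i - st i))"

definition ev :: "'a::field mpoly \<Rightarrow> 'a mpoly" where
  "ev p = mpoly_subst coord p"

lemma ev_simps [simp]:
  "ev (p + q) = ev p + ev q" "ev (p * q) = ev p * ev q" "ev (mconst c) = mconst c"
  "ev 0 = 0" "ev 1 = 1" "ev (mvar i) = coord i" "ev (sum h X) = (\<Sum>x\<in>X. ev (h x))"
  by (simp_all add: ev_def mpoly_subst_add mpoly_subst_mult mpoly_subst_sum)

lemma ev_uminus [simp]: "ev (- p) = - ev p"
  using ev_simps(1)[of p "- p"] by (simp add: eq_neg_iff_add_eq_0 add.commute)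

lemma coord_mpolys: "i < n \<Longrightarrow> coord i \<in> mpolys n"
  unfolding coord_def using en_le[of i] by (intro esym_mpolys) auto

lemma ev_mpolys: "p \<in> mpolys n \<Longrightarrow> ev p \<in> mpolys n"
  unfolding ev_def by (rule mpolys_subst[of _ n]) (auto intro: coord_mpolys)

lemma act_ev:
  assumes "\<sigma> \<in> young" "p \<in> mpolys n" shows "act \<sigma> (ev p) = ev p"
  unfolding act_def ev_def mpoly_subst_subst
proof (rule mpoly_subst_cong[OF assms(2)])
  fix i assume "i < n"
  thus "mpoly_subst (\<lambda>i. mvar (\<sigma> i)) (coord i) = coord i"
    using esym_act[OF young_bij[OF assms(1)] young_block[OF assms(1)]] by (simp add: coord_def act_def)
qed

text \<open>
  Adjoining the variables one after the other: over the block-symmetric polynomials and the earlier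
  variables, \<open>x\<^sub>k\<close> is a root of the monic polynomial with the roots \<open>x\<^sub>k, \<dots>, x\<^sub>e\<^sub>n\<^sub>-\<^sub>1\<close>, whose
  coefficients only involve these.
\<close>

primrec tower :: "nat \<Rightarrow> 'a::field mpoly set" where
  "tower 0 = ev ` mpolys n"
| "tower (Suc k) = power_span (tower k) (mvar k) (en k - k)"

text \<open>
  Deleting the first variable of the range divides the generating polynomial of the elementary
  symmetric polynomials by the factor \<open>1 + x\<^sub>j T\<close>, and \<open>x\<^sub>j\<close> already lies in the tower.
\<close>

lemma esym_tail_tower:
  assumes k: "k < n" and sub: "subring_set (tower k :: 'a::field mpoly set)"
    and vars: "\<And>j. j < k \<Longrightarrow> mvar j \<in> (tower k :: 'a mpoly set)"
    and ev: "\<And>p. p \<in> mpolys n \<Longrightarrow> ev p \<in> (tower k :: 'a mpoly set)"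
    and j: "st k \<le> j" "j \<le> k"
  shows "esym {j..<en k} t \<in> (tower k :: 'a mpoly set)"
  using j
proof (induction j arbitrary: t rule: dec_induct)
  case base
  show ?case
  proof (cases t)
    case 0
    thus ?thesis using subring_setD[OF sub] by (simp add: esym_0)
  next
    case (Suc t')
    show ?thesis
    proof (cases "t \<le> en k - st k")
      case True
      define i where "i = st k + t'"
      have i: "st k \<le> i" "i < en k" using True Suc by (auto simp: i_def)
      hence "i < n" using en_le[OF k] by simp
      moreover have "coord i = (esym {st k..<en k} t :: 'a mpoly)"
        using same[OF k i] by (simp add: coord_def Suc i_def)
      ultimately show ?thesis using ev[OF mpolys_mvar] by (metis ev_simps(6))
    next
      case False
      thus ?thesis using subring_setD[OF sub] by (simp add: esym_gt)
    qed
  qed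
next
  case (step j)
  have e: "{j..<en k} = insert j {Suc j..<en k}" using step.hyps step.prems en_gt[OF k] by auto
  show ?case
  proof (induction t)
    case 0
    show ?case using subring_setD[OF sub] by (simp add: esym_0)
  next
    case (Suc t)
    have "esym {Suc j..<en k} (Suc t)
        = (esym {j..<en k} (Suc t) - mvar j * esym {Suc j..<en k} t :: 'a mpoly)"
      unfolding e by (subst esym_insert) auto
    also have "\<dots> \<in> tower k"
      by (intro subring_setD(6)[OF sub] subring_setD(4)[OF sub] vars Suc.IH step.IH)
         (use step.prems in auto)
    finally show ?case .
  qed
qed

lemma tower_subring:
  "k \<le> n \<Longrightarrow> subring_set (tower k :: 'a::field mpoly set) \<and> (\<forall>j<k. mvar j \<in> (tower k :: 'a mpoly set)) \<and>
     (\<forall>p\<in>mpolys n. ev p \<in> (tower k :: 'a mpoly set))"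
proof (induction k)
  case 0
  have "subring_set (ev ` mpolys n :: 'a mpoly set)"
    unfolding subring_set_def
  proof (intro conjI ballI)
    show "0 \<in> ev ` (mpolys n :: 'a mpoly set)" by (rule image_eqI[of _ _ 0]) auto
    show "1 \<in> ev ` (mpolys n :: 'a mpoly set)" by (rule image_eqI[of _ _ 1]) auto
    show "x + y \<in> ev ` (mpolys n :: 'a mpoly set)" "x * y \<in> ev ` (mpolys n :: 'a mpoly set)"
      if "x \<in> ev ` (mpolys n :: 'a mpoly set)" "y \<in> ev ` (mpolys n :: 'a mpoly set)" for x y
      using that by (auto intro: mpolys_add mpolys_mult simp flip: ev_simps)
    show "- x \<in> ev ` (mpolys n :: 'a mpoly set)" if "x \<in> ev ` (mpolys n :: 'a mpoly set)" for x
      using that by (auto intro: mpolys_uminus simp flip: ev_uminus)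
  qed
  thus ?case by auto
next
  case (Suc k)
  hence k: "k < n" and sub: "subring_set (tower k :: 'a mpoly set)"
    and vars: "\<And>j. j < k \<Longrightarrow> mvar j \<in> (tower k :: 'a mpoly set)"
    and ev: "\<And>p. p \<in> mpolys n \<Longrightarrow> ev p \<in> (tower k :: 'a mpoly set)" by auto
  let ?m = "en k - k" and ?y = "mvar k :: 'a mpoly" and ?X = "{k..<en k}"
  have m: "0 < ?m" using en_gt[OF k] by simp
  define c where "c i = - ((-1) ^ i * esym ?X i :: 'a mpoly)" for i
  have cin: "c i \<in> tower k" for i
  proof -
    have "(-1) ^ i \<in> (tower k :: 'a mpoly set)"
      using subring_setD[OF sub] by (induction i) auto
    thus ?thesis unfolding c_def
      using esym_tail_tower[OF k sub vars ev st_le[OF k] order_refl] subring_setD[OF sub] by blast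
  qed
  have "(\<Sum>i\<le>?m. (-1) ^ i * esym ?X i * ?y ^ (?m - i)) = 0"
    using esym_root[of ?X k] en_gt[OF k] by simp
  hence "?y ^ ?m + (\<Sum>i<?m. (-1) ^ Suc i * esym ?X (Suc i) * ?y ^ (?m - Suc i)) = 0"
    by (simp add: sum.atMost_shift esym_0)
  hence "?y ^ ?m = (\<Sum>i<?m. c (Suc i) * ?y ^ (?m - Suc i))"
    by (simp add: c_def eq_neg_iff_add_eq_0 sum_negf[symmetric] del: power_Suc)
       (simp add: add_eq_0_iff sum_negf)
  also have "\<dots> = (\<Sum>t<?m. c (?m - t) * ?y ^ t)"
    by (subst sum.nat_diff_reindex[symmetric]) (auto intro!: sum.cong simp: Suc_diff_Suc)
  finally have "?y ^ ?m \<in> power_span (tower k) ?y ?m"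
    unfolding power_span_def using cin by (intro CollectI exI[of _ "\<lambda>t. c (?m - t)"]) auto
  from power_span_subring[OF sub m this] show ?case
    using vars ev by (auto simp: less_Suc_eq)
qed

definition stair :: "nat \<Rightarrow>\<^sub>0 nat" where
  "stair = expo n (\<lambda>i. en i - 1 - i)"

text \<open>
  The exponents of the monomials in the first \<open>k\<close> variables that generate the \<open>k\<close>-th step of the tower:
  the equation for the \<open>i\<close>-th variable has degree \<open>en i - i\<close>.
\<close>

definition boxed :: "nat \<Rightarrow> (nat \<Rightarrow>\<^sub>0 nat) set" where
  "boxed k = {a. \<forall>i. if i < k then lookup a i < en i - i else lookup a i = 0}"

lemma boxed_iff: "a \<in> boxed k \<longleftrightarrow> (\<forall>i. if i < k then lookup a i < en i - i else lookup a i = 0)"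
  by (simp add: boxed_def)

lemma boxed_top: "a \<in> boxed k \<Longrightarrow> k \<le> i \<Longrightarrow> lookup a i = 0"
  unfolding boxed_iff by (metis not_less)

lemma boxed_0: "boxed 0 = {0}"
  by (auto simp: boxed_iff intro!: poly_mapping_eqI)

lemma bij_betw_boxed_Suc:
  assumes "k < n"
  shows "bij_betw (\<lambda>(t, a). a + Poly_Mapping.single k t) ({..<en k - k} \<times> boxed k) (boxed (Suc k))"
proof (rule bij_betw_byWitness[where f' = "\<lambda>a. (lookup a k, Poly_Mapping.update k 0 a)"])
  show "\<forall>x\<in>{..<en k - k} \<times> boxed k. (\<lambda>a. (lookup a k, Poly_Mapping.update k 0 a)) ((\<lambda>(t, a). a + Poly_Mapping.single k t) x) = x"
  proof (intro ballI)
    fix x assume "x \<in> {..<en k - k} \<times> boxed k"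
    then obtain t a where x: "x = (t, a)" "a \<in> boxed k" by blast
    hence "lookup a k = 0" using boxed_top by blast
    moreover have "Poly_Mapping.update k 0 (a + Poly_Mapping.single k t) = a"
      using calculation by (intro poly_mapping_eqI) (auto simp: lookup_update lookup_add lookup_single)
    ultimately show "(\<lambda>a. (lookup a k, Poly_Mapping.update k 0 a)) ((\<lambda>(t, a). a + Poly_Mapping.single k t) x) = x"
      by (simp add: lookup_add x)
  qed
  show "\<forall>a\<in>boxed (Suc k). (\<lambda>(t, a). a + Poly_Mapping.single k t) (lookup a k, Poly_Mapping.update k 0 a) = a"
    by (auto intro!: poly_mapping_eqI simp: lookup_update lookup_add lookup_single when_def)
  show "(\<lambda>(t, a). a + Poly_Mapping.single k t) ` ({..<en k - k} \<times> boxed k) \<subseteq> boxed (Suc k)"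
  proof clarify
    fix t a assume t: "t < en k - k" and a: "a \<in> boxed k"
    have "if i < Suc k then lookup (a + Poly_Mapping.single k t) i < en i - i
        else lookup (a + Poly_Mapping.single k t) i = 0" for i
      using t a[unfolded boxed_iff, rule_format, of i]
      by (auto simp: lookup_add lookup_single when_def split: if_splits)
    thus "a + Poly_Mapping.single k t \<in> boxed (Suc k)" unfolding boxed_iff by blast
  qed
  show "(\<lambda>a. (lookup a k, Poly_Mapping.update k 0 a)) ` boxed (Suc k) \<subseteq> {..<en k - k} \<times> boxed k"
  proof clarify
    fix a assume a: "a \<in> boxed (Suc k)"
    have "if i < k then lookup (Poly_Mapping.update k 0 a) i < en i - i
        else lookup (Poly_Mapping.update k 0 a) i = 0" for i
      using a[unfolded boxed_iff, rule_format, of i] by (auto simp: lookup_update split: if_splits)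
    moreover have "lookup a k < en k - k" using a[unfolded boxed_iff, rule_format, of k] by simp
    ultimately show "lookup a k \<in> {..<en k - k} \<and> Poly_Mapping.update k 0 a \<in> boxed k"
      unfolding boxed_iff by blast
  qed
qed

lemma finite_boxed: "k \<le> n \<Longrightarrow> finite (boxed k)"
proof (induction k)
  case (Suc k)
  thus ?case using bij_betw_finite[OF bij_betw_boxed_Suc[of k]] by auto
qed (simp add: boxed_0)

lemma tower_span:
  "k \<le> n \<Longrightarrow> q \<in> tower k \<Longrightarrow> \<exists>c. (\<forall>a. c a \<in> mpolys n) \<and> q = (\<Sum>a\<in>boxed k. ev (c a) * xmon a)"
proof (induction k arbitrary: q)
  case 0
  then obtain p where "p \<in> mpolys n" "q = ev p" by auto
  thus ?case by (intro exI[of _ "\<lambda>_. p"]) (simp add: boxed_0)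
next
  case (Suc k)
  then obtain s where s: "q = (\<Sum>t<en k - k. s t * mvar k ^ t)" "\<And>t. s t \<in> tower k"
    by (auto simp: power_span_def)
  have "\<forall>t. \<exists>c. (\<forall>a. c a \<in> mpolys n) \<and> s t = (\<Sum>a\<in>boxed k. ev (c a) * xmon a)"
    using Suc s(2) by simp
  from choice[OF this] obtain c
    where c': "\<forall>t. (\<forall>a. c t a \<in> mpolys n) \<and> s t = (\<Sum>a\<in>boxed k. ev (c t a) * xmon a)" by blast
  hence c: "\<And>t a. c t a \<in> mpolys n" "\<And>t. s t = (\<Sum>a\<in>boxed k. ev (c t a) * xmon a)" by blast+
  define d where "d a = c (lookup a k) (Poly_Mapping.update k 0 a)" for a
  have "q = (\<Sum>t<en k - k. \<Sum>a\<in>boxed k. ev (c t a) * xmon (a + Poly_Mapping.single k t))"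
    by (simp only: s(1) c(2) sum_distrib_right mvar_power xmon_add mult.assoc)
  also have "\<dots> = (\<Sum>(t, a)\<in>{..<en k - k} \<times> boxed k. ev (d (a + Poly_Mapping.single k t)) * xmon (a + Poly_Mapping.single k t))"
    unfolding sum.cartesian_product
  proof (intro sum.cong refl, clarify)
    fix t a assume "a \<in> boxed k"
    hence "lookup a k = 0" using boxed_top by blast
    moreover have "Poly_Mapping.update k 0 (a + Poly_Mapping.single k t) = a"
      using calculation by (intro poly_mapping_eqI) (auto simp: lookup_update lookup_add lookup_single)
    ultimately show "ev (c t a) * xmon (a + Poly_Mapping.single k t)
      = ev (d (a + Poly_Mapping.single k t)) * xmon (a + Poly_Mapping.single k t)"
      by (simp add: d_def lookup_add)
  qed
  also have "\<dots> = (\<Sum>a\<in>boxed (Suc k). ev (d a) * xmon a)"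
    using sum.reindex_bij_betw[OF bij_betw_boxed_Suc[of k], of "\<lambda>a. ev (d a) * xmon a"] Suc.prems
    by (simp add: case_prod_unfold)
  finally show ?case using c(1) by (intro exI[of _ d]) (simp add: d_def)
qed

theorem block_symmetric_span:
  fixes q :: "'a::field mpoly"
  assumes "q \<in> mpolys n"
  obtains c where "\<And>a. c a \<in> mpolys n" "q = (\<Sum>a\<in>boxed n. ev (c a) * xmon a)"
proof -
  note T = tower_subring[OF order_refl, where 'a = 'a]
  hence sub: "subring_set (tower n :: 'a mpoly set)" by blast
  have "mconst (lookup q m) * xmon m \<in> tower n" if "m \<in> keys q" for m
  proof -
    have m: "keys m \<subseteq> {..<n}" using assms that by (auto simp: mpolys_def)
    have "mvar i ^ k \<in> (tower n :: 'a mpoly set)" if "i < n" for i k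
      using T that subring_setD[OF sub] by (induction k) auto
    hence "(\<Prod>i<l. mvar i ^ lookup m i) \<in> (tower n :: 'a mpoly set)" if "l \<le> n" for l
      using that subring_setD[OF sub] by (induction l) auto
    hence "xmon m \<in> (tower n :: 'a mpoly set)"
      using xmon_expo[of n "lookup m", where 'a = 'a] expo_lookup[OF m] by auto
    moreover have "ev (mconst (lookup q m)) \<in> (tower n :: 'a mpoly set)" using T mpolys_mconst by blast
    ultimately show ?thesis using subring_setD[OF sub] by simp
  qed
  hence "(\<Sum>m\<in>keys q. mconst (lookup q m) * xmon m) \<in> tower n" by (rule subring_set_sum[OF sub])
  hence "q \<in> tower n" by (simp only: mpoly_expand[symmetric])
  from tower_span[OF order_refl this] show ?thesis using that by blast
qed

end

section \<open>Antisymmetrization over a Young subgroup\<close>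

lemma lookup_map_key: "bij \<sigma> \<Longrightarrow> lookup (Poly_Mapping.map_key \<sigma> a) i = lookup a (\<sigma> i)"
  by (simp add: map_key.rep_eq bij_is_inj)

lemma lookup_esym_0: "finite X \<Longrightarrow> 0 < k \<Longrightarrow> lookup (esym X k) 0 = 0"
proof -
  assume X: "finite X" and k: "0 < k"
  have "lookup (\<Prod>i\<in>S. mvar i :: 'a mpoly) 0 = 0" if "card S = k" for S
  proof -
    have "finite S" using that k card.infinite by fastforce
    hence "lookup (\<Prod>i\<in>S. mvar i :: 'a mpoly) 0 = (\<Prod>i\<in>S. lookup (mvar i) 0)"
      by (induction S) (simp_all add: lookup_mult_0)
    also have "\<dots> = 0"
    proof -
      have "lookup (mvar i :: 'a mpoly) 0 = 0" for i
        by (auto simp: mvar_def lookup_single when_def poly_mapping_eq_iff fun_eq_iff)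
      moreover have "S \<noteq> {}" using that k by auto
      ultimately show ?thesis using \<open>finite S\<close> by (auto intro: prod_zero)
    qed
    finally show ?thesis .
  qed
  thus ?thesis by (simp add: esym_def lookup_sum)
qed

context blocks
begin

definition block_inj :: "(nat \<Rightarrow>\<^sub>0 nat) \<Rightarrow> bool" where
  "block_inj a \<longleftrightarrow> (\<forall>i<n. \<forall>j<n. st i = st j \<longrightarrow> lookup a i = lookup a j \<longrightarrow> i = j)"

lemma lookup_stair [simp]: "lookup stair i = (if i < n then en i - 1 - i else 0)"
  by (simp add: stair_def)

lemma stair_boxed: "stair \<in> boxed n"
proof -
  have "en i - 1 - i < en i - i" if "i < n" for i using en_gt[OF that] by simp
  thus ?thesis by (auto simp: boxed_iff)
qed

lemma stair_block_inj: "block_inj stair"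
  unfolding block_inj_def
proof (intro allI impI)
  fix i j assume ij: "i < n" "j < n" "st i = st j" "lookup stair i = lookup stair j"
  have "en i = en j" using st_eq_en_eq ij by metis
  thus "i = j" using ij en_gt[OF ij(1)] en_gt[OF ij(2)] by auto
qed

text \<open>From the end of a block backwards, each exponent is forced by the pigeonhole principle.\<close>

lemma boxed_block_inj:
  assumes a: "a \<in> boxed n" and inj: "block_inj a" shows "a = stair"
proof -
  have "lookup a i = en i - 1 - i" if i: "i < n" for i
    using i
  proof (induction "n - i" arbitrary: i rule: less_induct)
    case less
    have lt: "lookup a i < en i - i" using a less.prems by (auto simp: boxed_iff)
    show ?case
    proof (rule ccontr)
      assume ne: "lookup a i \<noteq> en i - 1 - i"
      define j where "j = en i - 1 - lookup a i"
      have j: "i < j" "j < en i" using lt ne by (auto simp: j_def)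
      hence jn: "j < n" using en_le[OF less.prems] by simp
      have s: "st j = st i" "en j = en i" using same[OF less.prems _ j(2)] j st_le[OF less.prems] by auto
      have "lookup a j = en j - 1 - j" using j jn less.prems by (intro less.hyps) auto
      also have "\<dots> = lookup a i" using lt j s by (auto simp: j_def)
      finally show False using inj less.prems jn s j unfolding block_inj_def by blast
    qed
  qed
  thus ?thesis using boxed_top[OF a] by (intro poly_mapping_eqI) auto
qed

lemma map_key_fixed_id:
  assumes "block_inj a" "\<sigma> \<in> young" "Poly_Mapping.map_key \<sigma> a = a" shows "\<sigma> = id"
proof
  fix i
  show "\<sigma> i = id i"
  proof (cases "i < n")
    case True
    have "lookup a (\<sigma> i) = lookup a i"
      using lookup_map_key[OF young_bij[OF assms(2)], of a i] assms(3) by simp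
    thus ?thesis using True young_lt[OF assms(2) True] assms(1,2)
      by (auto simp: block_inj_def young_def)
  qed (use young_permutes[OF assms(2)] in \<open>simp add: permutes_def\<close>)
qed

lemma act_transpose_xmon:
  assumes "lookup a i = lookup a j" shows "act (transpose i j) (xmon a) = xmon a"
proof -
  have "Poly_Mapping.map_key (transpose i j) a = a"
    using assms by (intro poly_mapping_eqI) (auto simp: lookup_map_key transpose_def)
  thus ?thesis using act_xmon[of "transpose i j" a] by simp
qed

text \<open>
  A transposition in the group that fixes \<open>q\<close> shows that the antisymmetrization is its own negative.
\<close>

lemma Alt_young_swap:
  fixes q :: "'a::field mpoly"
  assumes "(2::'a) \<noteq> 0" "i < n" "j < n" "i \<noteq> j" "st i = st j" "act (transpose i j) q = q"
  shows "Alt young q = 0"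
proof (rule two_mpoly_cancel[OF assms(1)])
  show "Alt young q = - Alt young q"
    using Alt_young_act[OF transpose_young[OF assms(2,3,5)], of q] assms(4,6)
    by (simp add: sign_swap_id)
qed

lemma Alt_young_repeat:
  assumes "(2::'a::field) \<noteq> 0" "\<not> block_inj a" shows "Alt young (xmon a) = (0 :: 'a mpoly)"
  using assms Alt_young_swap act_transpose_xmon unfolding block_inj_def by blast

lemma lookup_Alt_xmon:
  "lookup (Alt young (xmon a)) m
    = (\<Sum>\<sigma>\<in>young. if Poly_Mapping.map_key \<sigma> m = a then of_int (sign \<sigma>) else 0)"
  by (subst lookup_Alt) (auto simp: young_bij lookup_xmon intro!: sum.cong)

lemma lookup_Alt_xmon_self:
  assumes "block_inj a" shows "lookup (Alt young (xmon a) :: 'a::field mpoly) a = 1"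
proof -
  have "lookup (Alt young (xmon a) :: 'a mpoly) a = (\<Sum>\<sigma>\<in>young. if \<sigma> = id then 1 else 0)"
    unfolding lookup_Alt_xmon
  proof (intro sum.cong refl)
    fix \<sigma> assume s: "\<sigma> \<in> young"
    have "Poly_Mapping.map_key id a = a" by (rule poly_mapping_eqI) (simp add: lookup_map_key)
    thus "(if Poly_Mapping.map_key \<sigma> a = a then of_int (sign \<sigma>) else (0::'a)) = (if \<sigma> = id then 1 else 0)"
      using map_key_fixed_id[OF assms s] by (cases "\<sigma> = id") auto
  qed
  also have "\<dots> = 1" using finite_young id_young by simp
  finally show ?thesis .
qed

text \<open>
  The product of the Vandermonde determinants of the blocks.
\<close>

definition disc :: "'a::field mpoly" where
  "disc = Alt young (xmon stair)"

lemma disc_nonzero: "disc \<noteq> (0 :: 'a::field mpoly)"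
  using lookup_Alt_xmon_self[OF stair_block_inj, where 'a = 'a] by (auto simp: disc_def)

lemma keys_Alt_xmon:
  assumes "m \<in> keys (Alt young (xmon a) :: 'a::field mpoly)" shows "\<exists>\<sigma>\<in>young. Poly_Mapping.map_key \<sigma> m = a"
proof (rule ccontr)
  assume "\<not> ?thesis"
  hence "lookup (Alt young (xmon a) :: 'a mpoly) m = 0" unfolding lookup_Alt_xmon by (intro sum.neutral) auto
  thus False using assms by (simp add: in_keys_iff)
qed

end

section \<open>The coefficient functional of the symmetric group\<close>

text \<open>
  The antisymmetrization is the Vandermonde determinant times a symmetric polynomial.  The only
  monomial of the Vandermonde determinant that divides the staircase monomial is the latter itself, so
  the coefficient is the constant term of that symmetric polynomial.
\<close>

definition coeff_functional :: "nat \<Rightarrow> 'a::field mpoly \<Rightarrow> 'a" where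
  "coeff_functional n q = lookup (Alt {\<sigma>. \<sigma> permutes {..<n}} q) (expo n (\<lambda>i. n - 1 - i))"

lemma blocks_full: "blocks n (\<lambda>_. 0) (\<lambda>_. n)"
  by unfold_locales auto

interpretation full: blocks n "\<lambda>_. 0" "\<lambda>_. n" for n
  by (rule blocks_full)

lemma full_young: "full.young n = {\<sigma>. \<sigma> permutes {..<n}}"
  by (simp add: full.young_def)

lemma coeff_functional_Alt: "coeff_functional n q = lookup (Alt (full.young n) q) (full.stair n)"
  by (simp add: coeff_functional_def full_young full.stair_def)

lemma coeff_functional_add: "coeff_functional n (p + q) = coeff_functional n p + coeff_functional n q"
  by (simp add: coeff_functional_def Alt_add lookup_add)

lemma coeff_functional_sum: "coeff_functional n (sum h X) = (\<Sum>x\<in>X. coeff_functional n (h x))"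
  by (simp add: coeff_functional_def Alt_sum lookup_sum)

lemma coeff_functional_mconst: "coeff_functional n (mconst c * q) = c * coeff_functional n q"
  unfolding coeff_functional_def
  by (subst Alt_invariant_mult) (simp_all add: act_simps)

lemma coeff_functional_swap:
  fixes q :: "'a::field mpoly"
  assumes "(2::'a) \<noteq> 0" "i < n" "j < n" "i \<noteq> j" "act (transpose i j) q = q"
  shows "coeff_functional n q = 0"
  using full.Alt_young_swap[of i n j q] assms by (simp add: coeff_functional_Alt)

lemma coeff_functional_stair: "coeff_functional n (xmon (full.stair n)) = (1::'a::field)"
  by (simp add: coeff_functional_Alt full.lookup_Alt_xmon_self full.stair_block_inj)

lemma coeff_functional_alt_sum:
  "coeff_functional n q = (\<Sum>\<sigma> | \<sigma> permutes {..<n}.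
     of_int (sign \<sigma>) * lookup q (Poly_Mapping.map_key \<sigma> (full.stair n)))"
  unfolding coeff_functional_Alt by (subst lookup_Alt) (auto simp: full.young_bij full_young)

text \<open>
  The symmetric factor passes through the antisymmetrization, whose monomials have pairwise distinct
  exponents.  The only such monomial dividing the staircase monomial is the staircase monomial
  itself, so that its cofactor is the constant term of the symmetric factor.
\<close>

lemma coeff_functional_esym:
  fixes q :: "'a::field mpoly"
  assumes two: "(2::'a) \<noteq> 0" and k: "0 < k"
  shows "coeff_functional n (esym {..<n} k * q) = 0"
proof -
  let ?e = "esym {..<n} k :: 'a mpoly"
  have sym: "act \<sigma> ?e = ?e" if "\<sigma> \<in> full.young n" for \<sigma>
    using that by (intro esym_act full.young_bij) (auto simp: full_young permutes_image)
  have alt_e: "Alt (full.young n) (?e * p) = ?e * Alt (full.young n) p" for p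
    by (rule Alt_invariant_mult) (rule sym)
  have mono: "coeff_functional n (?e * xmon a) = 0" for a
  proof (cases "full.block_inj n a")
    case False
    thus ?thesis unfolding coeff_functional_Alt alt_e
      by (simp add: full.Alt_young_repeat[OF two])
  next
    case True
    show ?thesis
    proof (rule ccontr)
      assume "coeff_functional n (?e * xmon a) \<noteq> 0"
      hence "full.stair n \<in> keys (?e * Alt (full.young n) (xmon a))"
        unfolding coeff_functional_Alt alt_e by (simp add: in_keys_iff)
      then obtain s m where sm: "s \<in> keys ?e" "m \<in> keys (Alt (full.young n) (xmon a) :: 'a mpoly)"
        "full.stair n = s + m" using keys_mult by blast
      obtain \<sigma> where \<sigma>: "\<sigma> \<in> full.young n" "Poly_Mapping.map_key \<sigma> m = a"
        using full.keys_Alt_xmon[OF sm(2)] by blast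
      have "lookup m i \<le> n - 1 - i" if "i < n" for i
        using arg_cong[OF sm(3), of "\<lambda>x. lookup x i"] that by (simp add: lookup_add)
      moreover have "lookup m i = 0" if "n \<le> i" for i
        using arg_cong[OF sm(3), of "\<lambda>x. lookup x i"] that by (simp add: lookup_add)
      ultimately have "m \<in> full.boxed n n" by (fastforce simp: full.boxed_iff)
      moreover have "full.block_inj n m"
        unfolding full.block_inj_def
      proof (intro allI impI)
        fix i j assume ij: "i < n" "j < n" "lookup m i = lookup m j"
        have p: "\<sigma> permutes {..<n}" using \<sigma> by (simp add: full_young)
        obtain i' j' where i': "i' < n" "\<sigma> i' = i" and j': "j' < n" "\<sigma> j' = j"
          using ij permutes_surj[OF p] permutes_in_image[OF p] by (metis lessThan_iff surjD)
        have "lookup a i' = lookup a j'"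
          using \<sigma>(2) ij(3) i' j' lookup_map_key[OF full.young_bij[OF \<sigma>(1)]] by metis
        thus "i = j" using True i' j' by (auto simp: full.block_inj_def)
      qed
      ultimately have "m = full.stair n" by (rule full.boxed_block_inj)
      hence "s = 0" using sm(3) by simp
      thus False using sm(1) lookup_esym_0[of "{..<n}" k, where 'a = 'a] k by (simp add: in_keys_iff)
    qed
  qed
  have "?e * q = (\<Sum>m\<in>keys q. mconst (lookup q m) * (?e * xmon m))"
    by (subst (1) mpoly_expand[of q]) (simp add: sum_distrib_left mult_ac)
  thus ?thesis by (simp add: coeff_functional_sum coeff_functional_mconst mono)
qed

section \<open>Algebraic independence of the block-elementary symmetric polynomials\<close>

lemma esym_erase:
  "mpoly_subst (mvar(k := 0)) (esym X l) = (esym (X - {k}) l :: 'a::field mpoly)" if "finite X"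
proof -
  have "mpoly_subst (mvar(k := 0)) (esym X l) = (\<Sum>S | S \<subseteq> X \<and> card S = l. \<Prod>i\<in>S. (mvar(k := 0)) i :: 'a mpoly)"
    by (simp add: esym_def mpoly_subst_sum mpoly_subst_prod)
  also have "\<dots> = (\<Sum>S | S \<subseteq> X - {k} \<and> card S = l. \<Prod>i\<in>S. (mvar(k := 0)) i :: 'a mpoly)"
  proof (rule sum.mono_neutral_right)
    show "\<forall>S\<in>{S. S \<subseteq> X \<and> card S = l} - {S. S \<subseteq> X - {k} \<and> card S = l}. (\<Prod>i\<in>S. (mvar(k := 0)) i :: 'a mpoly) = 0"
    proof
      fix S assume "S \<in> {S. S \<subseteq> X \<and> card S = l} - {S. S \<subseteq> X - {k} \<and> card S = l}"
      hence "finite S" "k \<in> S" using that by (auto dest: finite_subset)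
      thus "(\<Prod>i\<in>S. (mvar(k := 0)) i :: 'a mpoly) = 0" by (intro prod_zero) auto
    qed
  qed (use that in auto)
  also have "\<dots> = esym (X - {k}) l"
    unfolding esym_def by (intro sum.cong prod.cong refl) auto
  finally show ?thesis .
qed

lemma mvar_nonzero: "mvar i \<noteq> (0 :: 'a::field mpoly)"
  using keys_single[of "Poly_Mapping.single i (1::nat)" "1::'a"]
  by (metis keys_eq_empty insert_not_empty mvar_def one_neq_zero)

text \<open>
  Setting the last variable to \<open>0\<close> kills the last coordinate and turns the others into the
  coordinates for one variable less.
\<close>

lemma block_coords_independent:
  assumes "blocks n st en" "p \<in> mpolys n" "blocks.ev st en p = (0 :: 'a::field mpoly)"
  shows "p = 0"
  using assms
proof (induction n arbitrary: en p)
  case 0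
  interpret blocks 0 st en by fact
  have "keys p \<subseteq> {0}" using 0(2) by (auto simp: mpolys_def)
  hence "p = mconst (lookup p 0)"
    by (intro poly_mapping_eqI) (auto simp: mconst_def lookup_single when_def in_keys_iff)
  hence "ev p = p" using ev_simps(3) by metis
  thus ?case using 0 by simp
next
  case (Suc n)
  interpret blocks "Suc n" st en by fact
  define en' where "en' i = min (en i) n" for i
  have bl': "blocks n st en'"
  proof
    fix i j assume i: "i < n"
    show "st i \<le> i" "i < en' i" "en' i \<le> n"
      using i st_le[of i] en_gt[of i] by (auto simp: en'_def)
    assume "st i \<le> j" "j < en' i"
    thus "st j = st i \<and> en' j = en' i" using same[of i j] i by (auto simp: en'_def)
  qed
  interpret b': blocks n st en' by (rule bl')
  let ?z = "mvar n :: 'a mpoly"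
  have coord_n: "coord n = (\<Prod>i\<in>{st n..<Suc n}. mvar i :: 'a mpoly)"
  proof -
    have "en n = Suc n" using en_gt[of n] en_le[of n] by simp
    moreover have "Suc (n - st n) = card {st n..<Suc n}" using st_le[of n] by simp
    ultimately show ?thesis by (simp only: coord_def esym_card[OF finite_atLeastLessThan])
  qed
  have coord_nz: "coord n \<noteq> (0 :: 'a mpoly)" by (simp add: coord_n mvar_nonzero)
  have erase_n: "mpoly_subst (mvar(n := 0)) (coord n) = (0 :: 'a mpoly)"
    unfolding coord_n mpoly_subst_prod using st_le[of n] by (intro prod_zero) auto
  have erase: "mpoly_subst (mvar(n := 0)) (coord i) = (b'.coord i :: 'a mpoly)" if i: "i < n" for i
  proof -
    have "{st i..<en i} - {n} = {st i..<en' i}" using en_le[of i] i by (auto simp: en'_def)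
    thus ?thesis by (simp add: coord_def b'.coord_def esym_erase)
  qed
  have ind: "p \<in> mpolys (Suc n) \<Longrightarrow> ev p = 0 \<Longrightarrow> \<forall>m\<in>keys p. lookup m n < d \<Longrightarrow> p = 0" for d and p :: "'a mpoly"
  proof (induction d arbitrary: p)
    case 0
    thus ?case by (metis all_not_in_conv keys_eq_empty not_less0)
  next
    case (Suc d)
    define p0 where "p0 = (\<Sum>m\<in>{m\<in>keys p. lookup m n = 0}. Poly_Mapping.single m (lookup p m))"
    define p1 where "p1 = (\<Sum>m\<in>{m\<in>keys p. lookup m n \<noteq> 0}.
      Poly_Mapping.single (m - Poly_Mapping.single n 1) (lookup p m))"
    have shift: "m - Poly_Mapping.single n 1 + Poly_Mapping.single n 1 = m" if "lookup m n \<noteq> 0" for m :: "nat \<Rightarrow>\<^sub>0 nat"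
      using that by (intro poly_mapping_eqI) (auto simp: lookup_add lookup_minus lookup_single when_def)
    have "p1 * ?z = (\<Sum>m\<in>{m\<in>keys p. lookup m n \<noteq> 0}. Poly_Mapping.single m (lookup p m))"
      unfolding p1_def sum_distrib_right single_mult_mvar by (intro sum.cong refl) (simp add: shift[simplified])
    hence "p0 + p1 * ?z = (\<Sum>m\<in>{m\<in>keys p. lookup m n = 0} \<union> {m\<in>keys p. lookup m n \<noteq> 0}. Poly_Mapping.single m (lookup p m))"
      unfolding p0_def by (subst sum.union_disjoint) auto
    also have "{m\<in>keys p. lookup m n = 0} \<union> {m\<in>keys p. lookup m n \<noteq> 0} = keys p" by blast
    finally have p: "p = p0 + p1 * ?z" by (simp only: mpoly_sum_monomials)
    have km: "keys m \<subseteq> {..<Suc n}" if "m \<in> keys p" for m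
      using that Suc.prems(1) by (auto simp: mpolys_def)
    have p0: "p0 \<in> mpolys n"
      unfolding p0_def
    proof (intro mpolys_sum mpolys_single)
      fix m assume "m \<in> {m\<in>keys p. lookup m n = 0}"
      hence "n \<notin> keys m" "keys m \<subseteq> {..<Suc n}" using km[of m] by (auto simp: in_keys_iff)
      thus "keys m \<subseteq> {..<n}" by (auto simp: lessThan_Suc)
    qed
    have p1: "p1 \<in> mpolys (Suc n)"
      unfolding p1_def
    proof (intro mpolys_sum mpolys_single)
      fix m assume "m \<in> {m\<in>keys p. lookup m n \<noteq> 0}"
      thus "keys (m - Poly_Mapping.single n 1) \<subseteq> {..<Suc n}"
        using km[of m] by (fastforce simp: in_keys_iff lookup_minus subset_iff)
    qed
    have "0 = mpoly_subst (mvar(n := 0)) (ev p)" using Suc.prems by simp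
    also have "\<dots> = mpoly_subst (mvar(n := 0)) (ev p0)"
      by (subst p) (simp add: mpoly_subst_add mpoly_subst_mult erase_n)
    also have "\<dots> = b'.ev p0"
      unfolding ev_def b'.ev_def mpoly_subst_subst by (rule mpoly_subst_cong[OF p0 erase])
    finally have "p0 = 0" using Suc.IH p0 bl' \<open>\<And>en p. blocks n st en \<Longrightarrow> p \<in> mpolys n \<Longrightarrow> blocks.ev st en p = 0 \<Longrightarrow> p = 0\<close> by metis
    hence pz: "p = p1 * ?z" using p by simp
    have "ev p1 * coord n = 0" using Suc.prems(2) unfolding pz by simp
    hence "ev p1 = 0" using coord_nz by simp
    moreover have "\<forall>m\<in>keys p1. lookup m n < d"
    proof
      fix m assume "m \<in> keys p1"
      hence "lookup p (m + Poly_Mapping.single n 1) \<noteq> 0"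
        unfolding pz by (simp add: lookup_mult_mvar lookup_add in_keys_iff)
      hence "lookup (m + Poly_Mapping.single n 1) n < Suc d" using Suc.prems(3) by (simp add: in_keys_iff)
      thus "lookup m n < d" by (simp add: lookup_add)
    qed
    ultimately have "p1 = 0" using Suc.IH p1 by blast
    thus ?case using pz by simp
  qed
  define d where "d = Suc (Max ((\<lambda>m. lookup m n) ` keys p))"
  have "\<forall>m\<in>keys p. lookup m n < d" by (auto simp: d_def less_Suc_eq_le)
  from ind[OF Suc.prems(2,3) this] show ?case .
qed

context blocks
begin

lemma ev_inj: "inj_on ev (mpolys n :: 'a::field mpoly set)"
proof (rule inj_onI)
  fix p q :: "'a mpoly" assume pq: "p \<in> mpolys n" "q \<in> mpolys n" "ev p = ev q"
  have "ev (p - q) = 0" using pq(3) ev_simps(1)[of "p - q" q] by simp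
  hence "p - q = 0"
    using block_coords_independent[OF blocks_axioms mpolys_diff[OF pq(1,2)]] by simp
  thus "p = q" by simp
qed

section \<open>Symmetrization\<close>

text \<open>
  Expanding \<open>q\<close> over the block-symmetric polynomials, only the coefficient of the staircase
  monomial survives antisymmetrization: all other monomials of the box have a repeated exponent.
\<close>

lemma symmetrize_ex:
  fixes q :: "'a::field mpoly"
  assumes two: "(2::'a) \<noteq> 0" and q: "q \<in> mpolys n"
  shows "\<exists>p\<in>mpolys n. Alt young q = ev p * disc \<and>
    (\<forall>r\<in>mpolys n. coeff_functional n (ev r * q) = coeff_functional n (ev r * ev p * xmon stair))"
proof -
  obtain c where c: "\<And>a. c a \<in> mpolys n" "q = (\<Sum>a\<in>boxed n. ev (c a) * xmon a)"
    using block_symmetric_span[OF q] by blast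
  have fin: "finite (boxed n)" by (rule finite_boxed) simp
  have rep: "\<not> block_inj a" if "a \<in> boxed n - {stair}" for a using that boxed_block_inj by blast
  have inv: "act \<sigma> (ev (c a)) = ev (c a)" if "\<sigma> \<in> young" for \<sigma> a using act_ev[OF that c(1)] .
  have "Alt young q = (\<Sum>a\<in>boxed n. ev (c a) * Alt young (xmon a))"
    unfolding c(2) Alt_sum by (intro sum.cong refl Alt_invariant_mult inv)
  also have "\<dots> = ev (c stair) * disc"
    unfolding disc_def using rep Alt_young_repeat[OF two]
    by (subst sum.remove[OF fin stair_boxed]) (simp add: sum.neutral)
  finally have 1: "Alt young q = ev (c stair) * disc" .
  have 2: "coeff_functional n (ev r * q) = coeff_functional n (ev r * ev (c stair) * xmon stair)"
    if r: "r \<in> mpolys n" for r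
  proof -
    have "coeff_functional n (ev r * (ev (c a) * xmon a)) = 0" if a: "a \<in> boxed n - {stair}" for a
    proof -
      obtain i j where ij: "i < n" "j < n" "i \<noteq> j" "st i = st j" "lookup a i = lookup a j"
        using rep[OF a] by (auto simp: block_inj_def)
      show ?thesis
        by (rule coeff_functional_swap[OF two ij(1-3)])
          (simp add: act_simps act_ev[OF transpose_young[OF ij(1,2,4)]] r c(1) act_transpose_xmon[OF ij(5)])
    qed
    hence "(\<Sum>a\<in>boxed n. coeff_functional n (ev r * (ev (c a) * xmon a)))
        = coeff_functional n (ev r * (ev (c stair) * xmon stair))"
      by (subst sum.remove[OF fin stair_boxed]) (simp add: sum.neutral)
    thus ?thesis unfolding c(2) sum_distrib_left coeff_functional_sum by (simp add: mult.assoc)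
  qed
  show ?thesis using 1 2 c(1) by blast
qed

text \<open>
  Division of the antisymmetrization by the Vandermonde determinants, expressed in the block
  coordinates.  The last clause of the choice says that this does not affect the coefficient
  functional, as long as the staircase monomial of the blocks is put back.
\<close>

definition symm :: "'a::field mpoly \<Rightarrow> 'a mpoly" where
  "symm q = (SOME p. p \<in> mpolys n \<and> Alt young q = ev p * disc \<and>
    (\<forall>r\<in>mpolys n. coeff_functional n (ev r * q) = coeff_functional n (ev r * ev p * xmon stair)))"

context
  fixes q :: "'a::field mpoly"
  assumes two: "(2::'a) \<noteq> 0" and q: "q \<in> mpolys n"
begin

lemma symm_props: "symm q \<in> mpolys n \<and> Alt young q = ev (symm q) * disc \<and>
    (\<forall>r\<in>mpolys n. coeff_functional n (ev r * q) = coeff_functional n (ev r * ev (symm q) * xmon stair))"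
  unfolding symm_def by (rule someI_ex) (use symmetrize_ex[OF two q] in blast)

lemma symm_mpolys: "symm q \<in> mpolys n"
  and Alt_symm: "Alt young q = ev (symm q) * disc"
  and coeff_functional_symm: "r \<in> mpolys n \<Longrightarrow>
    coeff_functional n (ev r * q) = coeff_functional n (ev r * ev (symm q) * xmon stair)"
  using symm_props by blast+

lemma symm_unique:
  assumes "p \<in> mpolys n" "Alt young q = ev p * disc" shows "symm q = p"
proof -
  have "ev (symm q) = ev p" using assms Alt_symm disc_nonzero[where 'a = 'a] by simp
  thus ?thesis using ev_inj symm_mpolys assms(1) by (auto dest: inj_onD)
qed

end

lemma stair_mpolys: "xmon stair \<in> mpolys n"
  unfolding stair_def by (intro xmon_mpolys keys_expo)

text \<open>
  The symmetrization of a block-symmetric \<open>q\<close> times the staircase monomial is \<open>q\<close> itself.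
\<close>

lemma block_symmetric_ev:
  fixes q :: "'a::field mpoly"
  assumes two: "(2::'a) \<noteq> 0" and q: "q \<in> mpolys n" and inv: "\<And>\<sigma>. \<sigma> \<in> young \<Longrightarrow> act \<sigma> q = q"
  shows "\<exists>p\<in>mpolys n. q = ev p"
proof -
  have m: "q * xmon stair \<in> mpolys n" using q stair_mpolys by (rule mpolys_mult)
  have "q * disc = ev (symm (q * xmon stair)) * disc"
    using Alt_symm[OF two m] Alt_invariant_mult[OF inv, of young "xmon stair"] by (simp add: disc_def)
  thus ?thesis using disc_nonzero[where 'a = 'a] symm_mpolys[OF two m] by auto
qed

end

section \<open>Reversing exponents\<close>

text \<open>
  The polynomial \<open>x\<^sup>c p(1/x)\<close>, for an exponent \<open>c\<close> that bounds all exponents of \<open>p\<close>.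
\<close>

definition revp :: "(nat \<Rightarrow>\<^sub>0 nat) \<Rightarrow> 'a::field mpoly \<Rightarrow> 'a mpoly" where
  "revp c p = (\<Sum>m\<in>keys p. mconst (lookup p m) * xmon (c - m))"

definition expo_le :: "(nat \<Rightarrow>\<^sub>0 nat) \<Rightarrow> (nat \<Rightarrow>\<^sub>0 nat) \<Rightarrow> bool" where
  "expo_le a b \<longleftrightarrow> (\<forall>i. lookup a i \<le> lookup b i)"

lemma expo_le_add_diff: "expo_le a b \<Longrightarrow> a + (b - a) = b"
  by (rule poly_mapping_eqI) (simp add: expo_le_def lookup_add lookup_minus)

lemma expo_le_iff: "expo_le a b \<longleftrightarrow> (\<exists>k. b = k + a)"
proof
  show "expo_le a b \<Longrightarrow> \<exists>k. b = k + a" using expo_le_add_diff[of a b] by (metis add.commute)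
qed (auto simp: expo_le_def lookup_add)

lemma revp_superset:
  assumes "finite S" "keys p \<subseteq> S"
  shows "revp c p = (\<Sum>m\<in>S. mconst (lookup p m) * xmon (c - m))"
  unfolding revp_def
  by (rule sum.mono_neutral_left) (use assms in \<open>auto simp: in_keys_iff\<close>)

lemma revp_add: "revp c (p + q) = revp c p + revp c q"
proof -
  let ?S = "keys p \<union> keys q"
  have "keys (p + q) \<subseteq> ?S" by (rule Poly_Mapping.keys_add)
  thus ?thesis by (simp add: revp_superset[of ?S] lookup_add distrib_right sum.distrib)
qed

lemma revp_sum: "revp c (sum h X) = (\<Sum>x\<in>X. revp c (h x))"
  by (induction X rule: infinite_finite_induct) (simp_all add: revp_add, simp_all add: revp_def)

lemma revp_mono: "revp c (mconst u * xmon m) = mconst u * xmon (c - m)"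
proof -
  have "revp c (mconst u * xmon m) = (\<Sum>k\<in>{m}. mconst (lookup (mconst u * xmon m) k) * xmon (c - k))"
    by (rule revp_superset) (auto simp: mconst_xmon)
  thus ?thesis by (simp add: lookup_xmon)
qed

lemma revp_mult:
  assumes "\<And>m. m \<in> keys p \<Longrightarrow> expo_le m c" "\<And>m. m \<in> keys q \<Longrightarrow> expo_le m d"
  shows "revp (c + d) (p * q) = revp c p * revp d q"
proof -
  have "p * q = (\<Sum>m\<in>keys p. \<Sum>k\<in>keys q. mconst (lookup p m * lookup q k) * xmon (m + k))"
    by (subst mpoly_expand[of p], subst mpoly_expand[of q]) (simp add: sum_product xmon_add mult_ac)
  hence "revp (c + d) (p * q)
      = (\<Sum>m\<in>keys p. \<Sum>k\<in>keys q. mconst (lookup p m * lookup q k) * xmon (c + d - (m + k)))"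
    by (simp only: revp_sum revp_mono)
  also have "\<dots> = (\<Sum>m\<in>keys p. \<Sum>k\<in>keys q.
      (mconst (lookup p m) * xmon (c - m)) * (mconst (lookup q k) * xmon (d - k)))"
  proof (intro sum.cong refl)
    fix m k assume "m \<in> keys p" "k \<in> keys q"
    hence "expo_le m c" "expo_le k d" using assms by auto
    hence "c + d - (m + k) = (c - m) + (d - k)"
      by (intro poly_mapping_eqI) (simp add: expo_le_def lookup_add lookup_minus)
    thus "mconst (lookup p m * lookup q k) * xmon (c + d - (m + k))
        = (mconst (lookup p m) * xmon (c - m)) * (mconst (lookup q k) * xmon (d - k))"
      by (simp add: xmon_add mult_ac)
  qed
  finally show ?thesis by (simp add: revp_def sum_product)
qed

lemma lookup_revp:
  assumes "\<And>k. k \<in> keys p \<Longrightarrow> expo_le k c" "expo_le m c"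
  shows "lookup (revp c p) (c - m) = lookup p m"
proof -
  have "lookup (revp c p) (c - m) = (\<Sum>k\<in>keys p. if k = m then lookup p k else 0)"
    unfolding revp_def lookup_sum
  proof (intro sum.cong refl)
    fix k assume "k \<in> keys p"
    hence "expo_le k c" using assms by blast
    have "c - m = c - k \<longleftrightarrow> k = m"
    proof
      assume e: "c - m = c - k"
      show "k = m"
      proof (rule poly_mapping_eqI)
        fix i
        have "lookup c i - lookup m i = lookup c i - lookup k i" using e by (metis lookup_minus)
        thus "lookup k i = lookup m i" using \<open>expo_le k c\<close> assms(2) unfolding expo_le_def
          by (metis diff_diff_cancel)
      qed
    qed simp
    thus "lookup (mconst (lookup p k) * xmon (c - k)) (c - m) = (if k = m then lookup p k else 0)"
      by (simp add: lookup_xmon)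
  qed
  thus ?thesis by (simp add: in_keys_iff)
qed

text \<open>
  The products of distinct homogeneous components of \<open>f\<close> with \<open>g\<close> have distinct weights and thus
  cannot cancel.
\<close>

lemma homogeneous_factor:
  fixes f g :: "'a::field mpoly" and wt :: "(nat \<Rightarrow>\<^sub>0 nat) \<Rightarrow> nat"
  assumes wt: "\<And>a b. wt (a + b) = wt a + wt b" and g: "g \<noteq> 0" "\<And>m. m \<in> keys g \<Longrightarrow> wt m = e"
    and fg: "\<And>m. m \<in> keys (f * g) \<Longrightarrow> wt m = d" and m: "m \<in> keys f"
  shows "wt m + e = d"
proof -
  define f1 where "f1 = (\<Sum>k\<in>{k\<in>keys f. wt k = wt m}. Poly_Mapping.single k (lookup f k))"
  define f2 where "f2 = (\<Sum>k\<in>{k\<in>keys f. wt k \<noteq> wt m}. Poly_Mapping.single k (lookup f k))"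
  have "f1 + f2 = (\<Sum>k\<in>{k\<in>keys f. wt k = wt m} \<union> {k\<in>keys f. wt k \<noteq> wt m}. Poly_Mapping.single k (lookup f k))"
    unfolding f1_def f2_def by (subst sum.union_disjoint) auto
  also have "{k\<in>keys f. wt k = wt m} \<union> {k\<in>keys f. wt k \<noteq> wt m} = keys f" by blast
  finally have f: "f = f1 + f2" by (simp only: mpoly_sum_monomials)
  have l1: "lookup f1 k = (if wt k = wt m then lookup f k else 0)" for k
    unfolding f1_def by (auto simp: lookup_sum lookup_single when_def in_keys_iff)
  have l2: "lookup f2 k = (if wt k \<noteq> wt m then lookup f k else 0)" for k
    unfolding f2_def by (auto simp: lookup_sum lookup_single when_def in_keys_iff)
  have "f1 \<noteq> 0" using l1[of m] m by (auto simp: in_keys_iff)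
  hence "f1 * g \<noteq> 0" using g(1) by simp
  then obtain k where k: "k \<in> keys (f1 * g)" by (metis all_not_in_conv keys_eq_empty)
  then obtain a b where ab: "k = a + b" "a \<in> keys f1" "b \<in> keys g" using keys_mult by blast
  have wk: "wt k = wt m + e" using ab wt g(2) l1[of a] by (auto simp: in_keys_iff split: if_splits)
  have "k \<notin> keys (f2 * g)"
  proof
    assume "k \<in> keys (f2 * g)"
    then obtain a b where ab: "k = a + b" "a \<in> keys f2" "b \<in> keys g" using keys_mult by blast
    thus False using wk wt g(2) l2[of a] by (auto simp: in_keys_iff split: if_splits)
  qed
  hence "k \<in> keys (f * g)" using k unfolding f by (simp add: distrib_right lookup_add in_keys_iff)
  thus ?thesis using fg wk by simp
qed

context blocks
begin

section \<open>Shapes and their complements\<close>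

text \<open>
  Exponents that decrease in each block; within a block, they are \<open>\<lambda> + \<delta>\<close> for a partition \<open>\<lambda>\<close>
  in a box, so that the symmetrizations of the monomials are products of Schur polynomials.
\<close>

definition shapes :: "(nat \<Rightarrow>\<^sub>0 nat) set" where
  "shapes = {w. (\<forall>i\<ge>n. lookup w i = 0) \<and> (\<forall>i<n. lookup w i < n - st i) \<and>
     (\<forall>i<n. \<forall>j<n. st i = st j \<longrightarrow> i < j \<longrightarrow> lookup w j < lookup w i)}"

definition block_rev :: "nat \<Rightarrow> nat" where
  "block_rev i = (if i < n then st i + en i - 1 - i else i)"

text \<open>
  The complement of the partition in its box, block by block.
\<close>

definition compl :: "(nat \<Rightarrow>\<^sub>0 nat) \<Rightarrow> nat \<Rightarrow>\<^sub>0 nat" where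
  "compl w = expo n (\<lambda>i. n - 1 - st i - lookup w (block_rev i))"

text \<open>
  This linear form takes the same value on all rearrangements of an exponent within the blocks, and
  is sensitive to moving entries between the blocks.
\<close>

definition weight :: "(nat \<Rightarrow>\<^sub>0 nat) \<Rightarrow> nat" where
  "weight m = (\<Sum>i<n. st i * lookup m i)"

lemma block_rev_simps:
  assumes "i < n"
  shows "block_rev i < n" "st (block_rev i) = st i" "en (block_rev i) = en i" "block_rev (block_rev i) = i"
proof -
  have r: "block_rev i = st i + en i - 1 - i" using assms by (simp add: block_rev_def)
  have b: "st i \<le> block_rev i" "block_rev i < en i"
    using st_le[OF assms] en_gt[OF assms] by (auto simp: r)
  show *: "block_rev i < n" using b en_le[OF assms] by simp
  show "st (block_rev i) = st i" "en (block_rev i) = en i" using same[OF assms b] by auto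
  thus "block_rev (block_rev i) = i"
    using * st_le[OF assms] en_gt[OF assms] by (simp add: block_rev_def[of "block_rev i"]) (simp add: r)
qed

lemma block_rev_invol: "block_rev (block_rev i) = i"
  by (cases "i < n") (simp add: block_rev_simps, simp add: block_rev_def)

lemma block_rev_young: "block_rev \<in> young"
proof -
  have "bij block_rev" using block_rev_invol by (rule involuntory_imp_bij)
  hence "block_rev permutes {..<n}" by (auto simp: permutes_def block_rev_def bij_iff)
  thus ?thesis by (simp add: young_def block_rev_simps)
qed

lemma lookup_compl [simp]:
  "lookup (compl w) i = (if i < n then n - 1 - st i - lookup w (block_rev i) else 0)"
  by (simp add: compl_def)

lemma shapes_lt: "w \<in> shapes \<Longrightarrow> i < n \<Longrightarrow> lookup w i < n - st i"
  by (simp add: shapes_def)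

lemma shapes_decreasing:
  "w \<in> shapes \<Longrightarrow> i < n \<Longrightarrow> j < n \<Longrightarrow> st i = st j \<Longrightarrow> i < j \<Longrightarrow> lookup w j < lookup w i"
  by (simp add: shapes_def)

lemma shapes_block_inj: "w \<in> shapes \<Longrightarrow> block_inj w"
  unfolding block_inj_def using shapes_decreasing by (metis less_irrefl linorder_neqE_nat)

lemma compl_shapes:
  assumes "w \<in> shapes" shows "compl w \<in> shapes"
  unfolding shapes_def
proof (intro CollectI conjI allI impI)
  fix i assume i: "i < n"
  thus "lookup (compl w) i < n - st i" using st_le[OF i] by simp
next
  fix i j assume ij: "i < n" "j < n" "st i = st j" "i < j"
  have "en i = en j" using st_eq_en_eq ij by metis
  hence "block_rev j < block_rev i"
    using ij en_gt[OF ij(2)] st_le[OF ij(1)] by (simp add: block_rev_def)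
  hence "lookup w (block_rev i) < lookup w (block_rev j)"
    using ij by (intro shapes_decreasing[OF assms]) (simp_all add: block_rev_simps)
  moreover have "lookup w (block_rev j) < n - st j"
    using shapes_lt[OF assms, of "block_rev j"] ij by (simp add: block_rev_simps)
  ultimately show "lookup (compl w) j < lookup (compl w) i" using ij by simp
qed simp

lemma compl_compl:
  assumes "w \<in> shapes" shows "compl (compl w) = w"
proof (rule poly_mapping_eqI)
  fix i
  show "lookup (compl (compl w)) i = lookup w i"
    using assms shapes_lt[OF assms, of i]
    by (cases "i < n") (auto simp: block_rev_simps shapes_def)
qed

lemma weight_add: "weight (a + b) = weight a + weight b"
  by (simp add: weight_def lookup_add distrib_left sum.distrib)

lemma weight_map_key:
  assumes "\<sigma> \<in> young" shows "weight (Poly_Mapping.map_key \<sigma> m) = weight m"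
proof -
  have "weight (Poly_Mapping.map_key \<sigma> m) = (\<Sum>i<n. st (\<sigma> i) * lookup m (\<sigma> i))"
    using assms unfolding weight_def by (intro sum.cong refl) (simp add: lookup_map_key young_bij young_def)
  also have "\<dots> = weight m"
    unfolding weight_def using permutes_imp_bij[OF young_permutes[OF assms]]
    by (rule sum.reindex_bij_betw)
  finally show ?thesis .
qed

lemma stair_shapes: "stair \<in> shapes"
  unfolding shapes_def
proof (intro CollectI conjI allI impI)
  fix i assume i: "i < n"
  thus "lookup stair i < n - st i" using st_le[OF i] en_gt[OF i] en_le[OF i] by simp
next
  fix i j assume ij: "i < n" "j < n" "st i = st j" "i < j"
  have "en i = en j" using st_eq_en_eq ij by metis
  thus "lookup stair j < lookup stair i" using ij en_gt[OF ij(2)] by simp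
qed simp

lemma weight_compl:
  assumes "w \<in> shapes" shows "weight w + weight (compl w) = (\<Sum>i<n. st i * (n - 1 - st i))"
proof -
  have "weight w = weight (Poly_Mapping.map_key block_rev w)"
    using weight_map_key[OF block_rev_young] by simp
  also have "\<dots> = (\<Sum>i<n. st i * lookup w (block_rev i))"
    unfolding weight_def by (intro sum.cong refl) (simp add: lookup_map_key young_bij[OF block_rev_young])
  finally have "weight w + weight (compl w)
      = (\<Sum>i<n. st i * (lookup w (block_rev i) + (n - 1 - st i - lookup w (block_rev i))))"
    by (simp add: weight_def distrib_left sum.distrib)
  also have "\<dots> = (\<Sum>i<n. st i * (n - 1 - st i))"
  proof (intro sum.cong refl)
    fix i assume "i \<in> {..<n}"
    hence "lookup w (block_rev i) \<le> n - 1 - st i"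
      using shapes_lt[OF assms, of "block_rev i"] by (simp add: block_rev_simps)
    hence "lookup w (block_rev i) + (n - 1 - st i - lookup w (block_rev i)) = n - 1 - st i"
      by (rule le_add_diff_inverse)
    thus "st i * (lookup w (block_rev i) + (n - 1 - st i - lookup w (block_rev i))) = st i * (n - 1 - st i)"
      by (rule arg_cong)
  qed
  finally show ?thesis .
qed

definition top :: "nat \<Rightarrow>\<^sub>0 nat" where
  "top = expo n (\<lambda>i. n - 1 - i)"

lemma compl_stair: "compl stair = top"
proof (rule poly_mapping_eqI)
  fix i
  show "lookup (compl stair) i = lookup top i"
  proof (cases "i < n")
    case True
    have "en (block_rev i) - 1 - block_rev i = i - st i"
      using block_rev_simps(3)[OF True] st_le[OF True] en_gt[OF True] True
      by (simp add: block_rev_def)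
    thus ?thesis using True st_le[OF True] by (simp add: block_rev_simps top_def)
  qed (simp add: top_def)
qed

text \<open>
  The weight, doubled and shifted so that taking complements changes its sign.
\<close>

definition score :: "(nat \<Rightarrow>\<^sub>0 nat) \<Rightarrow> int" where
  "score w = 2 * int (weight w) - int (weight stair + weight top)"

lemma score_compl: "w \<in> shapes \<Longrightarrow> score (compl w) = - score w"
proof -
  assume "w \<in> shapes"
  hence "weight w + weight (compl w) = weight stair + weight top"
    using weight_compl weight_compl[OF stair_shapes] unfolding compl_stair by metis
  thus ?thesis unfolding score_def by linarith
qed

text \<open>
  The block starts increase while the entries of \<open>top\<close> decrease.  The partial sums \<open>F\<close> of the block
  starts are convex, so every \<open>\<Delta> i\<close> is nonnegative, and it vanishes only if the block starts are
  constant between \<open>i\<close> and \<open>\<sigma> i\<close>, apart possibly from \<open>st (\<sigma> i)\<close> itself.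
\<close>

lemma weight_top_permuted:
  assumes s: "\<sigma> permutes {..<n}"
  shows "weight top \<le> weight (Poly_Mapping.map_key \<sigma> top)"
    and "weight (Poly_Mapping.map_key \<sigma> top) = weight top \<Longrightarrow> \<sigma> \<in> young"
proof -
  have lt: "\<sigma> i < n" if "i < n" for i using permutes_in_image[OF s, of i] that by simp
  define F where "F j = (\<Sum>l<j. int (st l))" for j
  define \<Delta> where "\<Delta> i = F (\<sigma> i) - F i - int (st i) * (int (\<sigma> i) - int i)" for i
  have F_split: "F b = F a + (\<Sum>l\<in>{a..<b}. int (st l))" if "a \<le> b" for a b
    unfolding F_def using that by (metis lessThan_atLeast0 sum.atLeastLessThan_concat zero_le)
  have D: "\<Delta> i = (if i \<le> \<sigma> i then \<Sum>l\<in>{i..<\<sigma> i}. int (st l) - int (st i)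
      else \<Sum>l\<in>{\<sigma> i..<i}. int (st i) - int (st l))" for i
    using F_split[of i "\<sigma> i"] F_split[of "\<sigma> i" i] by (auto simp: \<Delta>_def sum_subtractf algebra_simps)
  have D0: "\<Delta> i \<ge> 0" if "i < n" for i
    unfolding D using st_mono[of i] st_mono[of _ i] lt[OF that] that by (auto intro!: sum_nonneg)
  have perm: "(\<Sum>i<n. h (\<sigma> i)) = (\<Sum>i<n. h i)" for h :: "nat \<Rightarrow> int"
    using permutes_imp_bij[OF s] by (rule sum.reindex_bij_betw)
  have "int (weight (Poly_Mapping.map_key \<sigma> top)) - int (weight top)
      = (\<Sum>i<n. int (st i) * (int i - int (\<sigma> i)))"
    unfolding weight_def of_nat_sum sum_subtractf[symmetric]
  proof (intro sum.cong refl)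
    fix i assume "i \<in> {..<n}"
    hence i: "i < n" by simp
    have "int (n - 1 - j) = int n - 1 - int j" if "j < n" for j using that by linarith
    thus "int (st i * lookup (Poly_Mapping.map_key \<sigma> top) i) - int (st i * lookup top i)
        = int (st i) * (int i - int (\<sigma> i))"
      using i lt[OF i]
      by (simp only: lookup_map_key permutes_bij[OF s] top_def lookup_expo if_True of_nat_mult)
         (simp add: algebra_simps)
  qed
  also have "\<dots> = (\<Sum>i<n. \<Delta> i)"
    using perm[of F] by (simp add: \<Delta>_def sum_subtractf sum.distrib right_diff_distrib)
  finally have eq: "int (weight (Poly_Mapping.map_key \<sigma> top)) - int (weight top) = (\<Sum>i<n. \<Delta> i)" .
  moreover have "(\<Sum>i<n. \<Delta> i) \<ge> 0" using D0 by (intro sum_nonneg) auto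
  ultimately show "weight top \<le> weight (Poly_Mapping.map_key \<sigma> top)" by linarith
  assume "weight (Poly_Mapping.map_key \<sigma> top) = weight top"
  hence "(\<Sum>i<n. \<Delta> i) = 0" using eq by simp
  moreover have "(\<Sum>i<n. \<Delta> i) = 0 \<longleftrightarrow> (\<forall>i\<in>{..<n}. \<Delta> i = 0)"
    using D0 by (intro sum_nonneg_eq_0_iff) auto
  ultimately have z: "\<Delta> i = 0" if "i < n" for i using that by simp
  have ge: "int (st i) \<le> int (st (\<sigma> i))" if i: "i < n" for i
  proof (cases "i \<le> \<sigma> i")
    case True
    thus ?thesis using st_mono lt[OF i] by simp
  next
    case False
    hence "(\<Sum>l\<in>{\<sigma> i..<i}. int (st i) - int (st l)) = 0" using z[OF i] by (simp add: D)
    hence "\<forall>l\<in>{\<sigma> i..<i}. int (st i) - int (st l) = 0"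
      using st_mono[of _ i] i by (subst (asm) sum_nonneg_eq_0_iff) auto
    thus ?thesis using False by force
  qed
  have "(\<Sum>i<n. int (st (\<sigma> i)) - int (st i)) = 0"
    using perm[of "\<lambda>i. int (st i)"] by (simp add: sum_subtractf)
  hence "\<forall>i<n. int (st (\<sigma> i)) - int (st i) = 0"
    using ge by (subst (asm) sum_nonneg_eq_0_iff) auto
  thus "\<sigma> \<in> young" using s by (simp add: young_def)
qed

text \<open>
  The permutation is increasing on each block, and so is its inverse.
\<close>

lemma shapes_rearrangement:
  assumes w: "w \<in> shapes" and v: "v \<in> shapes" and s: "\<sigma> \<in> young" and e: "Poly_Mapping.map_key \<sigma> v = w"
  shows "\<sigma> = id"
proof -
  have up: "i \<le> \<tau> i" if t: "\<tau> \<in> young" and i: "i < n"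
    and mono: "\<And>i j. i < n \<Longrightarrow> j < n \<Longrightarrow> st i = st j \<Longrightarrow> i < j \<Longrightarrow> \<tau> i < \<tau> j" for \<tau> i
    using i
  proof (induction i)
    case (Suc i)
    show ?case
    proof (cases "st (Suc i) = Suc i")
      case True
      have "\<tau> (Suc i) < n" "st (\<tau> (Suc i)) = Suc i"
        using young_lt[OF t Suc.prems] t Suc.prems True by (auto simp: young_def)
      thus ?thesis using st_le[of "\<tau> (Suc i)"] by simp
    next
      case False
      hence "st (Suc i) \<le> i" using st_le[OF Suc.prems] by simp
      hence "st i = st (Suc i)" using same[OF Suc.prems, of i] en_gt[OF Suc.prems] by auto
      thus ?thesis using mono[of i "Suc i"] Suc by simp
    qed
  qed simp
  have ms: "\<sigma> i < \<sigma> j" if ij: "i < n" "j < n" "st i = st j" "i < j" for i j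
  proof -
    have "lookup v (\<sigma> j) < lookup v (\<sigma> i)"
      using shapes_decreasing[OF w ij] lookup_map_key[OF young_bij[OF s], of v] e by metis
    moreover have "st (\<sigma> i) = st (\<sigma> j)" "\<sigma> i < n" "\<sigma> j < n" using s ij young_lt[OF s] by (auto simp: young_def)
    ultimately show ?thesis using shapes_decreasing[OF v, of "\<sigma> j" "\<sigma> i"]
      by (metis less_asym less_irrefl linorder_neqE_nat)
  qed
  let ?r = "Hilbert_Choice.inv \<sigma>"
  have p: "\<sigma> permutes {..<n}" by (rule young_permutes[OF s])
  have r: "?r \<in> young" by (rule young_inv[OF s])
  have mr: "?r i < ?r j" if ij: "i < n" "j < n" "st i = st j" "i < j" for i j
  proof (rule ccontr)
    assume "\<not> ?r i < ?r j"
    moreover have "?r i \<noteq> ?r j" using ij permutes_inverses(1)[OF p] by (metis less_irrefl)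
    ultimately have "?r j < ?r i" by simp
    hence "\<sigma> (?r j) < \<sigma> (?r i)"
      using ij young_lt[OF r] r by (intro ms) (auto simp: young_def)
    thus False using ij permutes_inverses(1)[OF p] by simp
  qed
  show ?thesis
  proof
    fix i
    show "\<sigma> i = id i"
    proof (cases "i < n")
      case True
      have "i \<le> \<sigma> i" by (rule up[OF s True ms])
      moreover have "\<sigma> i \<le> ?r (\<sigma> i)" by (rule up[OF r young_lt[OF s True] mr])
      ultimately show ?thesis using permutes_inverses(2)[OF p, of i] by simp
    qed (use p in \<open>simp add: permutes_def\<close>)
  qed
qed

lemma lookup_Alt_shapes:
  assumes "w \<in> shapes" "v \<in> shapes"
  shows "lookup (Alt young (xmon w) :: 'a::field mpoly) v = (if v = w then 1 else 0)"
proof (cases "v = w")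
  case True
  thus ?thesis using lookup_Alt_xmon_self[OF shapes_block_inj[OF assms(1)]] by simp
next
  case False
  have "Poly_Mapping.map_key \<sigma> v \<noteq> w" if "\<sigma> \<in> young" for \<sigma>
  proof
    assume e: "Poly_Mapping.map_key \<sigma> v = w"
    hence "\<sigma> = id" using shapes_rearrangement[OF assms that] by blast
    hence "Poly_Mapping.map_key \<sigma> v = v" by (intro poly_mapping_eqI) (simp add: lookup_map_key)
    thus False using e False by simp
  qed
  thus ?thesis using False by (simp add: lookup_Alt_xmon)
qed

section \<open>Duality of Schur polynomials under complements\<close>

text \<open>
  The largest partition in the box of each block; it bounds the exponents of the Schur polynomials.
\<close>

definition rect :: "nat \<Rightarrow>\<^sub>0 nat" where
  "rect = expo n (\<lambda>i. n - en i)"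

text \<open>
  The degree of the block Vandermonde determinants in each variable.
\<close>

definition spread :: "nat \<Rightarrow>\<^sub>0 nat" where
  "spread = expo n (\<lambda>i. en i - 1 - st i)"

lemma Alt_xmon_sum:
  "Alt young (xmon a) = (\<Sum>\<sigma>\<in>young. of_int (sign \<sigma>) * xmon (Poly_Mapping.map_key \<sigma> a) :: 'a::field mpoly)"
proof -
  have b: "bij_betw Hilbert_Choice.inv young young"
    by (rule bij_betw_byWitness[where f' = Hilbert_Choice.inv])
       (auto simp: young_inv inv_inv_eq young_bij)
  have "Alt young (xmon a)
      = (\<Sum>\<sigma>\<in>young. of_int (sign (Hilbert_Choice.inv \<sigma>)) * act (Hilbert_Choice.inv \<sigma>) (xmon a) :: 'a mpoly)"
    unfolding Alt_def by (rule sum.reindex_bij_betw[OF b, symmetric])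
  also have "\<dots> = (\<Sum>\<sigma>\<in>young. of_int (sign \<sigma>) * xmon (Poly_Mapping.map_key \<sigma> a))"
  proof (intro sum.cong refl)
    fix \<sigma> assume s: "\<sigma> \<in> young"
    have bij: "bij \<sigma>" by (rule young_bij[OF s])
    have "permutation \<sigma>" using young_permutes[OF s] by (auto intro: permutes_imp_permutation)
    hence "sign (Hilbert_Choice.inv \<sigma>) = sign \<sigma>" by (rule sign_inverse)
    moreover have "act (Hilbert_Choice.inv \<sigma>) (xmon a) = (xmon (Poly_Mapping.map_key \<sigma> a) :: 'a mpoly)"
      using act_xmon[OF bij_imp_bij_inv[OF bij], of "Poly_Mapping.map_key \<sigma> a", where 'a = 'a]
        map_key_inv(2)[OF bij, of a] by simp
    ultimately show "of_int (sign (Hilbert_Choice.inv \<sigma>)) * act (Hilbert_Choice.inv \<sigma>) (xmon a)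
      = (of_int (sign \<sigma>) * xmon (Poly_Mapping.map_key \<sigma> a) :: 'a mpoly)" by simp
  qed
  finally show ?thesis .
qed

text \<open>Reversing all exponents of an alternant gives, up to the sign of the block reversal, another alternant.\<close>

lemma revp_Alt:
  assumes c: "\<And>\<sigma>. \<sigma> \<in> young \<Longrightarrow> Poly_Mapping.map_key \<sigma> c = c"
    and b: "\<And>i. lookup b i = lookup c i - lookup a (block_rev i)"
  shows "revp c (Alt young (xmon a)) = of_int (sign block_rev) * (Alt young (xmon b) :: 'a::field mpoly)"
proof -
  have "revp c (Alt young (xmon a)) = (\<Sum>\<sigma>\<in>young. of_int (sign \<sigma>) * xmon (c - Poly_Mapping.map_key \<sigma> a) :: 'a mpoly)"
    unfolding Alt_xmon_sum mconst_of_int by (simp only: revp_sum revp_mono)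
  also have "\<dots> = (\<Sum>\<sigma>\<in>young. of_int (sign \<sigma>) * xmon (Poly_Mapping.map_key \<sigma> (Poly_Mapping.map_key block_rev b)))"
  proof (intro sum.cong refl)
    fix \<sigma> assume s: "\<sigma> \<in> young"
    have "c - Poly_Mapping.map_key \<sigma> a = Poly_Mapping.map_key \<sigma> (Poly_Mapping.map_key block_rev b)"
    proof (rule poly_mapping_eqI)
      fix i
      have "lookup c (\<sigma> i) = lookup c i" using lookup_map_key[OF young_bij[OF s], of c i] c[OF s] by simp
      moreover have "lookup c (block_rev (\<sigma> i)) = lookup c (\<sigma> i)"
        using lookup_map_key[OF young_bij[OF block_rev_young], of c] c[OF block_rev_young] by metis
      ultimately show "lookup (c - Poly_Mapping.map_key \<sigma> a) i
          = lookup (Poly_Mapping.map_key \<sigma> (Poly_Mapping.map_key block_rev b)) i"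
        by (simp add: lookup_minus lookup_map_key young_bij[OF s] young_bij[OF block_rev_young] b block_rev_invol)
    qed
    thus "of_int (sign \<sigma>) * xmon (c - Poly_Mapping.map_key \<sigma> a)
        = (of_int (sign \<sigma>) * xmon (Poly_Mapping.map_key \<sigma> (Poly_Mapping.map_key block_rev b)) :: 'a mpoly)"
      by simp
  qed
  also have "\<dots> = Alt young (xmon (Poly_Mapping.map_key block_rev b))"
    by (rule Alt_xmon_sum[symmetric])
  also have "\<dots> = Alt young (act (Hilbert_Choice.inv block_rev) (xmon b))"
    using act_xmon[OF bij_imp_bij_inv[OF young_bij[OF block_rev_young]],
        of "Poly_Mapping.map_key block_rev b", where 'a = 'a]
      map_key_inv(2)[OF young_bij[OF block_rev_young], of b] by simp
  also have "\<dots> = of_int (sign (Hilbert_Choice.inv block_rev)) * Alt young (xmon b)"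
    by (rule Alt_young_act[OF young_inv[OF block_rev_young]])
  also have "sign (Hilbert_Choice.inv block_rev) = sign block_rev"
    using young_permutes[OF block_rev_young] by (intro sign_inverse permutes_imp_permutation) auto
  finally show ?thesis .
qed

lemma young_const_fixed:
  assumes "\<And>i j. i < n \<Longrightarrow> j < n \<Longrightarrow> st i = st j \<Longrightarrow> h i = h j" "\<sigma> \<in> young"
  shows "Poly_Mapping.map_key \<sigma> (expo n h) = expo n h"
proof (rule poly_mapping_eqI)
  fix i
  have "\<sigma> i < n \<longleftrightarrow> i < n" using permutes_in_image[OF young_permutes[OF assms(2)], of i] by simp
  moreover have "h (\<sigma> i) = h i" if "i < n"
    using assms(1)[of "\<sigma> i" i] that young_lt[OF assms(2) that] assms(2) by (auto simp: young_def)
  ultimately show "lookup (Poly_Mapping.map_key \<sigma> (expo n h)) i = lookup (expo n h) i"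
    by (simp add: lookup_map_key[OF young_bij[OF assms(2)]])
qed

definition schur :: "(nat \<Rightarrow>\<^sub>0 nat) \<Rightarrow> 'a::field mpoly" where
  "schur w = symm (xmon w)"

text \<open>
  The functional behind the bilinear form on the local algebra.  The factor \<open>xmon stair\<close> undoes a
  symmetrization over the blocks (\<open>coeff_functional_symm\<close>), so that a Schur polynomial in the
  argument may be replaced by its monomial.
\<close>

definition pairing :: "'a::field mpoly \<Rightarrow> 'a" where
  "pairing p = coeff_functional n (ev p * xmon stair)"

lemma shapes_keys: "w \<in> shapes \<Longrightarrow> keys w \<subseteq> {..<n}"
  by (auto simp: shapes_def in_keys_iff not_less[symmetric])

lemma shapes_xmon: "w \<in> shapes \<Longrightarrow> xmon w \<in> mpolys n"
  by (intro xmon_mpolys shapes_keys)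

end

section \<open>The quotient map in coordinates\<close>

locale block_quotient = blocks n st en for n and st en :: "nat \<Rightarrow> nat" +
  fixes f :: "nat \<Rightarrow> 'a::field mpoly"
  assumes char2: "CHAR('a) \<noteq> 2"
    and f_mpolys: "\<And>i. i < n \<Longrightarrow> f i \<in> mpolys n"
    and ev_f: "\<And>i. i < n \<Longrightarrow> ev (f i) = esym {..<n} (Suc i)"
begin

lemma two: "(2::'a) \<noteq> 0"
  by (rule two_nonzero[OF char2])

lemma schur_mpolys: "w \<in> shapes \<Longrightarrow> (schur w :: 'a mpoly) \<in> mpolys n"
  unfolding schur_def by (rule symm_mpolys[OF two shapes_xmon])

lemma schur_disc: "w \<in> shapes \<Longrightarrow> ev (schur w :: 'a mpoly) * disc = Alt young (xmon w)"
  unfolding schur_def by (rule Alt_symm[OF two shapes_xmon, symmetric])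

text \<open>
  Alternants are homogeneous for the weight, and the Schur polynomial is their quotient.
\<close>

lemma weight_schur:
  assumes "w \<in> shapes" "m \<in> keys (ev (schur w :: 'a mpoly))"
  shows "weight m + weight stair = weight w"
proof (rule homogeneous_factor[of weight "disc :: 'a mpoly" _ "ev (schur w)"])
  have alt: "weight m = weight a" if "m \<in> keys (Alt young (xmon a) :: 'a mpoly)" for m a
    using keys_Alt_xmon[OF that] weight_map_key by metis
  show "weight m = weight stair" if "m \<in> keys (disc :: 'a mpoly)" for m
    using alt that unfolding disc_def by blast
  show "weight m = weight w" if "m \<in> keys (ev (schur w) * disc :: 'a mpoly)" for m
    using alt that unfolding schur_disc[OF assms(1)] by blast
qed (use assms weight_add disc_nonzero in auto)

text \<open>
  Inverting the variables turns the quotient of alternants for \<open>w\<close> into the one for \<open>compl w\<close>, up to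
  a monomial.
\<close>

lemma schur_compl:
  assumes w: "w \<in> shapes" and m: "m \<in> keys (ev (schur w :: 'a mpoly))"
  shows "expo_le m rect" "lookup (ev (schur (compl w)) :: 'a mpoly) (rect - m) = lookup (ev (schur w)) m"
proof -
  let ?f = "ev (schur w) :: 'a mpoly" and ?g = "ev (schur (compl w)) :: 'a mpoly"
  let ?s = "of_int (sign block_rev) :: 'a mpoly"
  \<comment> \<open>A bound for all exponents that occur, so that reversing at it loses nothing.\<close>
  define B where "B = n + Max ((\<lambda>(m, i). lookup m i) ` (keys ?f \<times> {..<n}))"
  define c where "c = expo n (\<lambda>_. B)"
  have f_keys: "expo_le k c" if k: "k \<in> keys ?f" for k
  proof -
    have "?f \<in> mpolys n" by (intro ev_mpolys schur_mpolys w)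
    hence z: "lookup k i = 0" if "\<not> i < n" for i using k that by (fastforce simp: mpolys_def in_keys_iff subset_iff)
    have "lookup k i \<le> B" if "i < n" for i
    proof -
      have "lookup k i \<le> Max ((\<lambda>(m, i). lookup m i) ` (keys ?f \<times> {..<n}))"
        using k that by (intro Max_ge) force+
      thus ?thesis by (simp add: B_def)
    qed
    thus ?thesis using z by (auto simp: expo_le_def c_def)
  qed
  have rect_c: "expo_le rect c" by (auto simp: expo_le_def rect_def c_def B_def)
  have en_eq: "en i = en j" if "i < n" "j < n" "st i = st j" for i j using st_eq_en_eq that by metis
  have spread_fix: "Poly_Mapping.map_key \<sigma> spread = spread" if "\<sigma> \<in> young" for \<sigma>
    unfolding spread_def by (rule young_const_fixed[OF _ that]) (metis en_eq)
  have cs: "c + spread = expo n (\<lambda>i. B + (en i - 1 - st i))"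
    by (rule poly_mapping_eqI) (simp add: lookup_add c_def spread_def)
  have cs_fix: "Poly_Mapping.map_key \<sigma> (c + spread) = c + spread" if "\<sigma> \<in> young" for \<sigma>
    unfolding cs by (rule young_const_fixed[OF _ that]) (metis en_eq)
  have disc_keys: "expo_le k spread" if kd: "k \<in> keys (disc :: 'a mpoly)" for k
  proof -
    obtain \<sigma> where s: "\<sigma> \<in> young" "Poly_Mapping.map_key \<sigma> k = stair"
      using keys_Alt_xmon[OF kd[unfolded disc_def]] by blast
    have "lookup k i \<le> lookup spread i" for i
    proof -
      have p: "\<sigma> permutes {..<n}" by (rule young_permutes[OF s(1)])
      obtain j where j: "i = \<sigma> j" using permutes_surj[OF p] by (metis surjD)
      have "lookup k i = lookup stair j" using s(2) lookup_map_key[OF young_bij[OF s(1)], of k j] j by simp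
      also have "\<dots> \<le> lookup spread j" using st_le[of j] by (auto simp: spread_def intro: diff_le_mono2)
      also have "\<dots> = lookup spread i"
        using spread_fix[OF s(1)] lookup_map_key[OF young_bij[OF s(1)], of spread j] j by simp
      finally show ?thesis .
    qed
    thus ?thesis by (simp add: expo_le_def)
  qed
  have rd: "revp spread disc = ?s * disc"
    unfolding disc_def
  proof (rule revp_Alt[OF spread_fix])
    fix i
    show "lookup stair i = lookup spread i - lookup stair (block_rev i)"
    proof (cases "i < n")
      case True
      have "en (block_rev i) - 1 - block_rev i = i - st i"
        using block_rev_simps(3)[OF True] st_le[OF True] en_gt[OF True] True by (simp add: block_rev_def)
      thus ?thesis using True block_rev_simps(1)[OF True] st_le[OF True] en_gt[OF True]
        by (simp add: spread_def)
    next
      case False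
      thus ?thesis by (simp add: spread_def block_rev_def)
    qed
  qed
  have rA: "revp (c + spread) (Alt young (xmon w)) = ?s * Alt young (xmon (c - rect + compl w))"
  proof (rule revp_Alt[OF cs_fix])
    fix i
    show "lookup (c - rect + compl w) i = lookup (c + spread) i - lookup w (block_rev i)"
    proof (cases "i < n")
      case True
      have "lookup w (block_rev i) < n - st i"
        using shapes_lt[OF w block_rev_simps(1)[OF True]] by (simp add: block_rev_simps True)
      thus ?thesis using True st_le[OF True] en_gt[OF True] en_le[OF True]
        by (simp add: lookup_add lookup_minus c_def rect_def spread_def B_def)
    next
      case False
      thus ?thesis using w by (simp add: lookup_add lookup_minus c_def rect_def spread_def)
    qed
  qed
  have alt_shift: "Alt young (xmon (c - rect + compl w)) = xmon (c - rect) * (Alt young (xmon (compl w)) :: 'a mpoly)"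
  proof -
    have cr: "c - rect = expo n (\<lambda>i. B - (n - en i))"
      by (rule poly_mapping_eqI) (simp add: lookup_minus c_def rect_def)
    have fix_key: "Poly_Mapping.map_key \<sigma> (c - rect) = c - rect" if "\<sigma> \<in> young" for \<sigma>
      unfolding cr by (rule young_const_fixed[OF _ that]) (metis en_eq)
    have "act \<sigma> (xmon (c - rect)) = (xmon (c - rect) :: 'a mpoly)" if "\<sigma> \<in> young" for \<sigma>
      using act_xmon[OF young_bij[OF that], of "c - rect", where 'a = 'a] fix_key[OF that] by simp
    thus ?thesis unfolding xmon_add by (rule Alt_invariant_mult)
  qed
  have "revp c ?f * (?s * disc) = revp (c + spread) (?f * disc)"
    unfolding rd[symmetric] by (rule revp_mult[symmetric]) (use f_keys disc_keys in auto)
  also have "\<dots> = ?s * (xmon (c - rect) * (?g * disc))"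
    unfolding schur_disc[OF w] rA alt_shift schur_disc[OF compl_shapes[OF w]] ..
  finally have "?s * disc * (revp c ?f) = ?s * disc * (?g * xmon (c - rect))" by (simp only: mult_ac)
  moreover have "?s * disc \<noteq> 0"
    using disc_nonzero[where 'a = 'a] by (cases block_rev rule: sign_cases) auto
  ultimately have rf: "revp c ?f = ?g * xmon (c - rect)" by simp
  have mc: "expo_le m c" by (rule f_keys[OF m])
  have "lookup ?f m = lookup (?g * xmon (c - rect)) (c - m)"
    unfolding rf[symmetric] by (rule lookup_revp[OF _ mc, symmetric]) (rule f_keys)
  also have "\<dots> = (if expo_le (c - rect) (c - m) then lookup ?g (c - m - (c - rect)) else 0)"
    by (simp add: lookup_xmon_mult expo_le_iff)
  finally have val: "lookup ?f m = (if expo_le (c - rect) (c - m) then lookup ?g (c - m - (c - rect)) else 0)" .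
  hence le: "expo_le (c - rect) (c - m)" using m by (auto simp: in_keys_iff split: if_splits)
  show mr: "expo_le m rect"
    unfolding expo_le_def
  proof
    fix i
    have "lookup c i - lookup rect i \<le> lookup c i - lookup m i"
      using le by (simp add: expo_le_def lookup_minus)
    thus "lookup m i \<le> lookup rect i"
      using rect_c mc unfolding expo_le_def by (metis diff_le_mono2 diff_diff_cancel)
  qed
  have "c - m - (c - rect) = rect - m"
  proof (rule poly_mapping_eqI)
    fix k
    have "lookup m k \<le> lookup rect k" "lookup rect k \<le> lookup c k"
      using mr rect_c by (auto simp: expo_le_def)
    thus "lookup (c - m - (c - rect)) k = lookup (rect - m) k" unfolding lookup_minus by arith
  qed
  thus "lookup ?g (rect - m) = lookup ?f m" using val le by simp
qed

section \<open>The Gram matrix\<close>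

lemma pairing_schur:
  assumes "p \<in> mpolys n" "w \<in> shapes"
  shows "pairing (p * schur w) = (coeff_functional n (ev p * xmon w) :: 'a)"
  using coeff_functional_symm[OF two shapes_xmon[OF assms(2)] assms(1)]
  by (simp add: pairing_def schur_def)

lemma top_rect_stair: "\<sigma> \<in> young \<Longrightarrow> Poly_Mapping.map_key \<sigma> top = rect + Poly_Mapping.map_key \<sigma> stair"
proof -
  assume s: "\<sigma> \<in> young"
  have "rect = Poly_Mapping.map_key \<sigma> rect"
    unfolding rect_def by (rule young_const_fixed[symmetric, OF _ s]) (metis st_eq_en_eq)
  moreover have "top = rect + stair"
  proof (rule poly_mapping_eqI)
    fix i
    show "lookup top i = lookup (rect + stair) i"
    proof (cases "i < n")
      case True
      have "n - 1 - i = (n - en i) + (en i - 1 - i)" using en_gt[OF True] en_le[OF True] by arith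
      thus ?thesis by (simp only: top_def rect_def lookup_add lookup_expo lookup_stair True if_True)
    qed (simp add: top_def rect_def lookup_add)
  qed
  ultimately show ?thesis
    by (metis map_key_plus young_bij[OF s] bij_is_inj)
qed

text \<open>
  A monomial of the product that contributes to the pairing is a rearrangement of the staircase of
  the whole symmetric group, and the weight of the monomials is known.
\<close>

lemma gram_entry_support:
  assumes w: "w \<in> shapes" and v: "v \<in> shapes"
    and s: "\<sigma> permutes {..<n}" and nz: "lookup (ev (schur w) * xmon v :: 'a mpoly) (Poly_Mapping.map_key \<sigma> top) \<noteq> 0"
  shows "weight (Poly_Mapping.map_key \<sigma> top) + weight stair = weight w + weight v"
proof -
  obtain k where k: "Poly_Mapping.map_key \<sigma> top = k + v" "lookup (ev (schur w) :: 'a mpoly) k \<noteq> 0"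
    using nz by (auto simp: lookup_xmon_mult split: if_splits)
  hence "weight k + weight stair = weight w" using weight_schur[OF w] by (simp add: in_keys_iff)
  thus ?thesis by (simp add: k(1) weight_add)
qed

lemma gram_entry_sum:
  assumes w: "w \<in> shapes" and v: "v \<in> shapes"
  shows "pairing (schur w * schur v) = (\<Sum>\<sigma> | \<sigma> permutes {..<n}.
     of_int (sign \<sigma>) * lookup (ev (schur w) * xmon v :: 'a mpoly) (Poly_Mapping.map_key \<sigma> top))"
proof -
  have "blocks.stair n (\<lambda>_. n) = top"
    unfolding top_def blocks.stair_def[OF blocks_full] ..
  thus ?thesis using pairing_schur[OF schur_mpolys[OF w] v] coeff_functional_alt_sum[of n "ev (schur w) * xmon v :: 'a mpoly"]
    by simp
qed

lemma gram_entry_positive: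
  assumes w: "w \<in> shapes" and v: "v \<in> shapes" and nz: "pairing (schur w * schur v) \<noteq> (0::'a)"
  shows "score w + score v \<ge> 0"
proof -
  obtain \<sigma> where s: "\<sigma> permutes {..<n}"
    "lookup (ev (schur w) * xmon v :: 'a mpoly) (Poly_Mapping.map_key \<sigma> top) \<noteq> 0"
    using nz unfolding gram_entry_sum[OF w v] by (auto elim!: sum.not_neutral_contains_not_neutral)
  show ?thesis
    using gram_entry_support[OF w v s] weight_top_permuted(1)[OF s(1)] by (simp add: score_def)
qed

text \<open>
  When the scores cancel, only rearrangements of the staircase within the blocks contribute.  Passing to
  complements turns their alternating sum into the coefficient of the monomial \<open>v\<close> in the alternant
  of \<open>compl w\<close>.
\<close>

lemma gram_entry_zero_score:
  assumes w: "w \<in> shapes" and v: "v \<in> shapes" and sc: "score w + score v = 0"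
  shows "pairing (schur w * schur v) = (if v = compl w then 1 else (0::'a))"
proof -
  let ?f = "ev (schur w) :: 'a mpoly" and ?g = "ev (schur (compl w)) :: 'a mpoly"
  have cw: "compl w \<in> shapes" by (rule compl_shapes[OF w])
  have sub: "young \<subseteq> {\<sigma>. \<sigma> permutes {..<n}}" by (auto intro: young_permutes)
  have wt: "weight w + weight v = weight stair + weight top" using sc by (simp add: score_def)
  have "pairing (schur w * schur v)
      = (\<Sum>\<sigma>\<in>young. of_int (sign \<sigma>) * lookup (?f * xmon v) (Poly_Mapping.map_key \<sigma> top))"
    unfolding gram_entry_sum[OF w v]
  proof (rule sum.mono_neutral_right[OF _ sub])
    show "\<forall>\<sigma>\<in>{\<sigma>. \<sigma> permutes {..<n}} - young.
        of_int (sign \<sigma>) * lookup (?f * xmon v) (Poly_Mapping.map_key \<sigma> top) = 0"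
    proof (rule ballI, rule ccontr)
      fix \<sigma> assume s: "\<sigma> \<in> {\<sigma>. \<sigma> permutes {..<n}} - young"
        and "of_int (sign \<sigma>) * lookup (?f * xmon v) (Poly_Mapping.map_key \<sigma> top) \<noteq> 0"
      hence "weight (Poly_Mapping.map_key \<sigma> top) + weight stair = weight w + weight v"
        by (intro gram_entry_support[OF w v]) auto
      thus False using weight_top_permuted(2)[of \<sigma>] s wt by simp
    qed
  qed (simp add: finite_permutations)
  also have "\<dots> = (\<Sum>\<sigma>\<in>young. of_int (sign \<sigma>) * lookup (?g * xmon (Poly_Mapping.map_key \<sigma> stair)) v)"
  proof (intro sum.cong refl arg_cong[of _ _ "(*) _"])
    fix \<sigma> assume s: "\<sigma> \<in> young"
    let ?d = "Poly_Mapping.map_key \<sigma> stair"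
    have L: "lookup (?f * xmon v) (Poly_Mapping.map_key \<sigma> top)
        = (if expo_le v (rect + ?d) then lookup ?f (rect + ?d - v) else 0)"
      unfolding lookup_xmon_mult top_rect_stair[OF s] expo_le_iff ..
    have R: "lookup (?g * xmon ?d) v = (if expo_le ?d v then lookup ?g (v - ?d) else 0)"
      unfolding lookup_xmon_mult expo_le_iff ..
    show "lookup (?f * xmon v) (Poly_Mapping.map_key \<sigma> top) = lookup (?g * xmon ?d) v"
    proof (cases "expo_le v (rect + ?d) \<and> expo_le ?d v")
      case True
      have 1: "expo_le (rect + ?d - v) rect" "rect - (rect + ?d - v) = v - ?d" "expo_le (v - ?d) rect"
        "rect - (v - ?d) = rect + ?d - v"
      proof -
        have le: "lookup v i \<le> lookup rect i + lookup ?d i" "lookup ?d i \<le> lookup v i" for i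
          using True by (auto simp: expo_le_def lookup_add)
        have "lookup rect i + lookup ?d i - lookup v i \<le> lookup rect i"
          "lookup rect i - (lookup rect i + lookup ?d i - lookup v i) = lookup v i - lookup ?d i"
          "lookup v i - lookup ?d i \<le> lookup rect i"
          "lookup rect i - (lookup v i - lookup ?d i) = lookup rect i + lookup ?d i - lookup v i" for i
          using le[of i] by arith+
        thus "expo_le (rect + ?d - v) rect" "rect - (rect + ?d - v) = v - ?d" "expo_le (v - ?d) rect"
          "rect - (v - ?d) = rect + ?d - v"
          by (auto simp only: expo_le_def lookup_add lookup_minus intro!: poly_mapping_eqI)
      qed
      show ?thesis
      proof (cases "lookup ?f (rect + ?d - v) = 0")
        case False
        thus ?thesis using schur_compl(2)[OF w, of "rect + ?d - v"] True
          unfolding L R by (simp add: in_keys_iff 1)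
      next
        case zero: True
        have "lookup ?g (v - ?d) = 0"
        proof (rule ccontr)
          assume "lookup ?g (v - ?d) \<noteq> 0"
          hence "lookup ?f (rect + ?d - v) \<noteq> 0"
            using schur_compl(2)[OF cw, of "v - ?d"] by (simp add: in_keys_iff 1 compl_compl[OF w])
          thus False using zero by simp
        qed
        thus ?thesis using zero unfolding L R by simp
      qed
    next
      case False
      have "lookup ?f (rect + ?d - v) = 0" if "expo_le v (rect + ?d)" "\<not> expo_le ?d v"
      proof (rule ccontr)
        assume "lookup ?f (rect + ?d - v) \<noteq> 0"
        hence "expo_le (rect + ?d - v) rect" using schur_compl(1)[OF w] by (simp add: in_keys_iff)
        hence le: "lookup rect i + lookup ?d i - lookup v i \<le> lookup rect i" for i
          by (simp only: expo_le_def lookup_add lookup_minus)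
        have "lookup v i \<le> lookup rect i + lookup ?d i" for i
          using that(1) by (simp only: expo_le_def lookup_add)
        hence "lookup ?d i \<le> lookup v i" for i using le[of i] by (metis add_le_cancel_left le_diff_conv)
        hence "expo_le ?d v" by (simp add: expo_le_def)
        thus False using that by simp
      qed
      moreover have "lookup ?g (v - ?d) = 0" if "expo_le ?d v" "\<not> expo_le v (rect + ?d)"
      proof (rule ccontr)
        assume "lookup ?g (v - ?d) \<noteq> 0"
        hence "expo_le (v - ?d) rect" using schur_compl(1)[OF cw] by (simp add: in_keys_iff)
        hence "expo_le v (rect + ?d)"
          by (simp add: expo_le_def lookup_add lookup_minus le_diff_conv)
        thus False using that by simp
      qed
      ultimately show ?thesis using False unfolding L R by auto
    qed
  qed
  also have "\<dots> = lookup (?g * disc) v"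
    unfolding disc_def Alt_xmon_sum sum_distrib_left lookup_sum
    by (intro sum.cong refl) (simp add: mconst_of_int mult.left_commute[of _ "mconst _"])
  also have "\<dots> = (if v = compl w then 1 else 0)"
    unfolding schur_disc[OF cw] by (rule lookup_Alt_shapes[OF cw v])
  finally show ?thesis .
qed

end

section \<open>The basis of Schur polynomials\<close>

lemma keys_mpolys_subset: "p \<in> mpolys n \<Longrightarrow> m \<in> keys p \<Longrightarrow> keys m \<subseteq> {..<n}"
  by (auto simp: mpolys_def)

context block_quotient
begin

abbreviation "J \<equiv> poly_ideal n n f"

lemma full_coord: "full.coord n i = esym {..<n} (Suc i)"
  by (simp add: full.coord_def atLeast0LessThan)

lemma full_ev:
  assumes "c \<in> mpolys n" shows "full.ev n c = ev (mpoly_subst f c)"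
  unfolding full.ev_def ev_def mpoly_subst_subst
  by (rule mpoly_subst_cong[OF assms]) (use ev_f in \<open>simp add: full_coord ev_def\<close>)

lemma subst_f_mpolys: "c \<in> mpolys n \<Longrightarrow> mpoly_subst f c \<in> mpolys n"
  by (rule mpolys_subst[of _ n]) (auto intro: f_mpolys)

text \<open>
  Modulo the fibre ideal, every symmetric polynomial becomes its constant term.
\<close>

lemma subst_f_constant:
  assumes "c \<in> mpolys n" shows "mpoly_subst f c - mconst (lookup c 0) \<in> J"
proof -
  have "c - mconst (lookup c 0) \<in> poly_ideal n n mvar"
    using assms by (intro maximal_ideal_vars mpolys_diff) (auto simp: lookup_minus)
  then obtain d where d: "\<forall>i<n. d i \<in> mpolys n" "c - mconst (lookup c 0) = (\<Sum>i<n. d i * mvar i)"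
    by (auto simp: poly_ideal_def)
  have "c = (\<Sum>i<n. d i * mvar i) + mconst (lookup c 0)" using d(2) by (simp add: diff_eq_eq)
  hence "mpoly_subst f c = mpoly_subst f ((\<Sum>i<n. d i * mvar i) + mconst (lookup c 0))"
    by (rule arg_cong)
  hence "mpoly_subst f c = (\<Sum>i<n. mpoly_subst f (d i) * f i) + mconst (lookup c 0)"
    by (simp add: mpoly_subst_add mpoly_subst_sum mpoly_subst_mult)
  moreover have "(\<Sum>i<n. mpoly_subst f (d i) * f i) \<in> J"
    using d by (intro poly_idealI subst_f_mpolys) auto
  ultimately show ?thesis by simp
qed

text \<open>
  Sorting each block turns an exponent that is injective on the blocks into a shape; a permutation
  minimizing the weighted sum below sorts in decreasing order.
\<close>

lemma sort_to_shape:
  assumes a: "a \<in> full.boxed n n" and inj: "block_inj a"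
  obtains \<sigma> where "\<sigma> \<in> young" "Poly_Mapping.map_key \<sigma> a \<in> shapes"
proof -
  define g where "g \<sigma> = (\<Sum>i<n. i * lookup a (\<sigma> i))" for \<sigma> :: "nat \<Rightarrow> nat"
  obtain \<sigma> where s: "\<sigma> \<in> young" and min: "\<And>\<tau>. \<tau> \<in> young \<Longrightarrow> g \<sigma> \<le> g \<tau>"
    using arg_min_if_finite(1)[OF finite_young, of g] arg_min_least[OF finite_young, of _ g] id_young
    by blast
  have l: "lookup (Poly_Mapping.map_key \<sigma> a) i = lookup a (\<sigma> i)" for i
    by (rule lookup_map_key[OF young_bij[OF s]])
  have "Poly_Mapping.map_key \<sigma> a \<in> shapes"
    unfolding shapes_def
  proof (intro CollectI conjI allI impI)
    fix i assume "n \<le> i"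
    hence "\<sigma> i = i" using young_permutes[OF s] by (auto simp: permutes_def)
    thus "lookup (Poly_Mapping.map_key \<sigma> a) i = 0" unfolding l using full.boxed_top[OF a \<open>n \<le> i\<close>] by simp
  next
    fix i assume i: "i < n"
    have "\<sigma> i < n" "st (\<sigma> i) = st i" using s i young_lt[OF s] by (auto simp: young_def)
    moreover have "lookup a (\<sigma> i) < n - \<sigma> i"
      using a \<open>\<sigma> i < n\<close> unfolding full.boxed_iff by metis
    ultimately show "lookup (Poly_Mapping.map_key \<sigma> a) i < n - st i" unfolding l using st_le[of "\<sigma> i"] by linarith
  next
    fix i j assume ij: "i < n" "j < n" "st i = st j" "i < j"
    have ne: "lookup a (\<sigma> i) \<noteq> lookup a (\<sigma> j)"
    proof
      assume "lookup a (\<sigma> i) = lookup a (\<sigma> j)"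
      moreover have "st (\<sigma> i) = st (\<sigma> j)" using s ij by (simp add: young_def)
      ultimately have "\<sigma> i = \<sigma> j"
        using inj young_lt[OF s] ij unfolding block_inj_def by blast
      thus False using ij bij_is_inj[OF young_bij[OF s]] by (auto dest: injD)
    qed
    show "lookup (Poly_Mapping.map_key \<sigma> a) j < lookup (Poly_Mapping.map_key \<sigma> a) i"
      unfolding l
    proof (rule ccontr)
      assume "\<not> lookup a (\<sigma> j) < lookup a (\<sigma> i)"
      hence lt: "lookup a (\<sigma> i) < lookup a (\<sigma> j)" using ne by simp
      let ?t = "\<sigma> \<circ> transpose i j"
      have "?t \<in> young" by (intro young_comp s transpose_young ij(1-3))
      hence le: "g \<sigma> \<le> g ?t" by (rule min)
      let ?I = "{..<n} - {i, j}"
      have split: "(\<Sum>k<n. h k) = h i + h j + (\<Sum>k\<in>?I. h k)" for h :: "nat \<Rightarrow> nat"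
        using sum.subset_diff[of "{i, j}" "{..<n}" h] ij by (simp add: add_ac)
      have "g \<sigma> = i * lookup a (\<sigma> i) + j * lookup a (\<sigma> j) + (\<Sum>k\<in>?I. k * lookup a (\<sigma> k))"
        unfolding g_def by (rule split)
      moreover have "g ?t = i * lookup a (\<sigma> j) + j * lookup a (\<sigma> i) + (\<Sum>k\<in>?I. k * lookup a (\<sigma> k))"
        unfolding g_def split by (simp add: transpose_def)
      ultimately have "i * lookup a (\<sigma> i) + j * lookup a (\<sigma> j) \<le> i * lookup a (\<sigma> j) + j * lookup a (\<sigma> i)"
        using le by simp
      moreover obtain d where "j = i + d" "d > 0" using ij(4) less_imp_add_positive by blast
      moreover obtain e where "lookup a (\<sigma> j) = lookup a (\<sigma> i) + e" "e > 0"
        using lt less_imp_add_positive by metis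
      ultimately show False by (simp add: algebra_simps)
    qed
  qed
  thus ?thesis using that s by blast
qed

lemma symm_xmon_shape:
  assumes a: "a \<in> full.boxed n n"
  shows "\<exists>u. \<exists>w. (w \<in> shapes \<or> u = 0) \<and> symm (xmon a) = (mconst u * schur w :: 'a mpoly)"
proof -
  have "keys a \<subseteq> {..<n}" using full.boxed_top[OF a] by (auto simp: in_keys_iff not_less[symmetric])
  hence m: "(xmon a :: 'a mpoly) \<in> mpolys n" by (rule xmon_mpolys)
  show ?thesis
  proof (cases "block_inj a")
    case False
    have "symm (xmon a) = (0 :: 'a mpoly)"
      by (rule symm_unique[OF two m]) (simp_all add: Alt_young_repeat[OF two False])
    thus ?thesis by (intro exI[of _ 0]) simp
  next
    case True
    obtain \<sigma> where s: "\<sigma> \<in> young" "Poly_Mapping.map_key \<sigma> a \<in> shapes" by (rule sort_to_shape[OF a True])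
    let ?w = "Poly_Mapping.map_key \<sigma> a"
    have "Alt young (xmon a) = Alt young (act \<sigma> (xmon ?w) :: 'a mpoly)"
      by (simp add: act_xmon young_bij[OF s(1)])
    also have "\<dots> = mconst (of_int (sign \<sigma>)) * Alt young (xmon ?w)"
      unfolding Alt_young_act[OF s(1)] mconst_of_int ..
    also have "\<dots> = ev (mconst (of_int (sign \<sigma>)) * schur ?w) * disc"
      using schur_disc[OF s(2)] by (simp add: mult.assoc)
    finally have "symm (xmon a) = (mconst (of_int (sign \<sigma>)) * schur ?w :: 'a mpoly)"
      by (intro symm_unique[OF two m] mpolys_mult mpolys_mconst schur_mpolys[OF s(2)])
    thus ?thesis using s(2) by blast
  qed
qed

lemma finite_shapes: "finite shapes"
proof (rule finite_surj[of "PiE {..<n} (\<lambda>_. {..n})" _ "expo n"])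
  show "shapes \<subseteq> expo n ` PiE {..<n} (\<lambda>_. {..n})"
  proof
    fix w assume w: "w \<in> shapes"
    have "w = expo n (restrict (lookup w) {..<n})"
      using w by (intro poly_mapping_eqI) (auto simp: shapes_def)
    moreover have "restrict (lookup w) {..<n} \<in> PiE {..<n} (\<lambda>_. {..n})"
      using shapes_lt[OF w] by (force intro: less_imp_le less_le_trans)
    ultimately show "w \<in> expo n ` PiE {..<n} (\<lambda>_. {..n})" by blast
  qed
qed (simp add: finite_PiE)

text \<open>
  Over the symmetric polynomials, \<open>ev p\<close> times the staircase monomial is a combination of monomials,
  and symmetrizing these gives Schur polynomials up to sign, or zero.  Modulo the fibre ideal the
  symmetric coefficients become constants.
\<close>

theorem schur_span:
  assumes p: "p \<in> mpolys n"
  shows "\<exists>c. p - (\<Sum>w\<in>shapes. mconst (c w) * schur w) \<in> J"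
proof -
  \<comment> \<open>The polynomials for which the claim holds; they form a linear space containing the ideal.\<close>
  define U where "U = {q \<in> mpolys n. \<exists>c. q - (\<Sum>w\<in>shapes. mconst (c w) * schur w) \<in> J}"
  have U_add: "q + r \<in> U" if qr: "q \<in> U" "r \<in> U" for q r
  proof -
    obtain c d where "q - (\<Sum>w\<in>shapes. mconst (c w) * schur w) \<in> J" "r - (\<Sum>w\<in>shapes. mconst (d w) * schur w) \<in> J"
      using qr by (auto simp: U_def)
    from poly_ideal_add[OF this]
    have "(q + r) - (\<Sum>w\<in>shapes. mconst (c w + d w) * schur w) \<in> J"
      by (simp add: distrib_right sum.distrib algebra_simps)
    hence "\<exists>c. (q + r) - (\<Sum>w\<in>shapes. mconst (c w) * schur w) \<in> J"
      by (rule exI[of _ "\<lambda>w. c w + d w"])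
    thus ?thesis using qr unfolding U_def by (auto intro: mpolys_add)
  qed
  have U_J: "q \<in> U" if "q \<in> J" for q
    using that poly_ideal_mpolys[of n f n] f_mpolys by (auto simp: U_def intro!: exI[of _ "\<lambda>_. 0"])
  have U_schur: "mconst u * schur w \<in> U" if w: "w \<in> shapes" for u w
  proof -
    have "(\<Sum>v\<in>shapes. mconst (if v = w then u else 0) * schur v) = (\<Sum>v\<in>shapes. if v = w then mconst u * schur v else 0)"
      by (intro sum.cong) auto
    also have "\<dots> = (mconst u * schur w :: 'a mpoly)" using w finite_shapes by simp
    finally have "mconst u * schur w - (\<Sum>v\<in>shapes. mconst (if v = w then u else 0) * schur v) \<in> J" by simp
    hence "\<exists>c. mconst u * schur w - (\<Sum>v\<in>shapes. mconst (c v) * schur v) \<in> J"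
      by (rule exI[of _ "\<lambda>v. if v = w then u else 0"])
    moreover have "mconst u * schur w \<in> mpolys n" by (intro mpolys_mult mpolys_mconst schur_mpolys[OF w])
    ultimately show ?thesis unfolding U_def by blast
  qed
  have U_sum: "sum h X \<in> U" if "\<And>x. x \<in> X \<Longrightarrow> h x \<in> U" for h and X :: "(nat \<Rightarrow>\<^sub>0 nat) set"
    using that by (induction X rule: infinite_finite_induct) (auto simp: U_add U_J)
  have keys_boxed: "keys a \<subseteq> {..<n}" if "a \<in> full.boxed n n" for a
    using full.boxed_top[OF that] by (auto simp: in_keys_iff not_less[symmetric])
  have "ev p * xmon stair \<in> mpolys n" by (intro mpolys_mult ev_mpolys p stair_mpolys)
  then obtain c where c: "\<And>a. c a \<in> mpolys n" "ev p * xmon stair = (\<Sum>a\<in>full.boxed n n. full.ev n (c a) * xmon a)"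
    using full.block_symmetric_span by blast
  let ?d = "\<lambda>a. mpoly_subst f (c a)"
  have d: "?d a \<in> mpolys n" for a by (rule subst_f_mpolys[OF c(1)])
  have sm: "symm (xmon a) \<in> (mpolys n :: 'a mpoly set)" if "a \<in> full.boxed n n" for a
    by (intro symm_mpolys[OF two] xmon_mpolys keys_boxed that)
  have "ev p * disc = Alt young (ev p * xmon stair)"
    unfolding disc_def by (rule Alt_invariant_mult[symmetric]) (rule act_ev[OF _ p])
  also have "\<dots> = (\<Sum>a\<in>full.boxed n n. Alt young (ev (?d a) * xmon a))"
    unfolding c(2) Alt_sum by (simp add: full_ev[OF c(1)])
  also have "\<dots> = (\<Sum>a\<in>full.boxed n n. ev (?d a) * Alt young (xmon a))"
    by (intro sum.cong refl Alt_invariant_mult) (rule act_ev[OF _ d])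
  also have "\<dots> = (\<Sum>a\<in>full.boxed n n. ev (?d a) * (ev (symm (xmon a)) * disc))"
    by (intro sum.cong refl arg_cong[of _ _ "(*) _"] Alt_symm[OF two] xmon_mpolys keys_boxed)
  also have "\<dots> = ev (\<Sum>a\<in>full.boxed n n. ?d a * symm (xmon a)) * disc"
    by (simp add: sum_distrib_right mult.assoc)
  finally have "ev p = ev (\<Sum>a\<in>full.boxed n n. ?d a * symm (xmon a))"
    using disc_nonzero[where 'a = 'a] by simp
  moreover have "(\<Sum>a\<in>full.boxed n n. ?d a * symm (xmon a)) \<in> mpolys n"
    by (intro mpolys_sum mpolys_mult d sm)
  ultimately have "p = (\<Sum>a\<in>full.boxed n n. ?d a * symm (xmon a))"
    by (rule inj_onD[OF ev_inj _ p])
  also have "\<dots> = (\<Sum>a\<in>full.boxed n n. symm (xmon a) * (?d a - mconst (lookup (c a) 0))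
      + mconst (lookup (c a) 0) * symm (xmon a))"
    by (simp add: algebra_simps)
  also have "\<dots> \<in> U"
  proof (intro U_sum U_add)
    fix a assume a: "a \<in> full.boxed n n"
    show "symm (xmon a) * (?d a - mconst (lookup (c a) 0)) \<in> U"
      by (intro U_J poly_ideal_mult sm[OF a] subst_f_constant c(1))
    obtain u w where uw: "w \<in> shapes \<or> u = 0" "symm (xmon a) = (mconst u * schur w :: 'a mpoly)"
      using symm_xmon_shape[OF a] by blast
    have "mconst (lookup (c a) 0) * symm (xmon a) = mconst (lookup (c a) 0 * u) * schur w"
      unfolding uw(2) by (simp add: mult.assoc)
    also have "\<dots> \<in> U"
    proof (cases "u = 0")
      case True
      thus ?thesis using U_J[of 0] by simp
    next
      case False
      thus ?thesis using uw(1) U_schur by blast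
    qed
    finally show "mconst (lookup (c a) 0) * symm (xmon a) \<in> U" .
  qed
  finally show ?thesis by (auto simp: U_def)
qed

lemma pairing_add: "pairing (p + q) = pairing p + (pairing q :: 'a)"
  by (simp add: pairing_def distrib_right coeff_functional_add)

lemma pairing_smult: "pairing (mconst c * p) = c * (pairing p :: 'a)"
  by (simp add: pairing_def mult.assoc coeff_functional_mconst)

lemma pairing_J:
  assumes "p \<in> J" shows "pairing p = 0"
proof -
  obtain c where c: "\<forall>i<n. c i \<in> mpolys n" "p = (\<Sum>i<n. c i * f i)"
    using assms by (auto simp: poly_ideal_def)
  have "pairing p = (\<Sum>i<n. coeff_functional n (ev (c i * f i) * xmon stair))"
    by (simp add: pairing_def c(2) sum_distrib_right coeff_functional_sum)
  also have "\<dots> = (\<Sum>i<n. coeff_functional n (esym {..<n} (Suc i) * (ev (c i) * xmon stair)))"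
    by (intro sum.cong refl) (simp add: ev_f mult_ac)
  also have "\<dots> = 0" by (simp add: coeff_functional_esym[OF two])
  finally show ?thesis .
qed

end

section \<open>The value of the pairing on the socle element\<close>

context blocks
begin

text \<open>
  Grouping the subsets of a block by their largest element writes each block coordinate as a linear
  combination of the variables.  This presentation is triangular, and its determinant is the
  staircase monomial of the blocks.
\<close>

definition coord_mat :: "'a::field mpoly mat" where
  "coord_mat = mat n n (\<lambda>(i, j). if st j = st i \<and> i \<le> j then esym {st i..<j} (i - st i) else 0)"

lemma coord_mat_presents:
  assumes i: "i < n"
  shows "coord i = (\<Sum>j<n. coord_mat $$ (i, j) * mvar j :: 'a::field mpoly)"
proof -
  have "esym {s..<s + d} (Suc k) = (\<Sum>j\<in>{s..<s + d}. esym {s..<j} k * mvar j :: 'a mpoly)" for s d k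
  proof (induction d)
    case 0
    show ?case by (simp add: esym_gt)
  next
    case (Suc d)
    have "{s..<s + Suc d} = insert (s + d) {s..<s + d}" by auto
    thus ?case using Suc by (simp add: esym_insert mult.commute)
  qed
  from this[of "st i" "en i - st i"]
  have "coord i = (\<Sum>j\<in>{st i..<en i}. esym {st i..<j} (i - st i) * mvar j :: 'a mpoly)"
    using st_le[OF i] en_gt[OF i] by (simp add: coord_def)
  also have "\<dots> = (\<Sum>j<n. coord_mat $$ (i, j) * mvar j)"
  proof (rule sum.mono_neutral_cong)
    fix j assume "j \<in> {st i..<en i} - {..<n}"
    thus "esym {st i..<j} (i - st i) * mvar j = (0 :: 'a mpoly)" using en_le[OF i] by simp
  next
    fix j assume "j \<in> {..<n} - {st i..<en i}"
    thus "coord_mat $$ (i, j) * mvar j = (0 :: 'a mpoly)"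
      using i st_eq_iff[OF i, of j] by (auto simp: coord_mat_def)
  next
    fix j assume j: "j \<in> {st i..<en i} \<inter> {..<n}"
    hence "st j = st i" using st_eq_iff[OF i, of j] by simp
    moreover have "esym {st i..<j} (i - st i) = (0 :: 'a mpoly)" if "\<not> i \<le> j"
      using that j by (intro esym_gt) auto
    ultimately show "esym {st i..<j} (i - st i) * mvar j = coord_mat $$ (i, j) * (mvar j :: 'a mpoly)"
      using i j by (auto simp: coord_mat_def)
  qed auto
  finally show ?thesis .
qed

lemma coord_mat_mpolys: "i < n \<Longrightarrow> j < n \<Longrightarrow> coord_mat $$ (i, j) \<in> mpolys n"
  by (auto simp: coord_mat_def intro!: esym_mpolys)

lemma det_coord_mat: "det coord_mat = (xmon stair :: 'a::field mpoly)"
proof -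
  have c: "(coord_mat :: 'a mpoly mat) \<in> carrier_mat n n" by (simp add: coord_mat_def)
  have "upper_triangular (coord_mat :: 'a mpoly mat)" by (auto simp: coord_mat_def)
  hence "det coord_mat = prod_list (diag_mat (coord_mat :: 'a mpoly mat))"
    using c by (rule det_upper_triangular)
  also have "\<dots> = (\<Prod>j<n. coord_mat $$ (j, j))"
    using c by (simp add: prod_list_diag_prod atLeast0LessThan)
  also have "\<dots> = (\<Prod>j<n. \<Prod>l\<in>{st j..<j}. mvar l :: 'a mpoly)"
  proof (intro prod.cong refl)
    fix j assume "j \<in> {..<n}"
    thus "coord_mat $$ (j, j) = (\<Prod>l\<in>{st j..<j}. mvar l :: 'a mpoly)"
      using esym_card[of "{st j..<j}"] by (simp add: coord_mat_def)
  qed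
  also have "\<dots> = (\<Prod>j<n. \<Prod>l<n. if st j \<le> l \<and> l < j then mvar l else 1 :: 'a mpoly)"
  proof (rule prod.cong[OF refl])
    fix j assume "j \<in> {..<n}"
    hence e: "{st j..<j} = {l \<in> {..<n}. st j \<le> l \<and> l < j}" by auto
    show "(\<Prod>l\<in>{st j..<j}. mvar l) = (\<Prod>l<n. if st j \<le> l \<and> l < j then mvar l else 1 :: 'a mpoly)"
      unfolding e by (rule prod.inter_filter) simp
  qed
  also have "\<dots> = (\<Prod>l<n. \<Prod>j<n. if st j \<le> l \<and> l < j then mvar l else 1 :: 'a mpoly)"
    by (rule prod.swap)
  also have "\<dots> = (\<Prod>l<n. mvar l ^ (en l - 1 - l))"
  proof (intro prod.cong refl)
    fix l assume "l \<in> {..<n}"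
    hence l: "l < n" by simp
    have e: "{j \<in> {..<n}. st j \<le> l \<and> l < j} = {Suc l..<en l}"
    proof (intro equalityI subsetI)
      fix j assume "j \<in> {j \<in> {..<n}. st j \<le> l \<and> l < j}"
      hence j: "j < n" "st j \<le> l" "l < j" by auto
      hence "st l = st j" using same[OF j(1,2)] en_gt[OF j(1)] by simp
      hence "j < en l" using st_eq_iff[OF l j(1)] by simp
      thus "j \<in> {Suc l..<en l}" using j by simp
    next
      fix j assume "j \<in> {Suc l..<en l}"
      hence j: "l < j" "j < en l" "j < n" using en_le[OF l] by auto
      hence "st j = st l" using same[OF l, of j] st_le[OF l] by simp
      thus "j \<in> {j \<in> {..<n}. st j \<le> l \<and> l < j}" using j st_le[OF l] by simp
    qed
    have "(\<Prod>j<n. if st j \<le> l \<and> l < j then mvar l else 1 :: 'a mpoly) = (\<Prod>j\<in>{Suc l..<en l}. mvar l)"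
      unfolding e[symmetric] by (rule prod.inter_filter[symmetric]) simp
    thus "(\<Prod>j<n. if st j \<le> l \<and> l < j then mvar l else 1 :: 'a mpoly) = mvar l ^ (en l - 1 - l)"
      by simp
  qed
  also have "\<dots> = xmon stair" by (simp add: stair_def xmon_expo)
  finally show ?thesis .
qed

end

context block_quotient
begin

lemma ev_signof: "ev (of_int k) = of_int k"
  by (simp add: mconst_of_int)

lemma ev_prod: "ev (prod h X) = (\<Prod>x\<in>X. ev (h x))"
  by (simp add: ev_def mpoly_subst_prod)

lemma ev_det:
  assumes "A \<in> carrier_mat n n" shows "ev (det A) = det (map_mat ev A)"
  using assms by (subst (1 2) det_def'[of _ n]) (auto simp: ev_signof ev_prod intro!: sum.cong prod.cong)

text \<open>
  Composing a presentation of the quotient map with the presentation of the block coordinates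
  presents the elementary symmetric polynomials; the uniqueness of determinants of presentations
  compares it with the triangular one for the whole symmetric group.
\<close>

lemma pairing_socle:
  assumes A: "linear_presentation n f A" shows "pairing (det A) = 1"
proof -
  note A' = A[unfolded linear_presentation_def]
  let ?e = "\<lambda>i. esym {..<n} (Suc i) :: 'a mpoly"
  let ?M = "coord_mat :: 'a mpoly mat" and ?E = "full.coord_mat n :: 'a mpoly mat"
  let ?A = "map_mat ev A"
  have c: "?A \<in> carrier_mat n n" "?M \<in> carrier_mat n n" using A' by (auto simp: coord_mat_def)
  have idx: "(?A * ?M) $$ (i, j) = (\<Sum>l<n. ev (A $$ (i, l)) * ?M $$ (l, j))" if ij: "i < n" "j < n" for i j
    unfolding mult_mat_index[OF c ij] using A' ij by (intro sum.cong) auto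
  have "linear_presentation n ?e (?A * ?M)"
    unfolding linear_presentation_def
  proof (intro conjI allI impI)
    show "?A * ?M \<in> carrier_mat n n" using c by simp
  next
    fix i j assume ij: "i < n" "j < n"
    show "(?A * ?M) $$ (i, j) \<in> mpolys n"
      unfolding idx[OF ij] using A' ij by (intro mpolys_sum mpolys_mult ev_mpolys coord_mat_mpolys) auto
  next
    fix i assume i: "i < n"
    have "?e i = ev (\<Sum>l<n. A $$ (i, l) * mvar l)" using ev_f[OF i] A' i by metis
    also have "\<dots> = (\<Sum>l<n. ev (A $$ (i, l)) * (\<Sum>j<n. ?M $$ (l, j) * mvar j))"
      by (simp add: coord_mat_presents[symmetric])
    also have "\<dots> = (\<Sum>j<n. \<Sum>l<n. ev (A $$ (i, l)) * ?M $$ (l, j) * mvar j)"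
      unfolding sum_distrib_left by (subst sum.swap) (simp only: mult.assoc)
    also have "\<dots> = (\<Sum>j<n. (?A * ?M) $$ (i, j) * mvar j)"
      using i by (intro sum.cong refl) (simp add: idx sum_distrib_right del: index_mult_mat)
    finally show "?e i = (\<Sum>j<n. (?A * ?M) $$ (i, j) * mvar j)" .
  qed
  moreover have "linear_presentation n ?e ?E"
    unfolding linear_presentation_def
  proof (intro conjI allI impI)
    show "?E \<in> carrier_mat n n" by (simp add: full.coord_mat_def)
    show "?E $$ (i, j) \<in> mpolys n" if "i < n" "j < n" for i j
      using that by (rule full.coord_mat_mpolys)
    show "?e i = (\<Sum>j<n. ?E $$ (i, j) * mvar j)" if "i < n" for i
      using full.coord_mat_presents[OF that, where 'a = 'a] unfolding full_coord .
  qed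
  ultimately have "det (?A * ?M) - det ?E \<in> poly_ideal n n ?e" by (intro det_presentation_unique)
  then obtain d where d: "det (?A * ?M) - det ?E = (\<Sum>i<n. d i * ?e i)" by (auto simp: poly_ideal_def)
  have "det (?A * ?M) = ev (det A) * xmon stair"
    using det_mult[OF c] ev_det[of A] A' by (simp add: det_coord_mat)
  hence "ev (det A) * xmon stair = (\<Sum>i<n. ?e i * d i) + xmon (full.stair n)"
    using d unfolding full.det_coord_mat by (simp add: algebra_simps)
  thus ?thesis
    by (simp add: pairing_def coeff_functional_add coeff_functional_sum coeff_functional_esym[OF two]
        coeff_functional_stair)
qed

lemma coord_constant: "lookup (coord i :: 'a mpoly) 0 = 0"
  unfolding coord_def by (rule lookup_esym_0) auto

lemma presentation_ex: "\<exists>A. linear_presentation n f A"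
proof -
  have vars: "f i \<in> poly_ideal n n mvar" if i: "i < n" for i
  proof (rule maximal_ideal_vars[OF f_mpolys[OF i]])
    have "f i - mconst (lookup (f i) 0) \<in> poly_ideal n n mvar"
      using f_mpolys[OF i] by (intro maximal_ideal_vars mpolys_diff) (auto simp: lookup_minus)
    then obtain d where d: "f i - mconst (lookup (f i) 0) = (\<Sum>j<n. d j * mvar j)"
      by (auto simp: poly_ideal_def)
    hence "f i = (\<Sum>j<n. d j * mvar j) + mconst (lookup (f i) 0)" by (simp add: diff_eq_eq)
    hence "ev (f i) = ev ((\<Sum>j<n. d j * mvar j) + mconst (lookup (f i) 0))" by (rule arg_cong)
    hence "ev (f i) = (\<Sum>j<n. ev (d j) * coord j) + mconst (lookup (f i) 0)" by simp
    hence "lookup (ev (f i)) 0 = lookup (f i) 0"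
      by (simp add: lookup_add lookup_sum lookup_mult_0 coord_constant)
    thus "lookup (f i) 0 = 0" using ev_f[OF i] lookup_esym_0[of "{..<n}" "Suc i", where 'a = 'a] by simp
  qed
  have "\<forall>i. \<exists>d. i < n \<longrightarrow> (\<forall>j<n. d j \<in> mpolys n) \<and> f i = (\<Sum>j<n. d j * mvar j)"
  proof
    fix i
    show "\<exists>d. i < n \<longrightarrow> (\<forall>j<n. d j \<in> mpolys n) \<and> f i = (\<Sum>j<n. d j * mvar j)"
    proof (cases "i < n")
      case True
      from vars[OF True] show ?thesis unfolding poly_ideal_def by blast
    qed simp
  qed
  from choice[OF this] obtain d where
    d: "\<forall>i. i < n \<longrightarrow> (\<forall>j<n. d i j \<in> mpolys n) \<and> f i = (\<Sum>j<n. d i j * mvar j)" by blast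
  have "linear_presentation n f (mat n n (\<lambda>(i, j). d i j))"
    unfolding linear_presentation_def using d by simp
  thus ?thesis by blast
qed

section \<open>The class of the quotient map\<close>

text \<open>
  The score orders the basis so that \<open>gram_involution_class\<close> applies to taking complements.
\<close>

lemma gram_class:
  assumes ws: "distinct ws" "set ws = shapes"
  defines "g \<equiv> \<lambda>w v. pairing (schur w * schur v) :: 'a"
  shows "nondeg_sym_mat (gram_matrix g ws) \<and>
    (\<exists>h. length ws = card {w \<in> shapes. compl w = w} + 2 * h \<and>
      gw_of_mat (gram_matrix g ws) =
        of_nat h * (gw_unit 1 + gw_unit (-1)) + of_nat (card {w \<in> shapes. compl w = w}) * gw_unit 1)"
  unfolding ws(2)[symmetric]
proof (rule gram_involution_class[OF two ws(1), where score = score])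
  fix w v assume w: "w \<in> set ws" and v: "v \<in> set ws"
  show "g w v = g v w" by (simp add: g_def mult.commute)
  assume nz: "g w v \<noteq> 0"
  have "score w + score v \<ge> 0"
    using gram_entry_positive[of w v] w v ws nz by (simp add: g_def)
  moreover have "v = compl w" if "score w + score v = 0"
    using gram_entry_zero_score[of w v] w v ws nz that by (auto simp: g_def split: if_splits)
  ultimately show "v = compl w \<or> score w + score v > 0" by linarith
next
  fix w assume w: "w \<in> set ws"
  show "compl w \<in> set ws" "compl (compl w) = w" "score (compl w) = - score w"
    using w ws compl_shapes compl_compl score_compl by auto
  show "g w (compl w) = 1"
    using gram_entry_zero_score[of w "compl w"] w ws compl_shapes score_compl by (simp add: g_def)
qed

text \<open>
  A polynomial lies in the fibre ideal if it pairs to zero with everything; high powers of a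
  coordinate do so for reasons of degree.
\<close>

lemma coord_nilpotent:
  assumes i: "i < n" shows "\<exists>M. mvar i ^ M \<in> J"
proof -
  obtain ws where ws: "distinct ws" "set ws = shapes" using finite_distinct_list[OF finite_shapes] by blast
  let ?G = "gram_matrix (\<lambda>w v. pairing (schur w * schur v) :: 'a) ws"
  have nd: "nondeg_sym_mat ?G" using gram_class[OF ws] by simp
  define deg where "deg m = (\<Sum>j<n. lookup m j)" for m :: "nat \<Rightarrow>\<^sub>0 nat"
  have deg_add: "deg (a + b) = deg a + deg b" for a b by (simp add: deg_def lookup_add sum.distrib)
  \<comment> \<open>Larger than the degree of the monomials that the pairing detects.\<close>
  define M where "M = Suc (deg top)"
  have deg_coord: "1 \<le> deg m" if "m \<in> keys (coord i :: 'a mpoly)" for m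
  proof -
    have "m \<noteq> 0" using that coord_constant[of i] by (auto simp: in_keys_iff)
    then obtain j where j: "lookup m j \<noteq> 0" by (metis lookup_zero poly_mapping_eqI)
    moreover have "j < n"
      using keys_mpolys_subset[OF coord_mpolys[OF i] that] j by (fastforce simp: in_keys_iff subset_iff)
    ultimately show ?thesis using member_le_sum[of j "{..<n}" "lookup m"] by (simp add: deg_def)
  qed
  have deg_power: "k \<le> deg m" if "m \<in> keys (coord i ^ k :: 'a mpoly)" for m k
    using that
  proof (induction k arbitrary: m)
    case (Suc k)
    then obtain a b where ab: "m = a + b" "a \<in> keys (coord i :: 'a mpoly)" "b \<in> keys (coord i ^ k :: 'a mpoly)"
      using keys_mult[of "coord i :: 'a mpoly" "coord i ^ k"] by auto
    thus ?case using Suc.IH[OF ab(3)] deg_coord[OF ab(2)] by (simp add: deg_add)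
  qed simp
  have ev_power: "ev (mvar i ^ k) = (coord i ^ k :: 'a mpoly)" for k
    by (simp add: ev_def mpoly_subst_power)
  have mM: "mvar i ^ M \<in> (mpolys n :: 'a mpoly set)" using i by (intro mpolys_power mpolys_mvar)
  have orth: "pairing (mvar i ^ M * schur w) = (0::'a)" if w: "w \<in> shapes" for w
  proof -
    have "lookup (coord i ^ M * xmon w :: 'a mpoly) (Poly_Mapping.map_key \<sigma> top) = 0"
      if s: "\<sigma> permutes {..<n}" for \<sigma>
    proof (rule ccontr)
      assume "lookup (coord i ^ M * xmon w :: 'a mpoly) (Poly_Mapping.map_key \<sigma> top) \<noteq> 0"
      then obtain k where k: "Poly_Mapping.map_key \<sigma> top = k + w" "k \<in> keys (coord i ^ M :: 'a mpoly)"
        by (auto simp: lookup_xmon_mult in_keys_iff split: if_splits)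
      have "deg (Poly_Mapping.map_key \<sigma> top) = (\<Sum>j<n. lookup top (\<sigma> j))"
        by (simp add: deg_def lookup_map_key[OF permutes_bij[OF s]])
      also have "\<dots> = deg top"
        unfolding deg_def using permutes_imp_bij[OF s] by (rule sum.reindex_bij_betw)
      finally show False using k deg_power[OF k(2)] by (simp add: deg_add M_def)
    qed
    moreover have "full.stair n = top" by (simp only: top_def full.stair_def)
    ultimately show ?thesis
      unfolding pairing_schur[OF mM w] ev_power coeff_functional_alt_sum by simp
  qed
  obtain c where c: "mvar i ^ M - (\<Sum>w\<in>shapes. mconst (c w) * schur w) \<in> J"
    using schur_span[OF mM] by blast
  have lin: "(\<Sum>w\<in>shapes. c w * pairing (schur w * schur v)) = (0::'a)" if v: "v \<in> shapes" for v
  proof -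
    have "schur v * (mvar i ^ M - (\<Sum>w\<in>shapes. mconst (c w) * schur w)) \<in> J"
      by (intro poly_ideal_mult schur_mpolys[OF v] c)
    hence 0: "pairing (schur v * (mvar i ^ M - (\<Sum>w\<in>shapes. mconst (c w) * schur w))) = (0::'a)"
      by (rule pairing_J)
    have "schur v * (mvar i ^ M - (\<Sum>w\<in>shapes. mconst (c w) * schur w))
        + (\<Sum>w\<in>shapes. mconst (c w) * (schur w * schur v)) = (mvar i ^ M * schur v :: 'a mpoly)"
      by (simp add: right_diff_distrib sum_distrib_left mult_ac)
    from arg_cong[OF this, of pairing]
    have "pairing (\<Sum>w\<in>shapes. mconst (c w) * (schur w * schur v)) = (0::'a)"
      using 0 orth[OF v] by (simp only: pairing_add add_0)
    moreover have "pairing (\<Sum>w\<in>shapes. mconst (c w) * (schur w * schur v))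
        = (\<Sum>w\<in>shapes. pairing (mconst (c w) * (schur w * schur v)) :: 'a)"
      by (simp only: pairing_def ev_simps(7) sum_distrib_right coeff_functional_sum)
    ultimately show ?thesis by (simp only: pairing_smult)
  qed
  have "c w = 0" if w: "w \<in> shapes" for w
  proof -
    define N where "N = length ws"
    have G: "?G \<in> carrier_mat N N" by (simp add: N_def)
    obtain B where B: "B \<in> carrier_mat N N" "?G * B = 1\<^sub>m N"
      using mat_inverse_ex[OF G] nd by (auto simp: nondeg_sym_mat_def)
    have "w \<in> set ws" using w ws(2) by simp
    then obtain k where k: "k < N" "ws ! k = w" by (auto simp: in_set_conv_nth N_def)
    have reindex: "(\<Sum>l<N. h (ws ! l)) = (\<Sum>w\<in>shapes. h w)" for h :: "_ \<Rightarrow> 'a"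
      using sum.reindex_bij_betw[OF bij_betw_nth[OF ws(1)], of "{..<N}" shapes h] ws(2) by (simp add: N_def)
    have z: "(\<Sum>l<N. c (ws ! l) * ?G $$ (l, j)) = 0" if j: "j < N" for j
    proof -
      have "(\<Sum>l<N. c (ws ! l) * ?G $$ (l, j)) = (\<Sum>l<N. c (ws ! l) * pairing (schur (ws ! l) * schur (ws ! j)))"
        using j by (intro sum.cong refl) (simp add: gram_matrix_index N_def)
      also have "\<dots> = (\<Sum>w\<in>shapes. c w * pairing (schur w * schur (ws ! j)))"
        by (rule reindex)
      also have "\<dots> = 0"
      proof (rule lin)
        show "ws ! j \<in> shapes" using nth_mem[of j ws] j unfolding ws(2) N_def by blast
      qed
      finally show ?thesis .
    qed
    have "c w = (\<Sum>l<N. c (ws ! l) * (?G * B) $$ (l, k))"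
      using k by (simp add: B(2) if_distrib[of "\<lambda>a. _ * a"] cong: if_cong)
    also have "\<dots> = (\<Sum>l<N. \<Sum>j<N. c (ws ! l) * ?G $$ (l, j) * B $$ (j, k))"
      using k by (intro sum.cong refl) (simp add: mult_mat_index[OF G B(1)] sum_distrib_left mult.assoc del: index_mult_mat)
    also have "\<dots> = (\<Sum>j<N. (\<Sum>l<N. c (ws ! l) * ?G $$ (l, j)) * B $$ (j, k))"
      by (subst sum.swap) (simp add: sum_distrib_right)
    also have "\<dots> = 0" using z by simp
    finally show ?thesis .
  qed
  hence "mvar i ^ M \<in> J" using c by simp
  thus ?thesis by blast
qed

theorem EKL_degree_quotient:
  "\<exists>h. local_degree n f = card shapes \<and> card shapes = card {w \<in> shapes. compl w = w} + 2 * h \<and>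
    EKL_degree n f = of_nat h * (gw_unit 1 + gw_unit (-1)) + of_nat (card {w \<in> shapes. compl w = w}) * gw_unit 1"
proof -
  obtain ws where ws: "distinct ws" "set ws = shapes" using finite_distinct_list[OF finite_shapes] by blast
  let ?bs = "map schur ws :: 'a mpoly list"
  have gram: "gram_matrix (\<lambda>p q. pairing (p * q)) ?bs = gram_matrix (\<lambda>w v. pairing (schur w * schur v)) ws"
    by (rule eq_matI) (auto simp: gram_matrix_def)
  interpret ekl: socle_functional n f pairing ?bs
  proof
    show "\<exists>c. p - (\<Sum>i<length ?bs. mconst (c i) * ?bs ! i) \<in> J" if p: "p \<in> mpolys n" for p
    proof -
      obtain c where c: "p - (\<Sum>w\<in>shapes. mconst (c w) * schur w) \<in> J" using schur_span[OF p] by blast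
      have "(\<Sum>w\<in>shapes. mconst (c w) * schur w) = (\<Sum>i<length ws. mconst (c (ws ! i)) * schur (ws ! i))"
        using sum.reindex_bij_betw[OF bij_betw_nth[OF ws(1)], of "{..<length ws}" shapes
          "\<lambda>w. mconst (c w) * schur w"] ws(2) by simp
      thus ?thesis using c by (intro exI[of _ "\<lambda>i. c (ws ! i)"]) simp
    qed
    show "set ?bs \<subseteq> mpolys n" using ws(2) schur_mpolys by auto
    show "nondeg_sym_mat (gram_matrix (\<lambda>p q. pairing (p * q)) ?bs)"
      unfolding gram using gram_class[OF ws] by blast
  qed (use char2 f_mpolys coord_nilpotent pairing_add pairing_smult pairing_J pairing_socle presentation_ex
       in blast)+
  have len: "length ws = card shapes" using distinct_card[OF ws(1)] ws(2) by simp
  show ?thesis using ekl.EKL_degree_eq ekl.local_degree_eq gram_class[OF ws] unfolding gram by (auto simp: len)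
qed

end

section \<open>Counting shapes\<close>

definition decreasing_lists :: "nat \<Rightarrow> nat \<Rightarrow> nat list set" where
  "decreasing_lists k s = {ys. length ys = k \<and> sorted_wrt (>) ys \<and> set ys \<subseteq> {..<s}}"

lemma decreasing_set_inj: "inj_on set (decreasing_lists k s)"
proof (rule inj_onI)
  fix xs ys assume xy: "xs \<in> decreasing_lists k s" "ys \<in> decreasing_lists k s" "set xs = set ys"
  have "sorted_wrt (<) (rev xs)" "sorted_wrt (<) (rev ys)"
    using xy by (auto simp: decreasing_lists_def sorted_wrt_rev)
  hence "rev xs = rev ys" using xy(3) by (intro strict_sorted_equal) auto
  thus "xs = ys" by simp
qed

lemma decreasing_distinct: "sorted_wrt (>) (ys :: nat list) \<Longrightarrow> distinct ys"
  by (induction ys) auto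

lemma decreasing_set_bij:
  "bij_betw set (decreasing_lists k s) {S. S \<subseteq> {..<s} \<and> card S = k}"
  unfolding bij_betw_def
proof (intro conjI decreasing_set_inj equalityI subsetI)
  fix S assume "S \<in> set ` decreasing_lists k s"
  thus "S \<in> {S. S \<subseteq> {..<s} \<and> card S = k}"
    by (auto simp: decreasing_lists_def distinct_card decreasing_distinct)
next
  fix S assume S: "S \<in> {S. S \<subseteq> {..<s} \<and> card S = k}"
  hence "finite S" by (auto dest: finite_subset)
  hence "rev (sorted_list_of_set S) \<in> decreasing_lists k s" "set (rev (sorted_list_of_set S)) = S"
    using S by (auto simp: decreasing_lists_def sorted_wrt_rev)
  thus "S \<in> set ` decreasing_lists k s" using image_eqI by metis
qed

lemma card_decreasing_lists: "card (decreasing_lists k s) = s choose k"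
  using bij_betw_same_card[OF decreasing_set_bij] n_subsets[of "{..<s}" k] by simp

text \<open>
  The effect of taking complements on the exponents in one block, where \<open>s\<close> counts the variables from
  the start of the block on.
\<close>

definition reflect :: "nat \<Rightarrow> nat list \<Rightarrow> nat list" where
  "reflect s ys = map (\<lambda>x. s - 1 - x) (rev ys)"

lemma reflect_decreasing: "ys \<in> decreasing_lists k s \<Longrightarrow> reflect s ys \<in> decreasing_lists k s"
  by (auto simp: decreasing_lists_def reflect_def sorted_wrt_map sorted_wrt_rev
      elim!: sorted_wrt_mono_rel[rotated])

text \<open>A subset of an interval that is symmetric under reversal is determined by its size and its lower half.\<close>

lemma card_symmetric_subsets:
  "card {S. S \<subseteq> {..<s} \<and> card S = k \<and> (\<lambda>x. s - 1 - x) ` S = S}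
    = (if even s \<and> odd k then 0 else (s div 2) choose (k div 2))"
proof -
  define h where "h = s div 2"
  define r where "r x = s - 1 - x" for x
  let ?A = "{S. S \<subseteq> {..<s} \<and> card S = k \<and> r ` S = S}"
  define mid where "mid = (if odd s then {h} else {})"
  have rr: "r (r x) = x" if "x < s" for x using that by (simp add: r_def)
  have r_inj: "inj_on r {..<s}" by (rule inj_on_inverseI[of _ r]) (simp add: rr)
  have split: "S = (S \<inter> {..<h}) \<union> r ` (S \<inter> {..<h}) \<union> (S \<inter> mid)" if S: "S \<subseteq> {..<s}" "r ` S = S" for S
  proof (intro equalityI subsetI)
    fix x assume x: "x \<in> S"
    hence xs: "x < s" and rx: "r x \<in> S" using S by auto
    show "x \<in> (S \<inter> {..<h}) \<union> r ` (S \<inter> {..<h}) \<union> (S \<inter> mid)"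
    proof (cases "x < h")
      case False
      show ?thesis
      proof (cases "r x < h")
        case True
        hence "r (r x) \<in> r ` (S \<inter> {..<h})" using rx by blast
        thus ?thesis using rr[OF xs] by simp
      next
        case nr: False
        have "odd s \<and> x = h"
          using False nr xs unfolding h_def r_def by presburger
        thus ?thesis using x by (simp add: mid_def)
      qed
    qed (use x in simp)
  next
    fix x assume "x \<in> (S \<inter> {..<h}) \<union> r ` (S \<inter> {..<h}) \<union> (S \<inter> mid)"
    thus "x \<in> S" using S by blast
  qed
  have r_ge: "\<not> r x < h" "r x \<notin> mid" if "x < h" for x
    using that unfolding r_def h_def mid_def by (auto split: if_splits) presburger+
  have card_split: "card (T \<union> r ` T \<union> M) = 2 * card T + card M" if T: "T \<subseteq> {..<h}" and M: "M \<subseteq> mid" for T M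
  proof -
    have f: "finite T" "finite M" using T M finite_subset[of M mid] by (auto dest: finite_subset simp: mid_def)
    have "{..<h} \<subseteq> {..<s}" by (auto simp: h_def)
    hence "card (r ` T) = card T" using T by (intro card_image inj_on_subset[OF r_inj]) auto
    moreover have "T \<inter> r ` T = {}" using r_ge(1) T by blast
    moreover have "(T \<union> r ` T) \<inter> M = {}" using r_ge(2) T M by (auto simp: mid_def split: if_splits)
    ultimately show ?thesis using f by (simp add: card_Un_disjoint)
  qed
  have card_mid: "card (S \<inter> mid) \<le> 1" for S
  proof -
    have "card (S \<inter> mid) \<le> card mid" by (rule card_mono) (auto simp: mid_def)
    thus ?thesis by (simp add: mid_def split: if_splits)
  qed
  show ?thesis
  proof (cases "even s \<and> odd k")
    case True
    have "?A = {}"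
    proof (rule ccontr)
      assume "?A \<noteq> {}"
      then obtain S where S: "S \<subseteq> {..<s}" "card S = k" "r ` S = S" by blast
      have "card S = 2 * card (S \<inter> {..<h}) + card (S \<inter> mid)"
        by (subst split[OF S(1,3)]) (rule card_split; blast)
      thus False using True S(2) by (simp add: mid_def)
    qed
    thus ?thesis using True unfolding r_def by simp
  next
    case False
    define M where "M = (if odd k then {h} else {})"
    have M_mid: "M \<subseteq> mid" using False by (auto simp: M_def mid_def)
    have M_S: "S \<inter> mid = M" "card (S \<inter> {..<h}) = k div 2" if S: "S \<subseteq> {..<s}" "card S = k" "r ` S = S" for S
    proof -
      have "k = 2 * card (S \<inter> {..<h}) + card (S \<inter> mid)"
        unfolding S(2)[symmetric] by (subst split[OF S(1,3)]) (rule card_split; blast)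
      hence "card (S \<inter> mid) = k mod 2" "card (S \<inter> {..<h}) = k div 2" using card_mid[of S] by presburger+
      moreover have "S \<inter> mid = M" if "card (S \<inter> mid) = k mod 2"
        using that by (cases "h \<in> S") (auto simp: M_def mid_def odd_iff_mod_2_eq_one split: if_splits)
      ultimately show "S \<inter> mid = M" "card (S \<inter> {..<h}) = k div 2" by auto
    qed
    have "bij_betw (\<lambda>S. S \<inter> {..<h}) ?A {T. T \<subseteq> {..<h} \<and> card T = k div 2}"
    proof (rule bij_betw_byWitness[where f' = "\<lambda>T. T \<union> r ` T \<union> M"])
      show "\<forall>S\<in>?A. S \<inter> {..<h} \<union> r ` (S \<inter> {..<h}) \<union> M = S"
      proof
        fix S assume "S \<in> ?A"
        hence S: "S \<subseteq> {..<s}" "card S = k" "r ` S = S" by auto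
        show "S \<inter> {..<h} \<union> r ` (S \<inter> {..<h}) \<union> M = S"
          using split[OF S(1,3)] unfolding M_S(1)[OF S] by (rule sym)
      qed
      show "\<forall>T\<in>{T. T \<subseteq> {..<h} \<and> card T = k div 2}. (T \<union> r ` T \<union> M) \<inter> {..<h} = T"
        using r_ge(1) M_mid by (auto simp: mid_def split: if_splits)
      show "(\<lambda>S. S \<inter> {..<h}) ` ?A \<subseteq> {T. T \<subseteq> {..<h} \<and> card T = k div 2}"
        using M_S(2) by auto
      show "(\<lambda>T. T \<union> r ` T \<union> M) ` {T. T \<subseteq> {..<h} \<and> card T = k div 2} \<subseteq> ?A"
      proof clarify
        fix T assume T: "T \<subseteq> {..<h}" "card T = k div 2"
        have hs: "x < s" if "x \<in> T" for x using that T by (auto simp: h_def)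
        have "card M = k mod 2" by (auto simp: M_def odd_iff_mod_2_eq_one)
        hence "card (T \<union> r ` T \<union> M) = k" using card_split[OF T(1) M_mid] T(2) by simp
        moreover have M_s: "mid \<subseteq> {..<s}" and mid_fix: "\<And>x. x \<in> mid \<Longrightarrow> r x = x"
          unfolding mid_def h_def r_def by (auto split: if_splits) presburger+
        moreover have "r ` T \<subseteq> {..<s}" "T \<subseteq> {..<s}" by (auto simp: r_def dest!: hs)
        moreover have rrT: "r ` r ` T = T" using hs rr by (force simp: image_image)
        moreover have rM: "r ` M = M"
        proof -
          have "r ` M = (\<lambda>x. x) ` M" using M_mid mid_fix by (intro image_cong) auto
          thus ?thesis by simp
        qed
        ultimately show "T \<union> r ` T \<union> M \<subseteq> {..<s} \<and> card (T \<union> r ` T \<union> M) = k \<and> r ` (T \<union> r ` T \<union> M) = T \<union> r ` T \<union> M"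
          using M_mid by (simp add: image_Un rrT rM Un_commute)
      qed
    qed
    hence "card ?A = card {T. T \<subseteq> {..<h} \<and> card T = k div 2}" by (rule bij_betw_same_card)
    also have "\<dots> = h choose (k div 2)" using n_subsets[of "{..<h}"] by simp
    finally show ?thesis unfolding r_def h_def if_not_P[OF False] .
  qed
qed

lemma card_reflect_fixed:
  "card {ys \<in> decreasing_lists k s. reflect s ys = ys}
    = (if even s \<and> odd k then 0 else (s div 2) choose (k div 2))"
proof -
  have fix_iff: "reflect s ys = ys \<longleftrightarrow> (\<lambda>x. s - 1 - x) ` set ys = set ys" if ys: "ys \<in> decreasing_lists k s" for ys
  proof
    assume "(\<lambda>x. s - 1 - x) ` set ys = set ys"
    hence "set (reflect s ys) = set ys" by (simp add: reflect_def)
    thus "reflect s ys = ys" using decreasing_set_inj reflect_decreasing[OF ys] ys by (auto dest: inj_onD)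
  next
    assume "reflect s ys = ys"
    from arg_cong[OF this, of set] show "(\<lambda>x. s - 1 - x) ` set ys = set ys" by (simp add: reflect_def)
  qed
  have "bij_betw set {ys \<in> decreasing_lists k s. reflect s ys = ys}
      {S \<in> {S. S \<subseteq> {..<s} \<and> card S = k}. (\<lambda>x. s - 1 - x) ` S = S}"
    by (rule bij_betw_Collect[OF decreasing_set_bij]) (rule fix_iff[symmetric])
  hence "card {ys \<in> decreasing_lists k s. reflect s ys = ys}
      = card {S \<in> {S. S \<subseteq> {..<s} \<and> card S = k}. (\<lambda>x. s - 1 - x) ` S = S}"
    by (rule bij_betw_same_card)
  also have "{S \<in> {S. S \<subseteq> {..<s} \<and> card S = k}. (\<lambda>x. s - 1 - x) ` S = S}
      = {S. S \<subseteq> {..<s} \<and> card S = k \<and> (\<lambda>x. s - 1 - x) ` S = S}" by blast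
  finally show ?thesis unfolding card_symmetric_subsets .
qed

fun block_start :: "nat list \<Rightarrow> nat \<Rightarrow> nat" where
  "block_start [] i = 0"
| "block_start (k # ns) i = (if i < k then 0 else k + block_start ns (i - k))"

fun block_end :: "nat list \<Rightarrow> nat \<Rightarrow> nat" where
  "block_end [] i = 0"
| "block_end (k # ns) i = (if i < k then k else k + block_end ns (i - k))"

lemma blocks_list: "blocks (sum_list ns) (block_start ns) (block_end ns)"
proof (induction ns)
  case (Cons k ns)
  interpret blocks "sum_list ns" "block_start ns" "block_end ns" by fact
  show ?case
  proof
    fix i j assume i: "i < sum_list (k # ns)"
    have later: "i - k < sum_list ns" if "\<not> i < k" using that i by simp
    show "block_start (k # ns) i \<le> i"
      using st_le[OF later] i by (cases "i < k") auto
    show "i < block_end (k # ns) i"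
      using en_gt[OF later] i by (cases "i < k") auto
    show "block_end (k # ns) i \<le> sum_list (k # ns)"
      using en_le[OF later] i by (cases "i < k") auto
    assume j: "block_start (k # ns) i \<le> j" "j < block_end (k # ns) i"
    show "block_start (k # ns) j = block_start (k # ns) i \<and> block_end (k # ns) j = block_end (k # ns) i"
    proof (cases "i < k")
      case False
      have "block_start ns (i - k) \<le> j - k" "j - k < block_end ns (i - k)" "\<not> j < k"
        using j False by auto
      with same[OF later[OF False]] False show ?thesis by simp
    qed (use j in simp)
  qed
qed (unfold_locales, simp_all)

primrec shape_lists :: "nat list \<Rightarrow> nat list set" where
  "shape_lists [] = {[]}"
| "shape_lists (k # ns) =
     (\<lambda>(ys, zs). ys @ zs) ` (decreasing_lists k (k + sum_list ns) \<times> shape_lists ns)"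

primrec reflect_blocks :: "nat list \<Rightarrow> nat list \<Rightarrow> nat list" where
  "reflect_blocks [] xs = []"
| "reflect_blocks (k # ns) xs = reflect (k + sum_list ns) (take k xs) @ reflect_blocks ns (drop k xs)"

lemma append_decreasing_inj: "inj_on (\<lambda>(ys, zs). ys @ zs) (decreasing_lists k s \<times> Z)"
  by (auto simp: inj_on_def decreasing_lists_def)

text \<open>
  The binomial coefficients for the blocks multiply to the multinomial coefficient.
\<close>

lemma card_shape_lists: "card (shape_lists ns) * (\<Prod>k\<leftarrow>ns. fact k) = fact (sum_list ns)"
proof (induction ns)
  case (Cons k ns)
  have "card (shape_lists (k # ns)) = ((k + sum_list ns) choose k) * card (shape_lists ns)"
    by (simp add: card_image append_decreasing_inj card_cartesian_product card_decreasing_lists)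
  hence "card (shape_lists (k # ns)) * (\<Prod>k\<leftarrow>k # ns. fact k)
      = fact k * (card (shape_lists ns) * (\<Prod>k\<leftarrow>ns. fact k)) * ((k + sum_list ns) choose k)"
    by (simp only: list.map prod_list.Cons mult_ac)
  also have "\<dots> = fact (sum_list (k # ns))"
    unfolding Cons.IH using binomial_fact_lemma[of k "k + sum_list ns"] by simp
  finally show ?case .
qed simp

lemma reflect_blocks_append:
  "length ys = k \<Longrightarrow> reflect_blocks (k # ns) (ys @ zs) = reflect (k + sum_list ns) ys @ reflect_blocks ns zs"
  by simp

lemma parity_sum_list: "even (sum_list ns) \<longleftrightarrow> even (length (filter odd ns))"
  by (induction ns) auto

text \<open>
  Halving all block sizes, the binomial coefficients for the blocks again multiply to a multinomial
  coefficient.  With at least two odd blocks, the last but one of these sits at the start of an even number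
  of variables and admits no symmetric subset.
\<close>

lemma card_shape_lists_fixed:
  "card {xs \<in> shape_lists ns. reflect_blocks ns xs = xs} * (\<Prod>k\<leftarrow>ns. fact (k div 2))
    = (if length (filter odd ns) \<le> 1 then fact (sum_list ns div 2) else 0)"
proof (induction ns)
  case Nil
  have "{xs \<in> shape_lists []. reflect_blocks [] xs = xs} = {[]}" by auto
  thus ?case by simp
next
  case (Cons k ns)
  let ?s = "k + sum_list ns"
  let ?F = "{xs \<in> shape_lists ns. reflect_blocks ns xs = xs}"
  let ?D = "{ys \<in> decreasing_lists k ?s. reflect ?s ys = ys}"
  have len: "length (reflect ?s ys) = length ys" for ys by (simp add: reflect_def)
  have "{xs \<in> shape_lists (k # ns). reflect_blocks (k # ns) xs = xs} = (\<lambda>(ys, zs). ys @ zs) ` (?D \<times> ?F)"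
  proof (intro equalityI subsetI)
    fix xs assume xs: "xs \<in> {xs \<in> shape_lists (k # ns). reflect_blocks (k # ns) xs = xs}"
    then obtain ys zs where yz: "xs = ys @ zs" "ys \<in> decreasing_lists k ?s" "zs \<in> shape_lists ns" by auto
    have "length ys = k" using yz(2) by (simp add: decreasing_lists_def)
    hence "reflect ?s ys @ reflect_blocks ns zs = ys @ zs"
      using xs yz(1) reflect_blocks_append[of ys k ns zs] by simp
    hence "reflect ?s ys = ys" "reflect_blocks ns zs = zs" using len[of ys] by auto
    thus "xs \<in> (\<lambda>(ys, zs). ys @ zs) ` (?D \<times> ?F)" using yz by force
  next
    fix xs assume "xs \<in> (\<lambda>(ys, zs). ys @ zs) ` (?D \<times> ?F)"
    then obtain ys zs where yz: "xs = ys @ zs" "ys \<in> ?D" "zs \<in> ?F" by auto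
    hence "length ys = k" by (simp add: decreasing_lists_def)
    thus "xs \<in> {xs \<in> shape_lists (k # ns). reflect_blocks (k # ns) xs = xs}"
      using yz reflect_blocks_append[of ys k ns zs] by auto
  qed
  moreover have "inj_on (\<lambda>(ys, zs). ys @ zs) (?D \<times> ?F)"
    by (rule inj_on_subset[OF append_decreasing_inj[of k ?s ?F]]) auto
  ultimately have c: "card {xs \<in> shape_lists (k # ns). reflect_blocks (k # ns) xs = xs} = card ?D * card ?F"
    by (simp add: card_image card_cartesian_product)
  show ?case
  proof (cases "length (filter odd (k # ns)) \<le> 1")
    case True
    hence le: "length (filter odd ns) \<le> 1" by (simp split: if_splits)
    have par: "\<not> (odd k \<and> odd (sum_list ns))"
    proof
      assume "odd k \<and> odd (sum_list ns)"
      moreover from this have "length (filter odd ns) = 0" using True by simp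
      ultimately show False using parity_sum_list[of ns] by simp
    qed
    hence dv: "?s div 2 = k div 2 + sum_list ns div 2" and ne: "\<not> (even ?s \<and> odd k)"
      by presburger+
    have D: "card ?D = (?s div 2) choose (k div 2)"
      unfolding card_reflect_fixed using ne by (rule if_not_P)
    have IH: "card ?F * (\<Prod>k\<leftarrow>ns. fact (k div 2)) = fact (sum_list ns div 2)"
      using Cons.IH unfolding if_P[OF le] .
    have "card ?D * card ?F * (\<Prod>k\<leftarrow>k # ns. fact (k div 2))
        = fact (k div 2) * (card ?F * (\<Prod>k\<leftarrow>ns. fact (k div 2))) * card ?D"
      by (simp only: list.map prod_list.Cons mult_ac)
    also have "\<dots> = fact (?s div 2)"
      unfolding IH D using binomial_fact_lemma[of "k div 2" "?s div 2"] by (simp add: dv)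
    finally show ?thesis unfolding c if_P[OF True] sum_list.Cons .
  next
    case False
    have "card ?D * card ?F = 0"
    proof (cases "length (filter odd ns) \<le> 1")
      case True
      hence "odd k" using False by (auto split: if_splits)
      moreover have "length (filter odd ns) = 1" using True False \<open>odd k\<close> by (auto simp: le_Suc_eq)
      hence "odd (sum_list ns)" using parity_sum_list[of ns] by simp
      ultimately have "even ?s \<and> odd k" by simp
      hence "card ?D = 0" unfolding card_reflect_fixed by (rule if_P)
      thus ?thesis by (simp only: mult_0)
    next
      case False
      have "(\<Prod>k\<leftarrow>ns. fact (k div 2)) \<noteq> (0::nat)" by (induction ns) auto
      moreover have "card ?F * (\<Prod>k\<leftarrow>ns. fact (k div 2)) = 0"
        using Cons.IH unfolding if_not_P[OF False] .
      ultimately have "card ?F = 0" by (simp only: mult_eq_0_iff) blast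
      thus ?thesis by (simp only: mult_0_right)
    qed
    thus ?thesis unfolding c if_not_P[OF False] by (simp only: mult_zero_left)
  qed
qed

lemma shape_lists_iff:
  "xs \<in> shape_lists ns \<longleftrightarrow> length xs = sum_list ns \<and> (\<forall>i<sum_list ns. xs ! i < sum_list ns - block_start ns i) \<and>
     (\<forall>i<sum_list ns. \<forall>j<sum_list ns. block_start ns i = block_start ns j \<longrightarrow> i < j \<longrightarrow> xs ! j < xs ! i)"
proof (induction ns arbitrary: xs)
  case (Cons k ns)
  let ?n = "sum_list ns"
  show ?case
  proof
    assume "xs \<in> shape_lists (k # ns)"
    then obtain ys zs where yz: "xs = ys @ zs" "ys \<in> decreasing_lists k (k + ?n)" "zs \<in> shape_lists ns" by auto
    have ys: "length ys = k" "\<And>i j. i < j \<Longrightarrow> j < k \<Longrightarrow> ys ! j < ys ! i" "\<And>i. i < k \<Longrightarrow> ys ! i < k + ?n"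
      using yz(2) by (auto simp: decreasing_lists_def sorted_wrt_iff_nth_less subset_iff)
    note zs = yz(3)[unfolded Cons.IH]
    show "length xs = sum_list (k # ns) \<and> (\<forall>i<sum_list (k # ns). xs ! i < sum_list (k # ns) - block_start (k # ns) i) \<and>
      (\<forall>i<sum_list (k # ns). \<forall>j<sum_list (k # ns). block_start (k # ns) i = block_start (k # ns) j \<longrightarrow> i < j \<longrightarrow> xs ! j < xs ! i)"
    proof (intro conjI allI impI)
      show "length xs = sum_list (k # ns)" using yz(1) ys zs by simp
    next
      fix i assume "i < sum_list (k # ns)"
      thus "xs ! i < sum_list (k # ns) - block_start (k # ns) i"
        using ys zs by (cases "i < k") (auto simp: yz(1) nth_append)
    next
      fix i j assume "i < sum_list (k # ns)" "j < sum_list (k # ns)"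
        "block_start (k # ns) i = block_start (k # ns) j" "i < j"
      thus "xs ! j < xs ! i"
        using ys zs by (cases "j < k"; cases "i < k") (auto simp: yz(1) nth_append)
    qed
  next
    assume R: "length xs = sum_list (k # ns) \<and> (\<forall>i<sum_list (k # ns). xs ! i < sum_list (k # ns) - block_start (k # ns) i) \<and>
      (\<forall>i<sum_list (k # ns). \<forall>j<sum_list (k # ns). block_start (k # ns) i = block_start (k # ns) j \<longrightarrow> i < j \<longrightarrow> xs ! j < xs ! i)"
    hence len: "length xs = k + ?n" by simp
    have lt: "xs ! i < k + ?n - block_start (k # ns) i" if "i < k + ?n" for i
      using R that by simp
    have dec: "xs ! j < xs ! i" if "i < j" "j < k + ?n" "block_start (k # ns) i = block_start (k # ns) j" for i j
      using conjunct2[OF conjunct2[OF R], rule_format, of i j] that by simp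
    have "take k xs \<in> decreasing_lists k (k + ?n)"
      unfolding decreasing_lists_def sorted_wrt_iff_nth_less
    proof (intro CollectI conjI allI impI subsetI)
      show "length (take k xs) = k" using len by simp
      show "take k xs ! i > take k xs ! j" if "i < j" "j < length (take k xs)" for i j
        using dec[of i j] that len by simp
      fix x assume "x \<in> set (take k xs)"
      then obtain i where "i < k" "x = xs ! i" using len by (auto simp: in_set_conv_nth)
      thus "x \<in> {..<k + ?n}" using lt[of i] by simp
    qed
    moreover have "drop k xs \<in> shape_lists ns"
      unfolding Cons.IH
    proof (intro conjI allI impI)
      show "length (drop k xs) = ?n" using len by simp
      show "drop k xs ! i < ?n - block_start ns i" if "i < ?n" for i
        using lt[of "k + i"] that len by simp
      show "drop k xs ! j < drop k xs ! i"
        if "i < ?n" "j < ?n" "block_start ns i = block_start ns j" "i < j" for i j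
        using dec[of "k + i" "k + j"] that len by simp
    qed
    ultimately show "xs \<in> shape_lists (k # ns)"
      by (auto intro!: image_eqI[of _ _ "(take k xs, drop k xs)"])
  qed
qed simp

lemma reflect_blocks_nth:
  "length xs = sum_list ns \<Longrightarrow> length (reflect_blocks ns xs) = sum_list ns \<and> (\<forall>i<sum_list ns.
     reflect_blocks ns xs ! i = sum_list ns - 1 - block_start ns i - xs ! (block_start ns i + block_end ns i - 1 - i))"
proof (induction ns arbitrary: xs)
  case (Cons k ns)
  interpret blocks "sum_list ns" "block_start ns" "block_end ns" by (rule blocks_list)
  let ?n = "sum_list ns"
  have IH: "length (reflect_blocks ns (drop k xs)) = ?n"
    "\<And>i. i < ?n \<Longrightarrow> reflect_blocks ns (drop k xs) ! i
       = ?n - 1 - block_start ns i - drop k xs ! (block_start ns i + block_end ns i - 1 - i)"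
    using Cons.IH[of "drop k xs"] Cons.prems by auto
  have lenr: "length (reflect (k + ?n) (take k xs)) = k" using Cons.prems by (simp add: reflect_def)
  show ?case
  proof (intro conjI allI impI)
    show "length (reflect_blocks (k # ns) xs) = sum_list (k # ns)" using IH lenr by simp
    fix i assume i: "i < sum_list (k # ns)"
    show "reflect_blocks (k # ns) xs ! i = sum_list (k # ns) - 1 - block_start (k # ns) i
        - xs ! (block_start (k # ns) i + block_end (k # ns) i - 1 - i)"
    proof (cases "i < k")
      case True
      thus ?thesis using Cons.prems lenr by (simp add: nth_append) (simp add: reflect_def rev_nth)
    next
      case False
      define l where "l = i - k"
      have l: "i = k + l" "l < ?n" using False i by (auto simp: l_def)
      have b: "block_start ns l \<le> l" "l < block_end ns l" using st_le[OF l(2)] en_gt[OF l(2)] by auto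
      have "drop k xs ! (block_start ns l + block_end ns l - 1 - l)
          = xs ! (k + (block_start ns l + block_end ns l - 1 - l))"
        using Cons.prems by simp
      also have "k + (block_start ns l + block_end ns l - 1 - l)
          = block_start (k # ns) i + block_end (k # ns) i - 1 - i"
        using b by (simp add: l(1))
      finally show ?thesis using IH(2)[OF l(2)] lenr by (simp add: nth_append l(1))
    qed
  qed
qed simp

context
  fixes ns :: "nat list"
begin

interpretation blocks "sum_list ns" "block_start ns" "block_end ns"
  by (rule blocks_list)

text \<open>
  Listing the exponents of a shape separates the blocks: the conditions on different blocks are
  independent.
\<close>

lemma shapes_bij: "bij_betw (\<lambda>w. map (lookup w) [0..<sum_list ns]) shapes (shape_lists ns)"
proof (rule bij_betw_byWitness[where f' = "\<lambda>xs. expo (sum_list ns) (\<lambda>i. xs ! i)"])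
  show "\<forall>w\<in>shapes. expo (sum_list ns) (\<lambda>i. map (lookup w) [0..<sum_list ns] ! i) = w"
    by (auto simp: shapes_def intro!: poly_mapping_eqI)
  show "\<forall>xs\<in>shape_lists ns. map (lookup (expo (sum_list ns) (\<lambda>i. xs ! i))) [0..<sum_list ns] = xs"
    by (auto simp: shape_lists_iff intro!: nth_equalityI)
  show "(\<lambda>w. map (lookup w) [0..<sum_list ns]) ` shapes \<subseteq> shape_lists ns"
    by (auto simp: shapes_def shape_lists_iff)
  show "(\<lambda>xs. expo (sum_list ns) (\<lambda>i. xs ! i)) ` shape_lists ns \<subseteq> shapes"
    by (auto simp: shapes_def shape_lists_iff)
qed

lemma shapes_compl_reflect:
  "map (lookup (compl w)) [0..<sum_list ns] = reflect_blocks ns (map (lookup w) [0..<sum_list ns])"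
proof (rule nth_equalityI)
  let ?xs = "map (lookup w) [0..<sum_list ns]"
  have len: "length ?xs = sum_list ns" by simp
  note R = reflect_blocks_nth[OF len]
  show "length (map (lookup (compl w)) [0..<sum_list ns]) = length (reflect_blocks ns ?xs)" using R by simp
  fix i assume "i < length (map (lookup (compl w)) [0..<sum_list ns])"
  hence i: "i < sum_list ns" by simp
  have "block_start ns i + block_end ns i - 1 - i < sum_list ns"
    using block_rev_simps(1)[OF i] i by (simp add: block_rev_def)
  thus "map (lookup (compl w)) [0..<sum_list ns] ! i = reflect_blocks ns ?xs ! i"
    using R i by (simp add: block_rev_def)
qed

lemma card_shapes: "card shapes = fact (sum_list ns) div (\<Prod>k\<leftarrow>ns. fact k)"
proof -
  have "(\<Prod>k\<leftarrow>ns. fact k) \<noteq> (0::nat)" by (induction ns) auto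
  from nonzero_mult_div_cancel_right[OF this, of "card (shape_lists ns)"]
  show ?thesis unfolding bij_betw_same_card[OF shapes_bij] card_shape_lists by (rule sym)
qed

lemma card_shapes_fixed:
  "card {w \<in> shapes. compl w = w} = (if length (filter odd ns) \<le> 1
     then fact (sum_list ns div 2) div (\<Prod>k\<leftarrow>ns. fact (k div 2)) else 0)"
proof -
  let ?m = "\<lambda>w. map (lookup w) [0..<sum_list ns]"
  have inj: "inj_on ?m shapes" and img: "?m ` shapes = shape_lists ns"
    using shapes_bij by (auto simp: bij_betw_def)
  have fix_iff: "compl w = w \<longleftrightarrow> reflect_blocks ns (?m w) = ?m w" if w: "w \<in> shapes" for w
    unfolding shapes_compl_reflect[symmetric]
    using inj_on_eq_iff[OF inj compl_shapes[OF w] w] by simp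
  have "bij_betw ?m {w \<in> shapes. compl w = w} {xs \<in> shape_lists ns. reflect_blocks ns xs = xs}"
    by (rule bij_betw_Collect[OF shapes_bij]) (rule fix_iff[symmetric])
  hence c: "card {w \<in> shapes. compl w = w} = card {xs \<in> shape_lists ns. reflect_blocks ns xs = xs}"
    by (rule bij_betw_same_card)
  have "(\<Prod>k\<leftarrow>ns. fact (k div 2)) \<noteq> (0::nat)" by (induction ns) auto
  from nonzero_mult_div_cancel_right[OF this, of "card {w \<in> shapes. compl w = w}"]
  have "card {w \<in> shapes. compl w = w}
      = (if length (filter odd ns) \<le> 1 then fact (sum_list ns div 2) else 0) div (\<Prod>k\<leftarrow>ns. fact (k div 2))"
    unfolding c card_shape_lists_fixed by (rule sym)
  thus ?thesis by (cases "length (filter odd ns) \<le> 1") (simp_all only: if_True if_False div_0)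
qed

end

section \<open>The quotient map of a Young subgroup\<close>

lemma block_coords_nth:
  assumes "i < sum_list ns"
  shows "block_coords ns ! i = (blocks.coord (block_start ns) (block_end ns) i :: 'a::field mpoly)"
proof -
  define bc where "bc s ns = (concat (map (\<lambda>k. map (\<lambda>j. esym {s + sum_list (take k ns)..<s + sum_list (take (Suc k) ns)} (Suc j))
     [0..<ns ! k]) [0..<length ns]) :: 'a mpoly list)" for s :: nat and ns
  have bc_Cons: "bc s (m # ns) = map (\<lambda>j. esym {s..<s + m} (Suc j)) [0..<m] @ bc (s + m) ns" for s m ns
  proof -
    have "[0..<length (m # ns)] = 0 # map Suc [0..<length ns]"
      by (simp add: upt_conv_Cons map_Suc_upt del: upt_Suc)
    thus ?thesis unfolding bc_def by (simp add: comp_def add.assoc)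
  qed
  have "bc s ns ! i = esym {s + block_start ns i..<s + block_end ns i} (Suc (i - block_start ns i))"
    if "i < sum_list ns" for s
    using that
  proof (induction ns arbitrary: s i)
    case (Cons m ns)
    show ?case
    proof (cases "i < m")
      case False
      hence "i - m < sum_list ns" using Cons.prems by simp
      from Cons.IH[OF this, of "s + m"] show ?thesis
        using False by (simp add: bc_Cons nth_append add.assoc)
    qed (simp add: bc_Cons nth_append)
  qed simp
  from this[OF assms, of 0] show ?thesis
    by (simp add: bc_def block_coords_def block_def blocks.coord_def[OF blocks_list])
qed

text \<open>
  The preimages under \<open>coord_hom ns\<close> exist because symmetric polynomials are in particular
  block-symmetric, and are unique by algebraic independence.
\<close>

lemma sym_quotient_map_block_quotient:
  assumes char: "CHAR('a::field) \<noteq> 2"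
  shows "block_quotient (sum_list ns) (block_start ns) (block_end ns) (sym_quotient_map ns :: nat \<Rightarrow> 'a mpoly)"
proof -
  interpret blocks "sum_list ns" "block_start ns" "block_end ns" by (rule blocks_list)
  let ?n = "sum_list ns"
  have hom: "coord_hom ns p = ev p" if "p \<in> mpolys ?n" for p :: "'a mpoly"
    unfolding coord_hom_def ev_def using that by (rule mpoly_subst_cong) (rule block_coords_nth)
  have inj: "inj_on (coord_hom ns) (mpolys ?n :: 'a mpoly set)"
    using ev_inj inj_on_cong[of "mpolys ?n" "coord_hom ns" ev] hom by blast
  have "sym_quotient_map ns i \<in> (mpolys ?n :: 'a mpoly set) \<and> ev (sym_quotient_map ns i) = (esym {..<?n} (Suc i) :: 'a mpoly)"
    if i: "i < ?n" for i
  proof -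
    have "act \<sigma> (esym {..<?n} (Suc i)) = (esym {..<?n} (Suc i) :: 'a mpoly)" if "\<sigma> \<in> young" for \<sigma>
      by (rule esym_act[OF young_bij[OF that] permutes_image[OF young_permutes[OF that]]])
    then obtain p :: "'a mpoly" where p: "p \<in> mpolys ?n" "esym {..<?n} (Suc i) = ev p"
      using block_symmetric_ev[OF two_nonzero[OF char] esym_mpolys[OF order_refl]] by blast
    have "sym_quotient_map ns i = p"
      unfolding sym_quotient_map_def coord_hom_single[OF i] p(2) hom[OF p(1), symmetric]
      by (rule the_inv_into_f_f[OF inj p(1)])
    thus ?thesis using p by simp
  qed
  thus ?thesis using char by unfold_locales auto
qed

theorem theorem2:
  fixes ns :: "nat list" and \<pi> :: "nat \<Rightarrow> 'a::field mpoly" and n N a :: nat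
  assumes "CHAR('a) \<noteq> 2"
    and "ns \<noteq> []" and "\<forall>k\<in>set ns. 0 < k"
    and "n = sum_list ns"
    and "\<pi> = sym_quotient_map ns"
    and "N = fact n div (\<Prod>k\<leftarrow>ns. fact k)"
    and "a = (if length (filter odd ns) \<le> 1
              then fact (n div 2) div (\<Prod>k\<leftarrow>ns. fact (k div 2)) else 0)"
  shows "even (int (local_degree n \<pi>) - int a) \<and> even (int N + int a) \<and>
    EKL_degree n \<pi> =
      of_int ((int (local_degree n \<pi>) - int a) div 2) * (gw_unit 1 + gw_unit (-1))
      + of_int (int a) * gw_unit 1 \<and>
    EKL_degree n \<pi> =
      of_int ((int N + int a) div 2) * gw_unit 1 + of_int ((int N - int a) div 2) * gw_unit (-1)"
proof -
  interpret block_quotient n "block_start ns" "block_end ns" \<pi>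
    using sym_quotient_map_block_quotient[OF assms(1)] assms(4,5) by simp
  have N: "card shapes = N" using card_shapes[of ns] assms(4,6) by simp
  have a: "card {w \<in> shapes. compl w = w} = a" using card_shapes_fixed[of ns] assms(4,7) by simp
  obtain h where h: "local_degree n \<pi> = N" "N = a + 2 * h"
    "EKL_degree n \<pi> = of_nat h * (gw_unit 1 + gw_unit (-1)) + of_nat a * gw_unit 1"
    using EKL_degree_quotient unfolding N a by blast
  have "(int N - int a) div 2 = int h" "(int N + int a) div 2 = int (h + a)" using h(2) by auto
  thus ?thesis using h by (simp add: algebra_simps)
qed

end
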